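(* Let $n\ge 1$. The smooth map $$\varphi:\mathrm{U}(n)\times\mathrm{U}(n)\times\overrightarrow{\mathbb{R}}_+^n\to M_{n\times n}(\mathbb{C})^\times,\qquad \varphi(U,V,x)=U D(x) V,$$ satisfies the following properties. (1) $\varphi$ is a smooth submersion. (2) The $\mathbb{T}^n$-action on $\mathrm{U}(n)\times\mathrm{U}(n)\times\overrightarrow{\mathbb{R}}_+^n$ is proper and free. (3) For every $Z\in M_{n\times n}(\mathbb{C})^\times$, the fiber $\varphi^{-1}(Z)$ is a $\mathbb{T}^n$-orbit. In other words, $\mathrm{U}(n)\times\mathrm{U}(n)\times\overrightarrow{\mathbb{R}}_+^n$ is a principal fiber bundle over $M_{n\times n}(\mathbb{C})^\times$ with projection $\varphi$ and structure group $\mathbb{T}^n$. In particular, there is an induced diffeomorphism $$\widehat{\varphi}:(\mathrm{U}(n)\times\mathrm{U}(n))/\mathbb{T}^n\times\overrightarrow{\mathbb{R}}_+^n\to M_{n\times n}(\mathbb{C})^\times,\qquad \widehat{\varphi}([U,V],x)=U D(x) V,$$ where $[U,V]$ denotes the class of $(U,V)$ in the quotient of $\mathrm{U}(n)\times\mathrm{U}(n)$ by the $\mathbb{T}^n$-action.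
   Context: $\mathrm{U}(n)$ is the unitary group and $\mathbb{T}\subset\mathbb{C}$ is the unit circle. For $z\in\mathbb{C}^n$, $D(z)$ is the diagonal $n\times n$ matrix whose diagonal entries are the components of $z$. $M_{n\times n}(\mathbb{C})^\times$ is the set of complex $n\times n$ matrices $Z$ such that $ZZ^*$ is positive definite with all of its eigenvalues of multiplicity one; it is open, dense and conull in $M_{n\times n}(\mathbb{C})$. $\overrightarrow{\mathbb{R}}_+^n=\{x\in\mathbb{R}^n: x_1>\dots>x_n>0\}$. The $\mathbb{T}^n$-action on $\mathrm{U}(n)\times\mathrm{U}(n)$ is $t\cdot(U,V)=(U D(\overline{t}),D(t)V)$, and $\mathbb{T}^n$ acts on $\mathrm{U}(n)\times\mathrm{U}(n)\times\overrightarrow{\mathbb{R}}_+^n$ by this action on the first two factors and trivially on $\overrightarrow{\mathbb{R}}_+^n$. A submersion is a surjective smooth map whose differential at every point is surjective. *)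

theory Defs
  imports
    "HOL-Analysis.Analysis"
    "HOL-Computational_Algebra.Polynomial"
    "HOL-Algebra.Group_Action"
begin

section \<open>Smooth functions on subsets of Euclidean spaces\<close>

primrec Ck_on :: "nat \<Rightarrow> 'a::euclidean_space set \<Rightarrow> ('a \<Rightarrow> 'b::euclidean_space) \<Rightarrow> bool" where
  "Ck_on 0 T f \<longleftrightarrow> continuous_on T f"
| "Ck_on (Suc k) T f \<longleftrightarrow>
     (\<forall>x\<in>T. f differentiable (at x)) \<and>
     (\<forall>v. Ck_on k T (\<lambda>x. frechet_derivative f (at x) v))"

text \<open>A function on an arbitrary subset of a Euclidean space is smooth if it extends locally to
  a function that is smooth on an open set of the ambient space. For open sets this is the usual
  notion. Complex vector spaces are regarded as real ones throughout.\<close>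

definition smooth_on :: "'a::euclidean_space set \<Rightarrow> ('a \<Rightarrow> 'b::euclidean_space) \<Rightarrow> bool" where
  "smooth_on S f \<longleftrightarrow>
     (\<forall>x\<in>S. \<exists>T g. open T \<and> x \<in> T \<and> (\<forall>k. Ck_on k T g) \<and> (\<forall>y\<in>S \<inter> T. g y = f y))"


section \<open>Smooth manifolds\<close>

text \<open>The type \<open>'e\<close> is the Euclidean space on which the manifold is modelled. A chart is a pair
  of its domain and its coordinate function; values of the latter off the domain are irrelevant.
  The family of charts need not be maximal.\<close>

record ('a, 'e) mfd =
  mtop :: "'a topology"
  charts :: "('a set \<times> ('a \<Rightarrow> 'e)) set"

definition smooth_manifold :: "('a, 'e::euclidean_space) mfd \<Rightarrow> bool" where
  "smooth_manifold M \<longleftrightarrow>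
     Hausdorff_space (mtop M) \<and> second_countable (mtop M) \<and>
     (\<forall>(U, \<phi>)\<in>charts M. openin (mtop M) U \<and> open (\<phi> ` U) \<and>
        homeomorphic_map (subtopology (mtop M) U) (top_of_set (\<phi> ` U)) \<phi>) \<and>
     (\<Union>(U, \<phi>)\<in>charts M. U) = topspace (mtop M) \<and>
     (\<forall>(U, \<phi>)\<in>charts M. \<forall>(V, \<psi>)\<in>charts M. smooth_on (\<phi> ` (U \<inter> V)) (\<psi> \<circ> inv_into U \<phi>))"

definition smooth_map ::
  "('a, 'e::euclidean_space) mfd \<Rightarrow> ('b, 'f::euclidean_space) mfd \<Rightarrow> ('a \<Rightarrow> 'b) \<Rightarrow> bool" where
  "smooth_map M N f \<longleftrightarrow>
     continuous_map (mtop M) (mtop N) f \<and>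
     (\<forall>(U, \<phi>)\<in>charts M. \<forall>(V, \<psi>)\<in>charts N.
        smooth_on (\<phi> ` (U \<inter> f -` V)) (\<psi> \<circ> f \<circ> inv_into U \<phi>))"

definition submersion ::
  "('a, 'e::euclidean_space) mfd \<Rightarrow> ('b, 'f::euclidean_space) mfd \<Rightarrow> ('a \<Rightarrow> 'b) \<Rightarrow> bool" where
  "submersion M N f \<longleftrightarrow>
     smooth_map M N f \<and> f ` topspace (mtop M) = topspace (mtop N) \<and>
     (\<forall>(U, \<phi>)\<in>charts M. \<forall>(V, \<psi>)\<in>charts N. \<forall>p\<in>U \<inter> f -` V.
        surj (frechet_derivative (\<psi> \<circ> f \<circ> inv_into U \<phi>) (at (\<phi> p))))"

definition diffeomorphism ::
  "('a, 'e::euclidean_space) mfd \<Rightarrow> ('b, 'f::euclidean_space) mfd \<Rightarrow> ('a \<Rightarrow> 'b) \<Rightarrow> bool" where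
  "diffeomorphism M N f \<longleftrightarrow>
     bij_betw f (topspace (mtop M)) (topspace (mtop N)) \<and>
     smooth_map M N f \<and> smooth_map N M (inv_into (topspace (mtop M)) f)"

definition prod_mfd :: "('a, 'e) mfd \<Rightarrow> ('b, 'f) mfd \<Rightarrow> ('a \<times> 'b, 'e \<times> 'f) mfd" where
  "prod_mfd M N =
     \<lparr>mtop = prod_topology (mtop M) (mtop N),
      charts = {(U \<times> V, map_prod \<phi> \<psi>) | U \<phi> V \<psi>. (U, \<phi>) \<in> charts M \<and> (V, \<psi>) \<in> charts N}\<rparr>"

definition open_mfd :: "('a, 'e) mfd \<Rightarrow> 'a set \<Rightarrow> ('a, 'e) mfd" where
  "open_mfd M W =
     \<lparr>mtop = subtopology (mtop M) W, charts = {(U \<inter> W, \<phi>) | U \<phi>. (U, \<phi>) \<in> charts M}\<rparr>"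

text \<open>A subset of a Euclidean space with all its local parametrisations by open subsets of the
  model space. It satisfies \<open>smooth_manifold\<close> iff the subset is an embedded submanifold whose
  dimension is that of the model space.\<close>

definition embedded_mfd :: "'a::euclidean_space set \<Rightarrow> ('a, 'e::euclidean_space) mfd" where
  "embedded_mfd S =
     \<lparr>mtop = top_of_set S,
      charts = {(U, \<phi>). openin (top_of_set S) U \<and> inj_on \<phi> U \<and> open (\<phi> ` U) \<and>
                        smooth_on U \<phi> \<and> smooth_on (\<phi> ` U) (inv_into U \<phi>)}\<rparr>"


section \<open>Actions of Lie groups\<close>

definition lie_group :: "'g monoid \<Rightarrow> ('g, 'h::euclidean_space) mfd \<Rightarrow> bool" where
  "lie_group G L \<longleftrightarrow>
     group G \<and> smooth_manifold L \<and> topspace (mtop L) = carrier G \<and>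
     smooth_map (prod_mfd L L) L (\<lambda>(g, h). g \<otimes>\<^bsub>G\<^esub> h) \<and> smooth_map L L (\<lambda>g. inv\<^bsub>G\<^esub> g)"

definition free_action :: "'g monoid \<Rightarrow> 'p set \<Rightarrow> ('g \<Rightarrow> 'p \<Rightarrow> 'p) \<Rightarrow> bool" where
  "free_action G E act \<longleftrightarrow> (\<forall>g\<in>carrier G. \<forall>p\<in>E. act g p = p \<longrightarrow> g = \<one>\<^bsub>G\<^esub>)"

definition proper_action :: "('g, 'h) mfd \<Rightarrow> ('p, 'e) mfd \<Rightarrow> ('g \<Rightarrow> 'p \<Rightarrow> 'p) \<Rightarrow> bool" where
  "proper_action L P act \<longleftrightarrow>
     proper_map (prod_topology (mtop L) (mtop P)) (prod_topology (mtop P) (mtop P))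
       (\<lambda>(g, p). (act g p, p))"

text \<open>Principal bundles with the structure group acting from the left.\<close>

definition principal_bundle ::
  "'g monoid \<Rightarrow> ('g, 'h::euclidean_space) mfd \<Rightarrow> ('p, 'e::euclidean_space) mfd \<Rightarrow>
   ('b, 'f::euclidean_space) mfd \<Rightarrow> ('p \<Rightarrow> 'b) \<Rightarrow> ('g \<Rightarrow> 'p \<Rightarrow> 'p) \<Rightarrow> bool" where
  "principal_bundle G L P B \<pi> act \<longleftrightarrow>
     lie_group G L \<and> smooth_manifold P \<and> smooth_manifold B \<and>
     group_action G (topspace (mtop P)) act \<and>
     smooth_map (prod_mfd L P) P (\<lambda>(g, p). act g p) \<and>
     smooth_map P B \<pi> \<and>
     (\<forall>b\<in>topspace (mtop B). \<exists>W \<tau>. openin (mtop B) W \<and> b \<in> W \<and>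
        (let PW = {p \<in> topspace (mtop P). \<pi> p \<in> W} in
           diffeomorphism (open_mfd P PW) (prod_mfd (open_mfd B W) L) \<tau> \<and>
           (\<forall>p\<in>PW. fst (\<tau> p) = \<pi> p \<and>
              (\<forall>g\<in>carrier G. snd (\<tau> (act g p)) = g \<otimes>\<^bsub>G\<^esub> snd (\<tau> p)))))"

text \<open>\<open>Q\<close> is the orbit space with the quotient topology and the (unique) smooth structure for
  which the orbit map is a submersion.\<close>

definition quotient_manifold ::
  "'g monoid \<Rightarrow> ('p, 'e::euclidean_space) mfd \<Rightarrow> ('g \<Rightarrow> 'p \<Rightarrow> 'p) \<Rightarrow>
   ('p set, 'q::euclidean_space) mfd \<Rightarrow> bool" where
  "quotient_manifold G P act Q \<longleftrightarrow>
     smooth_manifold Q \<and>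
     topspace (mtop Q) = orbits G (topspace (mtop P)) act \<and>
     quotient_map (mtop P) (mtop Q) (orbit G act) \<and>
     submersion P Q (orbit G act)"


section \<open>Matrices\<close>

text \<open>Here \<open>n = CARD('n)\<close>; the order of the coordinates is that of the index type.\<close>

type_synonym 'n rvec = "(real, 'n) vec"
type_synonym 'n rmat = "((real, 'n) vec, 'n) vec"
type_synonym 'n cvec = "(complex, 'n) vec"
type_synonym 'n cmat = "((complex, 'n) vec, 'n) vec"

definition ctrans :: "('n::finite) cmat \<Rightarrow> 'n cmat" where
  "ctrans A = (\<chi> i j. cnj (A $ j $ i))"

definition diag_mat :: "('n::finite) cvec \<Rightarrow> 'n cmat" where
  "diag_mat z = (\<chi> i j. if i = j then z $ i else 0)"

definition cnj_vec :: "('n::finite) cvec \<Rightarrow> 'n cvec" where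
  "cnj_vec z = (\<chi> i. cnj (z $ i))"

definition complex_vec :: "('n::finite) rvec \<Rightarrow> 'n cvec" where
  "complex_vec x = (\<chi> i. complex_of_real (x $ i))"

definition positive_definite :: "('n::finite) cmat \<Rightarrow> bool" where
  "positive_definite A \<longleftrightarrow>
     ctrans A = A \<and> (\<forall>v. v \<noteq> 0 \<longrightarrow> 0 < Re (\<Sum>i\<in>UNIV. cnj (v $ i) * (A *v v) $ i))"

definition eigenvalue :: "('n::finite) cmat \<Rightarrow> complex \<Rightarrow> bool" where
  "eigenvalue A c \<longleftrightarrow> (\<exists>v. v \<noteq> 0 \<and> A *v v = c *s v)"

definition char_poly :: "('n::finite) cmat \<Rightarrow> complex poly" where
  "char_poly A = det (\<chi> i j. (if i = j then [:0, 1:] else 0) - [:A $ i $ j:])"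

definition eigenvalue_multiplicity :: "('n::finite) cmat \<Rightarrow> complex \<Rightarrow> nat" where
  "eigenvalue_multiplicity A c = Polynomial.order c (char_poly A)"

definition unitary_group :: "('n::finite) cmat set" where
  "unitary_group = {U. ctrans U ** U = mat 1 \<and> U ** ctrans U = mat 1}"

definition regular_matrices :: "('n::finite) cmat set" where
  "regular_matrices = {Z. positive_definite (Z ** ctrans Z) \<and>
     (\<forall>c. eigenvalue (Z ** ctrans Z) c \<longrightarrow> eigenvalue_multiplicity (Z ** ctrans Z) c = 1)}"

definition decreasing_cone :: "('n::{finite,linorder}) rvec set" where
  "decreasing_cone = {x. (\<forall>i j. i < j \<longrightarrow> x $ i > x $ j) \<and> (\<forall>i. x $ i > 0)}"

definition torus :: "('n::finite) cvec monoid" where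
  "torus = \<lparr>carrier = {t. \<forall>i. norm (t $ i) = 1}, mult = (*), one = 1\<rparr>"


section \<open>The manifolds and the actions\<close>

definition unitary_mfd :: "(('n::finite) cmat, 'n rmat) mfd" where
  "unitary_mfd = embedded_mfd unitary_group"

definition torus_mfd :: "(('n::finite) cvec, 'n rvec) mfd" where
  "torus_mfd = embedded_mfd (carrier torus)"

definition cone_mfd :: "(('n::{finite,linorder}) rvec, 'n rvec) mfd" where
  "cone_mfd = embedded_mfd decreasing_cone"

definition regular_mfd :: "(('n::finite) cmat, 'n cmat) mfd" where
  "regular_mfd = embedded_mfd regular_matrices"

abbreviation UU_mfd ::
  "(('n::finite) cmat \<times> 'n cmat, 'n rmat \<times> 'n rmat) mfd" where
  "UU_mfd \<equiv> prod_mfd unitary_mfd unitary_mfd"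

abbreviation UUR_mfd ::
  "(('n::{finite,linorder}) cmat \<times> 'n cmat \<times> 'n rvec,
    'n rmat \<times> 'n rmat \<times> 'n rvec) mfd" where
  "UUR_mfd \<equiv> prod_mfd unitary_mfd (prod_mfd unitary_mfd cone_mfd)"

text \<open>Group actions in \<open>HOL-Algebra\<close> are by extensional functions, hence the restrictions.\<close>

definition UU_act ::
  "('n::finite) cvec \<Rightarrow> 'n cmat \<times> 'n cmat \<Rightarrow> 'n cmat \<times> 'n cmat" where
  "UU_act t = (\<lambda>(U, V)\<in>unitary_group \<times> unitary_group.
     (U ** diag_mat (cnj_vec t), diag_mat t ** V))"

definition UUR_act ::
  "('n::{finite,linorder}) cvec \<Rightarrow> 'n cmat \<times> 'n cmat \<times> 'n rvec \<Rightarrow>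
   'n cmat \<times> 'n cmat \<times> 'n rvec" where
  "UUR_act t = (\<lambda>(U, V, x)\<in>unitary_group \<times> unitary_group \<times> decreasing_cone.
     (U ** diag_mat (cnj_vec t), diag_mat t ** V, x))"

definition svd_map ::
  "('n::{finite,linorder}) cmat \<times> 'n cmat \<times> 'n rvec \<Rightarrow> 'n cmat" where
  "svd_map = (\<lambda>(U, V, x). U ** diag_mat (complex_vec x) ** V)"

text \<open>An index type of cardinality \<open>n\<^sup>2 + n (n - 1)\<close>, the dimension of the quotient of
  \<open>U(n) \<times> U(n)\<close> by the \<open>n\<close>-torus.\<close>

typedef 'n quot_index = "{(b::bool, i::'n, j::'n). b \<or> i \<noteq> j}"
  by auto

instance quot_index :: (finite) finite
proof
  have "(UNIV :: 'a quot_index set) = Abs_quot_index ` {(b::bool, i::'a, j::'a). b \<or> i \<noteq> j}"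
    using type_definition.Abs_image[OF type_definition_quot_index] by metis
  then show "finite (UNIV :: 'a quot_index set)"
    by (metis finite finite_imageI)
qed

lemma card_quot_index: "CARD('n::finite quot_index) = 2 * CARD('n) ^ 2 - CARD('n)"
proof -
  have "{(b::bool, i::'n, j::'n). b \<or> i \<noteq> j} = UNIV - (\<lambda>i. (False, i, i)) ` UNIV"
    by auto
  moreover have "card (UNIV - (\<lambda>i::'n. (False, i, i)) ` UNIV) = 2 * CARD('n) ^ 2 - CARD('n)"
    by (subst card_Diff_subset) (auto simp: card_image inj_on_def power2_eq_square card_UNIV_bool)
  moreover have "CARD('n quot_index) = card {(b::bool, i::'n, j::'n). b \<or> i \<noteq> j}"
    using type_definition.card[OF type_definition_quot_index] by metis
  ultimately show ?thesis by simp
qed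

end

theory Submission
  imports Defs "HOL-Computational_Algebra.Fundamental_Theorem_Algebra"
begin

text \<open>
  Everything rests on one fact: every point \<open>p = (U, V, x)\<close> of
  \<open>U(n) \<times> U(n) \<times> cone\<close> lies on the image of a smooth local section of the map
  \<open>\<phi> (U, V, x) = U D(x) V\<close>, that is, singular value decompositions can be chosen smoothly near
  a regular matrix (\<open>svd_smooth_section\<close>). To see this, drop the constraint that \<open>U\<close>
  and \<open>V\<close> are unitary and consider, on an open set of a vector space, the polynomial map
  \<open>(U, V, x) \<mapsto> (U U*, V V*, U D(x) V)\<close> with values in Hermitian \<open>\<times>\<close> Hermitian \<open>\<times>\<close> all matrices.
  At a point of the constrained set its derivative is onto: after moving \<open>U\<close> and \<open>V\<close> away this
  amounts to solving \<open>A D(x) + D(x) B + D(e) = N\<close> with \<open>A, B\<close> skew-Hermitian and \<open>e\<close> real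
  (\<open>skew_hermitian_equation\<close>). Off the diagonal this is a system of two equations for each pair
  \<open>i \<noteq> j\<close>, with determinant \<open>x\<^sub>j\<^sup>2 - x\<^sub>i\<^sup>2 \<noteq> 0\<close>. The inverse function theorem then gives a smooth local
  right inverse, and restricting it to \<open>{(1, 1)} \<times>\<close> matrices gives the section.

  Sections give the rest. Their existence makes \<open>\<phi>\<close> a submersion by the chain rule, and shows that
  its image is open. The image is the set of regular matrices: if all eigenvalues of \<open>Z Z*\<close> are
  simple, there are \<open>n\<close> of them, and normalised eigenvectors form a unitary matrix
  (\<open>regular_matrix_has_svd\<close>). Two decompositions of the same matrix differ by a torus element, because
  \<open>U'* U\<close> intertwines the diagonal matrices of squared singular values and is therefore diagonal
  (\<open>svd_unique_up_to_torus\<close>). So the fibres are the torus orbits, and a section \<open>s\<close> yields the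
  trivialisation whose inverse is \<open>(Z, t) \<mapsto> t \<cdot> s Z\<close>. Properness holds since the torus is compact.

  For the quotient of \<open>U(n) \<times> U(n)\<close>, fix one \<open>x\<close> in the cone. The map \<open>(U, V) \<mapsto> U D(x) V\<close> identifies
  the orbit space with the set of matrices with singular values \<open>x\<close>. The local sections show that the
  singular values are smooth functions with independent differentials, so this set is a level set of a
  submersion and hence an embedded submanifold; its structure is transported to the orbit space
  (\<open>quotient_manifold_exists\<close>). For an arbitrary quotient structure, the induced bijection is smooth
  because the orbit map, being a submersion, has smooth local sections, and its inverse is smooth
  because \<open>\<phi>\<close> has them (\<open>svd_hat_diffeomorphism\<close>).
\<close>

section \<open>Functions of class Ck\<close>
lemma Ck_on_subset: "Ck_on k T f \<Longrightarrow> S \<subseteq> T \<Longrightarrow> Ck_on k S f"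
  by (induction k arbitrary: f) (auto intro: continuous_on_subset)

lemma Ck_on_cong:
  assumes "open T" "\<And>x. x \<in> T \<Longrightarrow> f x = g x" "Ck_on k T f"
  shows "Ck_on k T g"
  using assms(2,3)
proof (induction k arbitrary: f g)
  case 0
  then show ?case by (metis Ck_on.simps(1) continuous_on_cong)
next
  case (Suc k)
  have d: "(g has_derivative frechet_derivative f (at x)) (at x)" if "x \<in> T" for x
    using Suc.prems that assms(1)
    by (metis Ck_on.simps(2) frechet_derivative_works has_derivative_transform_within_open)
  then have e: "frechet_derivative f (at x) = frechet_derivative g (at x)" if "x \<in> T" for x
    using that frechet_derivative_at by blast
  have "Ck_on k T (\<lambda>x. frechet_derivative g (at x) v)" for v
    by (rule Suc.IH[where f = "\<lambda>x. frechet_derivative f (at x) v"]) (use e Suc.prems in auto)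
  then show ?case using d by (auto simp: differentiable_def)
qed

lemma Ck_on_Suc_imp: "Ck_on (Suc k) T f \<Longrightarrow> Ck_on k T f"
proof (induction k arbitrary: f)
  case 0
  then show ?case
    by (auto intro!: continuous_at_imp_continuous_on differentiable_imp_continuous_within)
next
  case (Suc k)
  then show ?case by (metis Ck_on.simps(2))
qed

lemma Ck_on_imp_Ck_on_0: "Ck_on k T f \<Longrightarrow> Ck_on 0 T f"
  by (induction k) (auto simp del: Ck_on.simps intro: Ck_on_Suc_imp)

lemma Ck_on_SucI:
  assumes "open T" "\<And>x. x \<in> T \<Longrightarrow> (f has_derivative f' x) (at x)" "\<And>v. Ck_on k T (\<lambda>x. f' x v)"
  shows "Ck_on (Suc k) T f"
proof -
  have "Ck_on k T (\<lambda>x. frechet_derivative f (at x) v)" for v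
    by (rule Ck_on_cong[OF assms(1) _ assms(3)[of v]]) (metis assms(2) frechet_derivative_at)
  then show ?thesis using assms(2) by (auto simp: differentiable_def)
qed

lemma Ck_on_Suc_has_derivative:
  "Ck_on (Suc k) T f \<Longrightarrow> x \<in> T \<Longrightarrow> (f has_derivative frechet_derivative f (at x)) (at x)"
  by (simp add: frechet_derivative_works[symmetric])

lemma Ck_on_const: "Ck_on k T (\<lambda>x. c)"
  by (induction k arbitrary: c) auto

lemma Ck_on_bounded_linear:
  assumes "bounded_linear L" "open T" "Ck_on k T f"
  shows "Ck_on k T (\<lambda>x. L (f x))"
  using assms(3)
proof (induction k arbitrary: f)
  case 0
  then show ?case by (simp add: assms(1) bounded_linear.continuous_on)
next
  case (Suc k)
  show ?case
  proof (rule Ck_on_SucI[OF assms(2)])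
    show "((\<lambda>x. L (f x)) has_derivative (\<lambda>v. L (frechet_derivative f (at x) v))) (at x)"
      if "x \<in> T" for x
      using that Suc.prems by (intro bounded_linear.has_derivative[OF assms(1)] Ck_on_Suc_has_derivative)
  qed (use Suc in auto)
qed

lemma Ck_on_linear:
  assumes "bounded_linear L" "open T"
  shows "Ck_on k T L"
proof (cases k)
  case 0
  then show ?thesis by (simp add: assms linear_continuous_on)
next
  case (Suc k)
  show ?thesis unfolding Suc
    by (rule Ck_on_SucI[where f' = "\<lambda>_. L"]) (use assms Ck_on_const in \<open>auto intro: bounded_linear_imp_has_derivative\<close>)
qed

lemma Ck_on_add:
  assumes "open T" "Ck_on k T f" "Ck_on k T g"
  shows "Ck_on k T (\<lambda>x. f x + g x)"
  using assms(2,3)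
proof (induction k arbitrary: f g)
  case 0
  then show ?case by (simp add: continuous_on_add)
next
  case (Suc k)
  show ?case
  proof (rule Ck_on_SucI[OF assms(1)])
    show "((\<lambda>x. f x + g x) has_derivative
        (\<lambda>v. frechet_derivative f (at x) v + frechet_derivative g (at x) v)) (at x)" if "x \<in> T" for x
      using that Suc.prems by (intro has_derivative_add Ck_on_Suc_has_derivative)
  qed (use Suc in auto)
qed

lemma Ck_on_sum:
  assumes "open T" "\<And>i. i \<in> I \<Longrightarrow> Ck_on k T (f i)"
  shows "Ck_on k T (\<lambda>x. \<Sum>i\<in>I. f i x)"
  using assms(2)
  by (induction I rule: infinite_finite_induct) (auto intro!: Ck_on_add[OF assms(1)] Ck_on_const)

lemma Ck_on_bilinear:
  assumes "bounded_bilinear B" "open T" "Ck_on k T f" "Ck_on k T g"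
  shows "Ck_on k T (\<lambda>x. B (f x) (g x))"
  using assms(3,4)
proof (induction k arbitrary: f g)
  case 0
  then show ?case by (simp add: assms(1) bounded_bilinear.continuous_on)
next
  case (Suc k)
  show ?case
  proof (rule Ck_on_SucI[OF assms(2)])
    show "((\<lambda>x. B (f x) (g x)) has_derivative
        (\<lambda>v. B (f x) (frechet_derivative g (at x) v) + B (frechet_derivative f (at x) v) (g x))) (at x)"
      if "x \<in> T" for x
      using that Suc.prems
      by (intro bounded_bilinear.FDERIV[OF assms(1)] Ck_on_Suc_has_derivative)
  next
    fix v
    show "Ck_on k T (\<lambda>x. B (f x) (frechet_derivative g (at x) v) + B (frechet_derivative f (at x) v) (g x))"
      by (intro Ck_on_add[OF assms(2)] Suc.IH) (use Suc.prems Ck_on_Suc_imp in auto)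
  qed
qed

text \<open>Expanding in a basis replaces an operator applied to a varying vector by a sum of products
  of functions, to which the product rules for Ck apply.\<close>
lemma linear_euclidean_expand:
  assumes "linear L"
  shows "L v = (\<Sum>b\<in>Basis. (v \<bullet> b) *\<^sub>R L b)"
  by (metis (mono_tags, lifting) assms euclidean_representation linear_sum linear_cmul sum.cong)

text \<open>The chain rule writes the derivative of a composition as a finite sum, over a basis, of
  products of partial derivatives. This reduces the induction to the stability of Ck under
  sums and products.\<close>
lemma Ck_on_compose:
  assumes "open S" "open T" "f ` S \<subseteq> T" "Ck_on k S f" "Ck_on k T g"
  shows "Ck_on k S (\<lambda>x. g (f x))"
  using assms(4,5)
proof (induction k arbitrary: g)
  case 0
  then show ?case using assms(3) by (auto intro: continuous_on_compose2)
next
  case (Suc k)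
  have fk: "Ck_on k S f" using Suc.prems Ck_on_Suc_imp by blast
  let ?f = "\<lambda>x v. frechet_derivative f (at x) v" and ?g = "\<lambda>y w. frechet_derivative g (at y) w"
  show ?case
  proof (rule Ck_on_SucI[OF assms(1)])
    show "((\<lambda>x. g (f x)) has_derivative (\<lambda>v. \<Sum>b\<in>Basis. (?f x v \<bullet> b) *\<^sub>R ?g (f x) b)) (at x)"
      if x: "x \<in> S" for x
    proof -
      have g: "(g has_derivative ?g (f x)) (at (f x))"
        using x assms(3) Suc.prems by (intro Ck_on_Suc_has_derivative) auto
      have "((\<lambda>x. g (f x)) has_derivative (\<lambda>v. ?g (f x) (?f x v))) (at x)"
        using has_derivative_compose[OF Ck_on_Suc_has_derivative[OF Suc.prems(1) x] g] .
      then show ?thesis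
        by (subst linear_euclidean_expand[symmetric]) (use g has_derivative_linear in auto)
    qed
  next
    fix v
    show "Ck_on k S (\<lambda>x. \<Sum>b\<in>Basis. (?f x v \<bullet> b) *\<^sub>R ?g (f x) b)"
    proof (intro Ck_on_sum[OF assms(1)] Ck_on_bilinear[OF bounded_bilinear_scaleR assms(1)])
      fix b :: 'b
      show "Ck_on k S (\<lambda>x. ?f x v \<bullet> b)"
        using Suc.prems by (intro Ck_on_bounded_linear[OF bounded_linear_inner_left assms(1)]) simp
      show "Ck_on k S (\<lambda>x. ?g (f x) b)"
        using Suc.prems by (intro Suc.IH[OF fk, of "\<lambda>y. ?g y b"]) simp
    qed
  qed
qed

text \<open>The resolvent identity \<open>B z - B y = - B z (A z - A y) B y\<close> first bounds
  \<open>B\<close> near \<open>y\<close> and then shows that it is continuous there.\<close>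
lemma continuous_on_blinfun_inverse:
  fixes A B :: "'a::topological_space \<Rightarrow> ('b::real_normed_vector \<Rightarrow>\<^sub>L 'b)"
  assumes "continuous_on V A"
    and "\<And>y. y \<in> V \<Longrightarrow> A y o\<^sub>L B y = id_blinfun" "\<And>y. y \<in> V \<Longrightarrow> B y o\<^sub>L A y = id_blinfun"
  shows "continuous_on V B"
  unfolding continuous_on_def
proof
  fix y assume y: "y \<in> V"
  let ?d = "\<lambda>z. norm (A z - A y)"
  have d0: "(?d \<longlongrightarrow> 0) (at y within V)"
    using assms(1) y by (auto simp: continuous_on_def LIM_zero_iff tendsto_norm_zero_iff)
  have eq: "B z - B y = - (B z o\<^sub>L ((A z - A y) o\<^sub>L B y))" if "z \<in> V" for z
  proof (rule blinfun_eqI)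
    fix v
    have "A y (B y v) = v" "B z (A z (B y v)) = B y v"
      using assms(2)[OF y] assms(3)[OF that] by (metis blinfun_apply_blinfun_compose blinfun_apply_id_blinfun)+
    then show "(B z - B y) v = (- (B z o\<^sub>L ((A z - A y) o\<^sub>L B y))) v"
      by (simp add: blinfun.bilinear_simps)
  qed
  have bd: "norm (B z - B y) \<le> norm (B z) * (?d z * norm (B y))" if "z \<in> V" for z
    using eq[OF that] norm_blinfun_compose[of "B z" "(A z - A y) o\<^sub>L B y"]
      norm_blinfun_compose[of "A z - A y" "B y"]
    by (smt (verit, best) mult_left_mono norm_ge_zero norm_minus_cancel)
  have "eventually (\<lambda>z. ?d z < 1 / (2 * (norm (B y) + 1))) (at y within V)"
    by (rule order_tendstoD(2)[OF d0]) (simp add: add_nonneg_pos)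
  then have ev: "eventually (\<lambda>z. norm (B z - B y) \<le> ?d z * (2 * norm (B y) ^ 2)) (at y within V)"
    unfolding eventually_at_filter
  proof eventually_elim
    case (elim z)
    show ?case
    proof safe
      assume z: "z \<noteq> y" "z \<in> V"
      then have "?d z * (2 * (norm (B y) + 1)) < 1"
        using elim by (simp add: pos_less_divide_eq add_nonneg_pos mult.commute)
      then have h: "?d z * norm (B y) \<le> 1 / 2"
        by (simp add: algebra_simps) (smt (verit) norm_ge_zero)
      have "norm (B z) \<le> norm (B y) + norm (B z) * (1/2)"
        using bd[OF z(2)] mult_left_mono[OF h, of "norm (B z)"] norm_triangle_sub[of "B z" "B y"] by simp
      then have "norm (B z) \<le> 2 * norm (B y)" by simp
      then have "norm (B z) * (?d z * norm (B y)) \<le> 2 * norm (B y) * (?d z * norm (B y))"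
        by (intro mult_right_mono) auto
      then show "norm (B z - B y) \<le> ?d z * (2 * norm (B y) ^ 2)"
        using bd[OF z(2)] by (simp add: power2_eq_square algebra_simps)
    qed
  qed
  have "((\<lambda>z. ?d z * (2 * norm (B y) ^ 2)) \<longlongrightarrow> 0) (at y within V)"
    using tendsto_mult_left_zero[OF d0] by simp
  from Lim_null_comparison[OF ev this] show "(B \<longlongrightarrow> B y) (at y within V)"
    by (simp add: LIM_zero_iff)
qed

text \<open>The product rule needs only continuity of one factor at a zero of the other: the increment
  of \<open>b\<close> contributes \<open>o(1) O(norm (y - x))\<close>.\<close>
lemma has_derivative_continuous_times_vanishing:
  assumes "bounded_bilinear P" "continuous (at x) b" "(q has_derivative q') (at x)" "q x = 0"
  shows "((\<lambda>y. P (b y) (q y)) has_derivative (\<lambda>v. P (b x) (q' v))) (at x)"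
proof -
  interpret bounded_bilinear P by fact
  obtain K where K: "K > 0" "\<And>a c. norm (P a c) \<le> norm a * norm c * K"
    using pos_bounded by blast
  obtain M where M: "M > 0" "\<And>v. norm (q' v) \<le> norm v * M"
    using bounded_linear.pos_bounded has_derivative_bounded_linear[OF assms(3)] by blast
  have q: "\<exists>d>0. \<forall>y. norm (y - x) < d \<longrightarrow> norm (q y - q' (y - x)) \<le> e * norm (y - x)" if "e > 0" for e
    using assms(3,4) that unfolding has_derivative_at_alt by auto
  have "((\<lambda>y. P (b y - b x) (q y)) has_derivative (\<lambda>v. 0)) (at x)"
    unfolding has_derivative_at_alt
  proof (intro conjI allI impI)
    fix e :: real assume e: "e > 0"
    obtain d where d: "d > 0" "\<And>y. norm (y - x) < d \<Longrightarrow> norm (q y - q' (y - x)) \<le> 1 * norm (y - x)"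
      using q[of 1] by auto
    define e' where "e' = e / ((M + 1) * K)"
    have e': "e' > 0" using e K M by (simp add: e'_def)
    obtain d' where d': "d' > 0" "\<And>y. norm (y - x) < d' \<Longrightarrow> norm (b y - b x) < e'"
      using assms(2) e' unfolding continuous_at_eps_delta dist_norm by meson
    show "\<exists>d>0. \<forall>y. norm (y - x) < d \<longrightarrow>
        norm (P (b y - b x) (q y) - P (b x - b x) (q x) - 0) \<le> e * norm (y - x)"
    proof (intro exI[of _ "min d d'"] conjI allI impI)
      fix y assume y: "norm (y - x) < min d d'"
      have "norm (q y) \<le> norm (q y - q' (y - x)) + norm (q' (y - x))"
        by (metis norm_triangle_sub add.commute)
      also have "\<dots> \<le> (M + 1) * norm (y - x)"
        using d(2)[of y] M(2)[of "y - x"] y by (simp add: algebra_simps)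
      finally have "norm (b y - b x) * norm (q y) * K \<le> e' * ((M + 1) * norm (y - x)) * K"
        using d'(2)[of y] y K M e' by (intro mult_right_mono mult_mono) auto
      also have "\<dots> = e * norm (y - x)" using K M by (simp add: e'_def)
      finally show "norm (P (b y - b x) (q y) - P (b x - b x) (q x) - 0) \<le> e * norm (y - x)"
        using K(2)[of "b y - b x" "q y"] by (simp add: zero_left)
    qed (use d d' in auto)
  qed auto
  moreover have "((\<lambda>y. P (b x) (q y)) has_derivative (\<lambda>v. P (b x) (q' v))) (at x)"
    by (rule bounded_linear.has_derivative[OF bounded_linear_right assms(3)])
  ultimately have "((\<lambda>y. P (b y - b x) (q y) + P (b x) (q y)) has_derivative (\<lambda>v. 0 + P (b x) (q' v))) (at x)"
    by (rule has_derivative_add)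
  then show ?thesis by (simp add: diff_left)
qed

text \<open>The derivative of the inverse \<open>B\<close> of \<open>A\<close> is \<open>- B A'
  B\<close>. It contains no derivative of \<open>B\<close>, so the differentiability class
  climbs by induction.\<close>
lemma Ck_on_blinfun_inverse:
  fixes A B :: "'a::euclidean_space \<Rightarrow> ('b::euclidean_space \<Rightarrow>\<^sub>L 'b)"
  assumes "open V"
    and AB: "\<And>y. y \<in> V \<Longrightarrow> A y o\<^sub>L B y = id_blinfun" and BA: "\<And>y. y \<in> V \<Longrightarrow> B y o\<^sub>L A y = id_blinfun"
    and "\<And>v. Ck_on k V (\<lambda>y. A y v)"
  shows "Ck_on k V (\<lambda>y. B y v)"
  using assms(4)
proof (induction k arbitrary: v)
  case 0
  then have "continuous_on V A"
    by (intro continuous_on_blinfun_componentwise) auto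
  then have "continuous_on V B"
    by (rule continuous_on_blinfun_inverse) (use AB BA in auto)
  then show ?case by (auto intro!: continuous_intros)
next
  case (Suc k)
  let ?A = "\<lambda>u y w. frechet_derivative (\<lambda>y. A y u) (at y) w"
  have Ak: "Ck_on k V (\<lambda>y. A y v)" for v using Suc.prems Ck_on_Suc_imp by blast
  have A0: "Ck_on 0 V (\<lambda>y. A y v)" for v by (rule Ck_on_imp_Ck_on_0[OF Suc.prems])
  have "continuous_on V A"
    using A0 by (intro continuous_on_blinfun_componentwise) auto
  then have "continuous_on V B"
    by (rule continuous_on_blinfun_inverse) (use AB BA in auto)
  then have Bc: "continuous (at y) B" if "y \<in> V" for y
    using that assms(1) continuous_on_eq_continuous_at by blast
  have BAv: "B y (A y w) = w" and ABv: "A y (B y w) = w" if "y \<in> V" for y w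
    using arg_cong[OF AB[OF that], of "\<lambda>L. blinfun_apply L w"] arg_cong[OF BA[OF that], of "\<lambda>L. blinfun_apply L w"]
    by simp_all
  show ?case
  proof (rule Ck_on_SucI[OF assms(1)])
    fix y assume y: "y \<in> V"
    define u where "u = B y v"
    \<comment> \<open>\<open>B z v = u - B z (q z)\<close>, where \<open>q\<close> is differentiable
      and vanishes at \<open>y\<close>.\<close>
    define q where "q z = A z u - A y u" for z
    have Au: "((\<lambda>z. A z b) has_derivative ?A b y) (at y)" for b
      by (rule Ck_on_Suc_has_derivative[OF Suc.prems y])
    have "(q has_derivative ?A u y) (at y)"
      using has_derivative_diff[OF Au[of u] has_derivative_const[of "A y u"]] by (simp add: q_def[abs_def])
    then have "((\<lambda>z. B z (q z)) has_derivative (\<lambda>w. B y (?A u y w))) (at y)"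
      by (rule has_derivative_continuous_times_vanishing[OF bounded_bilinear_blinfun_apply Bc[OF y]])
         (simp add: q_def)
    then have "((\<lambda>z. u - B z (q z)) has_derivative (\<lambda>w. - B y (?A u y w))) (at y)"
      using has_derivative_diff[OF has_derivative_const[of u]] by fastforce
    then have "((\<lambda>z. B z v) has_derivative (\<lambda>w. - B y (?A u y w))) (at y)"
      by (rule has_derivative_transform_within_open[OF _ assms(1) y])
         (use y in \<open>simp add: q_def u_def BAv ABv blinfun.bilinear_simps\<close>)
    moreover have Aexp: "?A u y w = (\<Sum>b\<in>Basis. (B y v \<bullet> b) *\<^sub>R ?A b y w)" for w
    proof -
      have d: "((\<lambda>z. \<Sum>b\<in>Basis. (u \<bullet> b) *\<^sub>R A z b) has_derivative (\<lambda>w. \<Sum>b\<in>Basis. (u \<bullet> b) *\<^sub>R ?A b y w)) (at y)"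
        by (intro has_derivative_sum has_derivative_scaleR_right Au)
      have e: "(\<Sum>b\<in>Basis. (u \<bullet> b) *\<^sub>R A z b) = A z u" for z
        by (rule linear_euclidean_expand[symmetric], rule bounded_linear.linear, rule blinfun.bounded_linear_right)
      have "((\<lambda>z. A z u) has_derivative (\<lambda>w. \<Sum>b\<in>Basis. (u \<bullet> b) *\<^sub>R ?A b y w)) (at y)"
        using d unfolding e .
      then have "(\<lambda>w. \<Sum>b\<in>Basis. (u \<bullet> b) *\<^sub>R ?A b y w) = frechet_derivative (\<lambda>z. A z u) (at y)"
        by (rule frechet_derivative_at)
      from fun_cong[OF this, of w] show ?thesis unfolding u_def by (rule sym)
    qed
    moreover have "- B y (?A u y w) = - (\<Sum>c\<in>Basis. (?A u y w \<bullet> c) *\<^sub>R B y c)" for w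
      by (rule arg_cong[where f = uminus], rule linear_euclidean_expand, rule bounded_linear.linear, rule blinfun.bounded_linear_right)
    ultimately show "((\<lambda>z. B z v) has_derivative
       (\<lambda>w. - (\<Sum>c\<in>Basis. ((\<Sum>b\<in>Basis. (B y v \<bullet> b) *\<^sub>R ?A b y w) \<bullet> c) *\<^sub>R B y c))) (at y)"
      by (simp only: Aexp)
  next
    fix w
    show "Ck_on k V (\<lambda>y. - (\<Sum>c\<in>Basis. ((\<Sum>b\<in>Basis. (B y v \<bullet> b) *\<^sub>R ?A b y w) \<bullet> c) *\<^sub>R B y c))"
      using Suc.IH[OF Ak] Suc.prems
      by (intro Ck_on_bounded_linear[OF bounded_linear_minus[OF bounded_linear_ident] assms(1)] Ck_on_sum[OF assms(1)]
          Ck_on_bilinear[OF bounded_bilinear_scaleR assms(1)]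
          Ck_on_bounded_linear[OF bounded_linear_inner_left assms(1)]) auto
  qed
qed

section \<open>Smooth functions and the submersion theorem\<close>
text \<open>Smoothness was defined through local extensions; this glues local statements to one on the
  whole set.\<close>
lemma Ck_on_local:
  assumes "\<And>x. x \<in> S \<Longrightarrow> \<exists>T. open T \<and> x \<in> T \<and> Ck_on k (S \<inter> T) f"
  shows "Ck_on k S f"
  using assms
proof (induction k arbitrary: f)
  case 0
  have "continuous (at x within S) f" if x: "x \<in> S" for x
  proof -
    obtain T where T: "open T" "x \<in> T" "continuous_on (S \<inter> T) f" using 0[OF x] by auto
    then have "continuous (at x within (S \<inter> T)) f"
      using x by (simp add: continuous_on_eq_continuous_within)
    then show ?thesis
      using at_within_nhd[OF T(2,1), of "S \<inter> T" S] by (auto simp: continuous_within)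
  qed
  then show ?case by (simp add: continuous_on_eq_continuous_within)
next
  case (Suc k)
  have "f differentiable (at x)" if "x \<in> S" for x using Suc.prems[OF that] that by auto
  moreover have "Ck_on k S (\<lambda>x. frechet_derivative f (at x) v)" for v
  proof (rule Suc.IH)
    fix x assume "x \<in> S"
    from Suc.prems[OF this] show "\<exists>T. open T \<and> x \<in> T \<and> Ck_on k (S \<inter> T) (\<lambda>x. frechet_derivative f (at x) v)"
      by auto
  qed
  ultimately show ?case by simp
qed

lemma smooth_onE:
  assumes "smooth_on S f" "x \<in> S"
  obtains T g where "open T" "x \<in> T" "\<forall>k. Ck_on k T g" "\<forall>y\<in>S. y \<in> T \<longrightarrow> g y = f y"
proof -
  obtain T g where "open T" "x \<in> T" "\<forall>k. Ck_on k T g" "\<forall>y\<in>S \<inter> T. g y = f y"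
    using bspec[OF assms(1)[unfolded smooth_on_def] assms(2)] by (elim exE conjE)
  then show thesis by (intro that[of T g]) simp_all
qed

lemma smooth_onI:
  assumes "\<And>x. x \<in> S \<Longrightarrow> \<exists>T g. open T \<and> x \<in> T \<and> (\<forall>k. Ck_on k T g) \<and> (\<forall>y\<in>S \<inter> T. g y = f y)"
  shows "smooth_on S f"
  unfolding smooth_on_def by (intro ballI assms)

lemma smooth_on_openI:
  assumes "open S" "\<And>k. Ck_on k S f"
  shows "smooth_on S f"
  by (rule smooth_onI) (use assms in \<open>intro exI[of _ S] exI[of _ f], simp\<close>)

lemma smooth_on_openD:
  assumes "smooth_on S f" "open S"
  shows "Ck_on k S f"
proof (rule Ck_on_local)
  fix x assume x: "x \<in> S"
  obtain T g where T: "open T" "x \<in> T" "\<forall>k. Ck_on k T g" "\<forall>y\<in>S. y \<in> T \<longrightarrow> g y = f y"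
    by (rule smooth_onE[OF assms(1) x]) (rule that)
  have "Ck_on k (S \<inter> T) g" by (rule Ck_on_subset[OF T(3)[rule_format]]) simp
  from Ck_on_cong[OF _ _ this, of f] have "Ck_on k (S \<inter> T) f"
    using T(1) T(4)[rule_format] assms(2) by (simp add: open_Int)
  with T(1,2) show "\<exists>T. open T \<and> x \<in> T \<and> Ck_on k (S \<inter> T) f"
    by (intro exI[of _ T]) simp
qed

lemma smooth_on_subset:
  assumes "smooth_on T f" "S \<subseteq> T"
  shows "smooth_on S f"
proof (rule smooth_onI)
  fix x assume "x \<in> S"
  then have x: "x \<in> T" using assms(2) by blast
  obtain A g where A: "open A" "x \<in> A" "\<forall>k. Ck_on k A g" "\<forall>y\<in>T. y \<in> A \<longrightarrow> g y = f y"
    by (rule smooth_onE[OF assms(1) x]) (rule that)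
  from A(1-3) A(4)[rule_format] show "\<exists>A g. open A \<and> x \<in> A \<and> (\<forall>k. Ck_on k A g) \<and> (\<forall>y\<in>S \<inter> A. g y = f y)"
    using assms(2) by (intro exI[of _ A] exI[of _ g]) (simp add: subset_iff)
qed

lemma smooth_on_cong:
  assumes "smooth_on S f" "\<And>x. x \<in> S \<Longrightarrow> f x = g x"
  shows "smooth_on S g"
proof (rule smooth_onI)
  fix x assume x: "x \<in> S"
  obtain A h where A: "open A" "x \<in> A" "\<forall>k. Ck_on k A h" "\<forall>y\<in>S. y \<in> A \<longrightarrow> h y = f y"
    by (rule smooth_onE[OF assms(1) x]) (rule that)
  then show "\<exists>A h. open A \<and> x \<in> A \<and> (\<forall>k. Ck_on k A h) \<and> (\<forall>y\<in>S \<inter> A. h y = g y)"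
    using assms(2) by (intro exI[of _ A] exI[of _ h]) simp
qed

lemma smooth_on_local:
  assumes "\<And>x. x \<in> S \<Longrightarrow> \<exists>T. open T \<and> x \<in> T \<and> smooth_on (S \<inter> T) f"
  shows "smooth_on S f"
proof (rule smooth_onI)
  fix x assume x: "x \<in> S"
  obtain T where T: "open T" "x \<in> T" "smooth_on (S \<inter> T) f" using assms[OF x] by (elim exE conjE)
  have xST: "x \<in> S \<inter> T" using x T by simp
  obtain A g where A: "open A" "x \<in> A" "\<forall>k. Ck_on k A g"
      "\<forall>y\<in>S \<inter> T. y \<in> A \<longrightarrow> g y = f y"
    by (rule smooth_onE[OF T(3) xST]) (rule that)
  have "Ck_on k (T \<inter> A) g" for k by (rule Ck_on_subset[OF A(3)[rule_format]]) simp
  then show "\<exists>T g. open T \<and> x \<in> T \<and> (\<forall>k. Ck_on k T g) \<and> (\<forall>y\<in>S \<inter> T. g y = f y)"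
    using T(1,2) A(1,2) A(4)[rule_format] by (intro exI[of _ "T \<inter> A"] exI[of _ g]) (simp add: open_Int)
qed

lemma smooth_on_imp_continuous_on:
  assumes "smooth_on S f"
  shows "continuous_on S f"
proof -
  have "continuous (at x within S) f" if x: "x \<in> S" for x
  proof -
    obtain T g where T: "open T" "x \<in> T" "\<forall>k. Ck_on k T g" "\<forall>y\<in>S. y \<in> T \<longrightarrow> g y = f y"
      by (rule smooth_onE[OF assms x]) (rule that)
    have "continuous_on T g" using T(3)[rule_format, of 0] by simp
    then have "continuous (at x) g"
      using continuous_on_eq_continuous_at[OF T(1)] T(2) by blast
    then have "(g \<longlongrightarrow> g x) (at x within S)"
      unfolding continuous_at by (rule tendsto_within_subset) simp
    moreover have "\<forall>\<^sub>F y in at x within S. g y = f y"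
      unfolding eventually_at_topological using T(1,2) T(4)[rule_format] by (intro exI[of _ T]) simp
    ultimately have "(f \<longlongrightarrow> g x) (at x within S)"
      by (rule Lim_transform_eventually)
    then show ?thesis using T(4)[rule_format, OF x T(2)] by (simp add: continuous_within)
  qed
  then show ?thesis by (simp add: continuous_on_eq_continuous_within)
qed

lemma smooth_on_has_derivative:
  assumes "smooth_on S f" "open S" "x \<in> S"
  shows "(f has_derivative frechet_derivative f (at x)) (at x)"
  by (rule Ck_on_Suc_has_derivative[OF smooth_on_openD[OF assms(1,2), of "Suc 0"] assms(3)])

lemma smooth_on_compose:
  assumes "smooth_on S f" "smooth_on T g" "f ` S \<subseteq> T"
  shows "smooth_on S (\<lambda>x. g (f x))"
proof (rule smooth_onI)
  fix x assume x: "x \<in> S"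
  then have fx: "f x \<in> T" using assms(3) by blast
  obtain A f' where A: "open A" "x \<in> A" "\<forall>k. Ck_on k A f'" "\<forall>y\<in>S. y \<in> A \<longrightarrow> f' y = f y"
    by (rule smooth_onE[OF assms(1) x]) (rule that)
  obtain B g' where B: "open B" "f x \<in> B" "\<forall>k. Ck_on k B g'" "\<forall>y\<in>T. y \<in> B \<longrightarrow> g' y = g y"
    by (rule smooth_onE[OF assms(2) fx]) (rule that)
  have "continuous_on A f'" using A(3)[rule_format, of 0] by simp
  then have o: "open (A \<inter> f' -` B)" using continuous_on_open_vimage[OF A(1), of f'] B(1)
    by (simp add: Int_commute)
  have "Ck_on k (A \<inter> f' -` B) (\<lambda>x. g' (f' x))" for k
    by (rule Ck_on_compose[OF o B(1) _ Ck_on_subset[OF A(3)[rule_format]] B(3)[rule_format]]) auto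
  moreover have "x \<in> A \<inter> f' -` B" using A(2) A(4)[rule_format, OF x] B(2) by simp
  moreover have "g' (f' y) = g (f y)" if "y \<in> S \<inter> (A \<inter> f' -` B)" for y
    using that A(4)[rule_format] B(4)[rule_format, of "f y"] assms(3) by auto
  ultimately show "\<exists>T h. open T \<and> x \<in> T \<and> (\<forall>k. Ck_on k T h) \<and> (\<forall>y\<in>S \<inter> T. h y = g (f y))"
    using o by (intro exI[of _ "A \<inter> f' -` B"] exI[of _ "\<lambda>x. g' (f' x)"]) simp
qed

text \<open>The common part of the closure properties under addition and under bilinear operations.\<close>
lemma smooth_on_binary:
  fixes S :: "'a::euclidean_space set"
  assumes "smooth_on S f" "smooth_on S g"
    and P: "\<And>(T::'a set) f g k. open T \<Longrightarrow> Ck_on k T f \<Longrightarrow> Ck_on k T g \<Longrightarrow> Ck_on k T (\<lambda>x. P (f x) (g x))"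
  shows "smooth_on S (\<lambda>x. P (f x) (g x))"
proof (rule smooth_onI)
  fix x assume x: "x \<in> S"
  obtain A f' where A: "open A" "x \<in> A" "\<forall>k. Ck_on k A f'" "\<forall>y\<in>S. y \<in> A \<longrightarrow> f' y = f y"
    by (rule smooth_onE[OF assms(1) x]) (rule that)
  obtain B g' where B: "open B" "x \<in> B" "\<forall>k. Ck_on k B g'" "\<forall>y\<in>S. y \<in> B \<longrightarrow> g' y = g y"
    by (rule smooth_onE[OF assms(2) x]) (rule that)
  have o: "open (A \<inter> B)" using A(1) B(1) by (rule open_Int)
  have "Ck_on k (A \<inter> B) (\<lambda>x. P (f' x) (g' x))" for k
    by (rule P[OF o Ck_on_subset[OF A(3)[rule_format]] Ck_on_subset[OF B(3)[rule_format]]]) auto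
  then show "\<exists>T h. open T \<and> x \<in> T \<and> (\<forall>k. Ck_on k T h) \<and> (\<forall>y\<in>S \<inter> T. h y = P (f y) (g y))"
    using o A(2) A(4)[rule_format] B(2) B(4)[rule_format] by (intro exI[of _ "A \<inter> B"] exI[of _ "\<lambda>x. P (f' x) (g' x)"]) simp
qed

lemma smooth_on_linear: "bounded_linear L \<Longrightarrow> smooth_on S L"
  by (rule smooth_on_subset[of UNIV]) (auto intro: smooth_on_openI Ck_on_linear)

lemma smooth_on_linear_compose:
  "bounded_linear L \<Longrightarrow> smooth_on S f \<Longrightarrow> smooth_on S (\<lambda>x. L (f x))"
  by (rule smooth_on_compose[where T = UNIV]) (auto intro: smooth_on_linear)

lemma smooth_on_const: "smooth_on S (\<lambda>x. c)"
  by (rule smooth_on_subset[of UNIV]) (auto intro: smooth_on_openI Ck_on_const)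

lemma smooth_on_ident: "smooth_on S (\<lambda>x. x)"
  by (rule smooth_on_linear) (rule bounded_linear_ident)

lemma smooth_on_bilinear:
  "bounded_bilinear B \<Longrightarrow> smooth_on S f \<Longrightarrow> smooth_on S g \<Longrightarrow> smooth_on S (\<lambda>x. B (f x) (g x))"
  by (rule smooth_on_binary) (auto intro: Ck_on_bilinear)

lemma smooth_on_add:
  "smooth_on S f \<Longrightarrow> smooth_on S g \<Longrightarrow> smooth_on S (\<lambda>x. f x + g x)"
  by (rule smooth_on_binary) (auto intro: Ck_on_add)

lemma smooth_on_diff:
  "smooth_on S f \<Longrightarrow> smooth_on S g \<Longrightarrow> smooth_on S (\<lambda>x. f x - g x)"
  using smooth_on_add[of S f "\<lambda>x. - g x"]
    smooth_on_linear_compose[OF bounded_linear_minus[OF bounded_linear_ident], of S g] by simp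

lemma smooth_on_Pair:
  assumes "smooth_on S f" "smooth_on S g"
  shows "smooth_on S (\<lambda>x. (f x, g x))"
proof -
  have "smooth_on S (\<lambda>x. (f x, 0) + (0, g x))"
    using assms by (intro smooth_on_add smooth_on_linear_compose[of "\<lambda>u. (u, 0)"]
        smooth_on_linear_compose[of "\<lambda>u. (0, u)"])
      (auto intro!: bounded_linear_Pair bounded_linear_ident bounded_linear_zero)
  then show ?thesis by simp
qed

lemma smooth_on_fst: "smooth_on S f \<Longrightarrow> smooth_on S (\<lambda>x. fst (f x))"
  by (rule smooth_on_linear_compose[OF bounded_linear_fst])

lemma smooth_on_snd: "smooth_on S f \<Longrightarrow> smooth_on S (\<lambda>x. snd (f x))"
  by (rule smooth_on_linear_compose[OF bounded_linear_snd])

text \<open>The inverse function theorem for continuously differentiable maps gives a differentiable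
  local inverse \<open>g\<close> with \<open>g' y\<close> inverse to \<open>h' (g
  y)\<close>. If \<open>g\<close> is Ck, then so is \<open>y \<mapsto> h' (g y)\<close>,
  hence its inverse \<open>g'\<close>, and \<open>g\<close> is of class \<open>Suc
  k\<close>. The normalisation of the derivative at \<open>p\<close> to the identity
  suffices for the straightening below.\<close>
lemma smooth_local_inverse:
  fixes h :: "'a::euclidean_space \<Rightarrow> 'a"
  assumes "open W" "p \<in> W" "smooth_on W h" "(h has_derivative (\<lambda>x. x)) (at p)"
  obtains U V g where "open U" "p \<in> U" "U \<subseteq> W" "open V" "homeomorphism U V h g" "smooth_on V g"
proof -
  define D where "D x = Blinfun (frechet_derivative h (at x))" for x
  have D: "blinfun_apply (D x) = frechet_derivative h (at x)"
    and hd: "(h has_derivative blinfun_apply (D x)) (at x)" if "x \<in> W" for x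
    using smooth_on_has_derivative[OF assms(3,1) that]
    by (simp_all add: D_def bounded_linear_Blinfun_apply has_derivative_bounded_linear)
  have CkD: "Ck_on k W (\<lambda>x. blinfun_apply (D x) v)" for k v
    by (rule Ck_on_cong[OF assms(1)]) (use smooth_on_openD[OF assms(3,1), of "Suc k"] D in auto)
  have contD: "continuous_on W D"
    using CkD[of 0] by (intro continuous_on_blinfun_componentwise) auto
  have "blinfun_apply (D p) = (\<lambda>x. x)"
    using hd[OF assms(2)] assms(4) has_derivative_unique by blast
  then have "id_blinfun o\<^sub>L D p = id_blinfun" by (intro blinfun_eqI) simp
  then obtain U V g g' where U: "open U" "U \<subseteq> W" "p \<in> U" and V: "open V" "h p \<in> V"
    and hom: "homeomorphism U V h g"
    and g': "\<And>y. y \<in> V \<Longrightarrow> (g has_derivative g' y) (at y)"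
    and inv: "\<And>y. y \<in> V \<Longrightarrow> g' y = inv_into UNIV (blinfun_apply (D (g y)))"
    and bij: "\<And>y. y \<in> V \<Longrightarrow> bij (blinfun_apply (D (g y)))"
    using inverse_function_theorem[OF assms(1) hd contD assms(2)] by metis
  have gV: "g ` V = U" using hom by (simp add: homeomorphism_def)
  have bl: "blinfun_apply (Blinfun (g' y)) = g' y" if "y \<in> V" for y
    using g'[OF that] by (simp add: bounded_linear_Blinfun_apply has_derivative_bounded_linear)
  have "Ck_on k V g" for k
  proof (induction k)
    case 0
    show ?case using hom by (simp add: homeomorphism_def)
  next
    case (Suc k)
    have "Ck_on k V (\<lambda>y. blinfun_apply (Blinfun (g' y)) v)" for v
    proof (rule Ck_on_blinfun_inverse[OF V(1), where A = "\<lambda>y. D (g y)"])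
      show "D (g y) o\<^sub>L Blinfun (g' y) = id_blinfun" if "y \<in> V" for y
        using bij[OF that] inv[OF that] bl[OF that]
        by (intro blinfun_eqI) (simp add: bij_is_surj surj_f_inv_f)
      show "Blinfun (g' y) o\<^sub>L D (g y) = id_blinfun" if "y \<in> V" for y
        using bij[OF that] inv[OF that] bl[OF that]
        by (intro blinfun_eqI) (simp add: bij_is_inj inv_f_f)
      show "Ck_on k V (\<lambda>y. blinfun_apply (D (g y)) v)" for v
        using gV U by (intro Ck_on_compose[OF V(1) assms(1) _ Suc CkD]) auto
    qed
    then have "Ck_on k V (\<lambda>y. g' y v)" for v
      using Ck_on_cong[OF V(1), of "\<lambda>y. blinfun_apply (Blinfun (g' y)) v" "\<lambda>y. g' y v"] bl by metis
    then show ?case by (intro Ck_on_SucI[OF V(1) g'])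
  qed
  then show thesis using that[OF U(1,3,2) V(1) hom smooth_on_openI[OF V(1)]] by blast
qed

text \<open>Near a point with surjective derivative \<open>L\<close>, a smooth coordinate change turns
  \<open>f\<close> into the linear map \<open>L\<close>. Both local sections and charts of
  level sets are read off from this normal form.\<close>
lemma submersion_straightening:
  fixes f :: "'a::euclidean_space \<Rightarrow> 'b::euclidean_space"
  assumes "open W" "p \<in> W" "smooth_on W f" "(f has_derivative L) (at p)" "surj L"
  obtains U V h g where "open U" "p \<in> U" "U \<subseteq> W" "open V" "homeomorphism U V h g"
    "smooth_on U h" "smooth_on V g" "\<And>z. z \<in> U \<Longrightarrow> L (h z) = f z"
proof -
  have L: "bounded_linear L" using assms(4) has_derivative_bounded_linear by blast
  obtain R where R: "linear R" "L \<circ> R = id"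
    using linear_surjective_right_inverse[OF bounded_linear.linear[OF L] assms(5)] by blast
  have bR: "bounded_linear R" using R linear_conv_bounded_linear by blast
  \<comment> \<open>Its derivative at \<open>p\<close> is the identity, and \<open>L (h z) = L z +
    (f z - L z) = f z\<close>.\<close>
  define h where "h z = z + R (f z - L z)" for z
  have "smooth_on W h" unfolding h_def
    by (intro smooth_on_add smooth_on_ident smooth_on_linear_compose[OF bR] smooth_on_diff assms(3)
        smooth_on_linear[OF L])
  moreover have "(h has_derivative (\<lambda>v. v + R (L v - L v))) (at p)" unfolding h_def
    by (intro has_derivative_add has_derivative_ident bounded_linear.has_derivative[OF bR]
        has_derivative_diff assms(4) bounded_linear_imp_has_derivative[OF L])
  then have "(h has_derivative (\<lambda>v. v)) (at p)" using R(1) by (simp add: linear_0)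
  ultimately obtain U V g where U: "open U" "p \<in> U" "U \<subseteq> W" "open V" "homeomorphism U V h g" "smooth_on V g"
    using smooth_local_inverse[OF assms(1,2)] by metis
  have "L (h z) = f z" for z
    using R(2) L by (simp add: h_def linear_add linear_diff bounded_linear.linear pointfree_idE)
  then show thesis using that[OF U(1-5) smooth_on_subset[OF \<open>smooth_on W h\<close> U(3)] U(6)] by blast
qed

text \<open>In the straightened coordinates a section is an affine right inverse of \<open>L\<close>,
  shifted so that it passes through \<open>p\<close>.\<close>
lemma smooth_local_section:
  fixes f :: "'a::euclidean_space \<Rightarrow> 'b::euclidean_space"
  assumes "open W" "p \<in> W" "smooth_on W f" "(f has_derivative L) (at p)" "surj L"
  obtains N s where "open N" "f p \<in> N" "smooth_on N s" "s (f p) = p" "s ` N \<subseteq> W"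
    "\<And>y. y \<in> N \<Longrightarrow> f (s y) = y"
proof -
  have L: "bounded_linear L" using assms(4) has_derivative_bounded_linear by blast
  obtain R where R: "linear R" "L \<circ> R = id"
    using linear_surjective_right_inverse[OF bounded_linear.linear[OF L] assms(5)] by blast
  have bR: "bounded_linear R" using R linear_conv_bounded_linear by blast
  obtain U V h g where U: "open U" "p \<in> U" "U \<subseteq> W" "open V" "homeomorphism U V h g"
    "smooth_on U h" "smooth_on V g" and Lh: "\<And>z. z \<in> U \<Longrightarrow> L (h z) = f z"
    using submersion_straightening[OF assms] by metis
  define r where "r y = h p + R (y - f p)" for y
  define N where "N = r -` V"
  have r: "smooth_on T r" for T unfolding r_def
    by (intro smooth_on_add smooth_on_const smooth_on_linear_compose[OF bR] smooth_on_diff smooth_on_ident)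
  have "open N" unfolding N_def
    using U(4) smooth_on_imp_continuous_on[OF r[of UNIV]] by (simp add: open_vimage)
  moreover have "r (f p) = h p" using R(1) by (simp add: r_def linear_0)
  moreover have hp: "h p \<in> V" "g (h p) = p" using U by (auto simp: homeomorphism_def)
  moreover have "smooth_on N (\<lambda>y. g (r y))"
    by (rule smooth_on_compose[OF r U(7)]) (auto simp: N_def)
  moreover have "g (r y) \<in> U" "f (g (r y)) = y" if "y \<in> N" for y
  proof -
    show gU: "g (r y) \<in> U" using that U(5) by (auto simp: N_def homeomorphism_def)
    have "h (g (r y)) = r y" using that U(5) by (auto simp: N_def homeomorphism_def)
    then have "f (g (r y)) = L (r y)" using Lh[OF gU] by simp
    also have "\<dots> = L (h p) + (y - f p)"
      using R(2) L by (simp add: r_def linear_add bounded_linear.linear pointfree_idE)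
    finally show "f (g (r y)) = y" using Lh[OF U(2)] by simp
  qed
  ultimately show thesis using U(3) by (intro that[of N "\<lambda>y. g (r y)"]) (auto simp: N_def)
qed

text \<open>The kernel of \<open>L\<close> is the orthogonal complement of the range of its adjoint,
  which is injective since \<open>L\<close> is onto. This gives the dimension of the kernel.\<close>
lemma linear_kernel_parametrization:
  fixes L :: "'a::euclidean_space \<Rightarrow> 'b::euclidean_space"
  assumes "linear L" "surj L" "DIM('a) = DIM('b) + DIM('e::euclidean_space)"
  obtains J :: "'e::euclidean_space \<Rightarrow> 'a" and K where "linear J" "linear K" "K \<circ> J = id" "range J = {v. L v = 0}"
proof -
  have "inj (adjoint L)"
  proof (rule linear_injective_0[THEN iffD2, rule_format, OF adjoint_linear[OF assms(1)]])
    fix y assume y: "adjoint L y = 0"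
    obtain x where "L x = y" using assms(2) by (metis surjD)
    then show "y = 0" using adjoint_works[OF assms(1), of x y] y by simp
  qed
  then have "dim (range (adjoint L)) = DIM('b)"
    using dim_image_eq[OF adjoint_linear[OF assms(1)], of UNIV] by simp
  moreover have "L v = 0 \<longleftrightarrow> (\<forall>x\<in>range (adjoint L). orthogonal x v)" for v
  proof
    assume "L v = 0"
    then show "\<forall>x\<in>range (adjoint L). orthogonal x v"
      using adjoint_works[OF assms(1), of v] by (auto simp: orthogonal_def inner_commute[of _ v])
  next
    assume "\<forall>x\<in>range (adjoint L). orthogonal x v"
    then have "adjoint L (L v) \<bullet> v = 0" by (auto simp: orthogonal_def)
    then have "L v \<bullet> L v = 0"
      using adjoint_works[OF assms(1), of v "L v"] by (simp only: inner_commute[of _ v])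
    then show "L v = 0" by simp
  qed
  then have "{v. L v = 0} = {y \<in> UNIV. \<forall>x\<in>range (adjoint L). orthogonal x y}" by blast
  ultimately have "dim {v. L v = 0} + DIM('b) = DIM('a)"
    using dim_subspace_orthogonal_to_vectors[of "range (adjoint L)" UNIV]
      linear_subspace_image[OF adjoint_linear[OF assms(1)] subspace_UNIV] by simp
  then have "dim (UNIV :: 'e set) = dim {v. L v = 0}" using assms(3) by simp
  then obtain J :: "'e \<Rightarrow> 'a" where J: "linear J" "J ` UNIV = {v. L v = 0}" "inj_on J UNIV"
    using subspace_isomorphism[OF subspace_UNIV linear_subspace_kernel[OF assms(1)]] by blast
  then obtain K where "linear K" "K \<circ> J = id" using linear_injective_left_inverse by blast
  with J show thesis using that by blast
qed

text \<open>In the straightened coordinates the level set is an affine copy of the kernel of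
  \<open>L\<close>, and a linear parametrisation of the kernel is a chart. Only the germ of
  \<open>S\<close> at \<open>p\<close> has to be a level set.\<close>
lemma level_set_chart:
  fixes f :: "'a::euclidean_space \<Rightarrow> 'b::euclidean_space"
  assumes "open W" "p \<in> W" "smooth_on W f" "(f has_derivative L) (at p)" "surj L"
    and dim: "DIM('a) = DIM('b) + DIM('e::euclidean_space)"
    and S: "S \<inter> W = {z \<in> W. f z = f p}"
  shows "\<exists>(A, \<phi>) \<in> charts (embedded_mfd S :: ('a, 'e::euclidean_space) mfd). p \<in> A"
proof -
  have L: "linear L" using assms(4) has_derivative_linear by blast
  obtain J :: "'e \<Rightarrow> 'a" and K where JK: "linear J" "linear K" "K \<circ> J = id" "range J = {v. L v = 0}"
    using linear_kernel_parametrization[OF L assms(5) dim] by blast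
  have b: "bounded_linear J" "bounded_linear K" using JK linear_conv_bounded_linear by blast+
  obtain U V h g where U: "open U" "p \<in> U" "U \<subseteq> W" "open V" "homeomorphism U V h g"
    "smooth_on U h" "smooth_on V g" and Lh: "\<And>z. z \<in> U \<Longrightarrow> L (h z) = f z"
    using submersion_straightening[OF assms(1-5)] by metis
  define A where "A = S \<inter> U"
  define r where "r c = h p + J c" for c
  define \<phi> where "\<phi> z = K (h z - h p)" for z
  have A: "z \<in> A \<longleftrightarrow> z \<in> U \<and> f z = f p" for z using S U(3) by (auto simp: A_def)
  have hg: "g (h z) = z" "h z \<in> V" if "z \<in> U" for z using that U(5) by (auto simp: homeomorphism_def)
  have gh: "h (g w) = w" "g w \<in> U" if "w \<in> V" for w using that U(5) by (auto simp: homeomorphism_def)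
  have r\<phi>: "r (\<phi> z) = h z" if "z \<in> A" for z
  proof -
    have "L (h z - h p) = 0" using that A Lh U(2) by (simp add: linear_diff L)
    then obtain c where "h z - h p = J c" using JK(4) by auto
    then show ?thesis using JK(3) by (simp add: r_def \<phi>_def pointfree_idE) (metis add.commute diff_add_cancel)
  qed
  have Lr: "L (r c) = f p" for c
    using JK(4) L Lh[OF U(2)] by (auto simp: r_def linear_add)
  have gr: "g (r c) \<in> A" "\<phi> (g (r c)) = c" if "r c \<in> V" for c
    using gh[OF that] Lr[of c] Lh[of "g (r c)"] JK(3) by (auto simp: A r_def \<phi>_def pointfree_idE)
  have r: "smooth_on T r" for T unfolding r_def
    by (intro smooth_on_add smooth_on_const smooth_on_linear[OF b(1)])
  have im: "\<phi> ` A = r -` V"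
  proof (intro subset_antisym subsetI)
    fix c assume "c \<in> \<phi> ` A"
    then show "c \<in> r -` V" using r\<phi> hg(2) A by auto
  next
    fix c assume "c \<in> r -` V"
    then have "c = \<phi> (g (r c))" "g (r c) \<in> A" using gr by auto
    then show "c \<in> \<phi> ` A" by (rule image_eqI)
  qed
  have inj: "inj_on \<phi> A" by (rule inj_onI) (metis r\<phi> hg(1) A)
  have "openin (top_of_set S) A" using U(1) by (auto simp: A_def)
  moreover have "open (\<phi> ` A)" unfolding im
    using U(4) smooth_on_imp_continuous_on[OF r[of UNIV]] by (simp add: open_vimage)
  moreover have "smooth_on A \<phi>" unfolding \<phi>_def
    by (rule smooth_on_subset[of U]) (auto simp: A_def intro!: smooth_on_linear_compose[OF b(2)] smooth_on_diff U(6) smooth_on_const)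
  moreover have "smooth_on (\<phi> ` A) (inv_into A \<phi>)"
  proof (rule smooth_on_cong)
    show "smooth_on (\<phi> ` A) (\<lambda>c. g (r c))"
      by (rule smooth_on_compose[OF r U(7)]) (auto simp: im)
    fix c assume "c \<in> \<phi> ` A"
    then show "g (r c) = inv_into A \<phi> c"
      using inj gr im by (metis inv_into_f_f vimageE)
  qed
  moreover have "p \<in> A" using U A by auto
  ultimately show ?thesis using inj by (auto simp: embedded_mfd_def)
qed

section \<open>Smooth atlases\<close>
text \<open>The part of the definition of a manifold that the calculus of smooth maps uses, with the
  homeomorphism condition unfolded to open images and open preimages. Unlike the separation
  and countability axioms it is inherited by products and open subsets by direct inspection
  of the charts.\<close>
definition smooth_atlas :: "('a, 'e::euclidean_space) mfd \<Rightarrow> bool" where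
  "smooth_atlas M \<longleftrightarrow>
     (\<forall>(U, \<phi>)\<in>charts M. openin (mtop M) U \<and> inj_on \<phi> U \<and>
        (\<forall>A. openin (mtop M) A \<longrightarrow> A \<subseteq> U \<longrightarrow> open (\<phi> ` A)) \<and>
        (\<forall>W. open W \<longrightarrow> openin (mtop M) (U \<inter> \<phi> -` W))) \<and>
     (\<Union>(U, \<phi>)\<in>charts M. U) = topspace (mtop M) \<and>
     (\<forall>(U, \<phi>)\<in>charts M. \<forall>(V, \<psi>)\<in>charts M. smooth_on (\<phi> ` (U \<inter> V)) (\<psi> \<circ> inv_into U \<phi>))"

lemma smooth_atlas_chartD:
  assumes "smooth_atlas M" "(U, \<phi>) \<in> charts M"
  shows "openin (mtop M) U" "inj_on \<phi> U" "\<And>A. openin (mtop M) A \<Longrightarrow> A \<subseteq> U \<Longrightarrow> open (\<phi> ` A)"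
    "\<And>W. open W \<Longrightarrow> openin (mtop M) (U \<inter> \<phi> -` W)"
proof -
  have "\<forall>(U, \<phi>)\<in>charts M. openin (mtop M) U \<and> inj_on \<phi> U \<and>
        (\<forall>A. openin (mtop M) A \<longrightarrow> A \<subseteq> U \<longrightarrow> open (\<phi> ` A)) \<and>
        (\<forall>W. open W \<longrightarrow> openin (mtop M) (U \<inter> \<phi> -` W))"
    using assms(1) unfolding smooth_atlas_def by (elim conjE)
  from bspec[OF this assms(2)] show "openin (mtop M) U" "inj_on \<phi> U"
    "\<And>A. openin (mtop M) A \<Longrightarrow> A \<subseteq> U \<Longrightarrow> open (\<phi> ` A)"
    "\<And>W. open W \<Longrightarrow> openin (mtop M) (U \<inter> \<phi> -` W)"
    by simp_all
qed

lemma smooth_atlas_coverE: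
  assumes "smooth_atlas M" "p \<in> topspace (mtop M)"
  obtains U \<phi> where "(U, \<phi>) \<in> charts M" "p \<in> U"
proof -
  have "p \<in> (\<Union>(U, \<phi>)\<in>charts M. U)" using assms by (simp add: smooth_atlas_def)
  then show thesis using that by auto
qed

lemma smooth_atlas_transition:
  assumes "smooth_atlas M" "(U, \<phi>) \<in> charts M" "(V, \<psi>) \<in> charts M"
  shows "smooth_on (\<phi> ` (U \<inter> V)) (\<lambda>y. \<psi> (inv_into U \<phi> y))"
proof -
  have "\<forall>(U, \<phi>)\<in>charts M. \<forall>(V, \<psi>)\<in>charts M. smooth_on (\<phi> ` (U \<inter> V)) (\<psi> \<circ> inv_into U \<phi>)"
    using assms(1) unfolding smooth_atlas_def by (elim conjE)
  from bspec[OF bspec[OF this assms(2), unfolded prod.case] assms(3)] show ?thesis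
    by (simp add: comp_def)
qed

lemma smooth_atlasI:
  assumes "\<And>U \<phi>. (U, \<phi>) \<in> charts M \<Longrightarrow> openin (mtop M) U"
    and "\<And>U \<phi>. (U, \<phi>) \<in> charts M \<Longrightarrow> inj_on \<phi> U"
    and "\<And>U \<phi> A. (U, \<phi>) \<in> charts M \<Longrightarrow> openin (mtop M) A \<Longrightarrow> A \<subseteq> U \<Longrightarrow> open (\<phi> ` A)"
    and "\<And>U \<phi> W. (U, \<phi>) \<in> charts M \<Longrightarrow> open W \<Longrightarrow> openin (mtop M) (U \<inter> \<phi> -` W)"
    and cover: "\<And>p. p \<in> topspace (mtop M) \<Longrightarrow> \<exists>U \<phi>. (U, \<phi>) \<in> charts M \<and> p \<in> U"
    and "\<And>U \<phi> V \<psi>. (U, \<phi>) \<in> charts M \<Longrightarrow> (V, \<psi>) \<in> charts M \<Longrightarrow>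
      smooth_on (\<phi> ` (U \<inter> V)) (\<lambda>y. \<psi> (inv_into U \<phi> y))"
  shows "smooth_atlas M"
proof -
  have "(\<Union>(U, \<phi>)\<in>charts M. U) = topspace (mtop M)"
  proof (intro subset_antisym subsetI)
    fix p assume "p \<in> (\<Union>(U, \<phi>)\<in>charts M. U)"
    then obtain U \<phi> where "(U, \<phi>) \<in> charts M" "p \<in> U" by auto
    then show "p \<in> topspace (mtop M)" using openin_subset[OF assms(1)] by blast
  next
    fix p assume "p \<in> topspace (mtop M)"
    then obtain U \<phi> where "(U, \<phi>) \<in> charts M" "p \<in> U" using cover by blast
    then show "p \<in> (\<Union>(U, \<phi>)\<in>charts M. U)" by (intro UN_I[of "(U, \<phi>)"]) simp_all
  qed
  moreover have "\<forall>x\<in>charts M. case x of (U, \<phi>) \<Rightarrow> openin (mtop M) U \<and> inj_on \<phi> U \<and>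
        (\<forall>A. openin (mtop M) A \<longrightarrow> A \<subseteq> U \<longrightarrow> open (\<phi> ` A)) \<and>
        (\<forall>W. open W \<longrightarrow> openin (mtop M) (U \<inter> \<phi> -` W))"
  proof (intro ballI, simp only: split_paired_all prod.case)
    fix U \<phi> assume c: "(U, \<phi>) \<in> charts M"
    show "openin (mtop M) U \<and> inj_on \<phi> U \<and>
        (\<forall>A. openin (mtop M) A \<longrightarrow> A \<subseteq> U \<longrightarrow> open (\<phi> ` A)) \<and>
        (\<forall>W. open W \<longrightarrow> openin (mtop M) (U \<inter> \<phi> -` W))"
      using assms(1)[OF c] assms(2)[OF c] assms(3)[OF c] assms(4)[OF c] by simp
  qed
  moreover have "\<forall>x\<in>charts M. case x of (U, \<phi>) \<Rightarrow> \<forall>y\<in>charts M. case y of (V, \<psi>) \<Rightarrow>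
      smooth_on (\<phi> ` (U \<inter> V)) (\<lambda>y. \<psi> (inv_into U \<phi> y))"
    by (intro ballI, simp only: split_paired_all prod.case, intro ballI, simp only: split_paired_all prod.case)
      (rule assms(6))
  ultimately show ?thesis
    unfolding smooth_atlas_def comp_def by (intro conjI)
qed

lemma smooth_manifold_imp_atlas:
  assumes "smooth_manifold M"
  shows "smooth_atlas M"
proof -
  have *: "openin (mtop M) U \<and> inj_on \<phi> U \<and>
        (\<forall>A. openin (mtop M) A \<longrightarrow> A \<subseteq> U \<longrightarrow> open (\<phi> ` A)) \<and>
        (\<forall>W. open W \<longrightarrow> openin (mtop M) (U \<inter> \<phi> -` W))" if c: "(U, \<phi>) \<in> charts M" for U \<phi>
  proof -
    have "\<forall>(U, \<phi>)\<in>charts M. openin (mtop M) U \<and> open (\<phi> ` U) \<and>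
        homeomorphic_map (subtopology (mtop M) U) (top_of_set (\<phi> ` U)) \<phi>"
      using assms unfolding smooth_manifold_def by (elim conjE)
    from bspec[OF this c] have U: "openin (mtop M) U" "open (\<phi> ` U)"
      and h: "homeomorphic_map (subtopology (mtop M) U) (top_of_set (\<phi> ` U)) \<phi>"
      by simp_all
    have tU: "topspace (subtopology (mtop M) U) = U"
      using U(1) openin_subset by fastforce
    have "inj_on \<phi> U" using homeomorphic_imp_injective_map[OF h] tU by simp
    moreover have "open (\<phi> ` A)" if A: "openin (mtop M) A" "A \<subseteq> U" for A
    proof -
      have "openin (subtopology (mtop M) U) A" using A by (simp add: openin_open_subtopology U(1))
      then have "openin (top_of_set (\<phi> ` U)) (\<phi> ` A)"
        using homeomorphic_imp_open_map[OF h] by (simp add: open_map_def)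
      then show ?thesis using U(2) by (rule openin_open_trans)
    qed
    moreover have "openin (mtop M) (U \<inter> \<phi> -` W)" if "open W" for W
    proof -
      have "openin (top_of_set (\<phi> ` U)) (\<phi> ` U \<inter> W)" using that by (rule openin_open_Int)
      from openin_continuous_map_preimage[OF homeomorphic_imp_continuous_map[OF h] this]
      have "openin (subtopology (mtop M) U) {x \<in> U. \<phi> x \<in> \<phi> ` U \<inter> W}"
        unfolding tU .
      moreover have "{x \<in> U. \<phi> x \<in> \<phi> ` U \<inter> W} = U \<inter> \<phi> -` W" by auto
      ultimately show ?thesis using U(1) by (simp add: openin_open_subtopology)
    qed
    ultimately show ?thesis using U(1) by simp
  qed
  have "\<forall>x\<in>charts M. case x of (U, \<phi>) \<Rightarrow> openin (mtop M) U \<and> inj_on \<phi> U \<and>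
        (\<forall>A. openin (mtop M) A \<longrightarrow> A \<subseteq> U \<longrightarrow> open (\<phi> ` A)) \<and>
        (\<forall>W. open W \<longrightarrow> openin (mtop M) (U \<inter> \<phi> -` W))"
    by (intro ballI, simp only: split_paired_all prod.case) (rule *)
  then show ?thesis
    using assms unfolding smooth_atlas_def smooth_manifold_def by (elim conjE, intro conjI)
qed

text \<open>Smoothness near each point in one pair of charts implies smoothness in all pairs, by the
  transition maps, and it implies continuity, since charts are homeomorphisms. All later
  proofs of smoothness between abstract manifolds pass through this lemma.\<close>
lemma smooth_mapI:
  assumes M: "smooth_atlas M" and N: "smooth_atlas N"
    and f: "\<And>p. p \<in> topspace (mtop M) \<Longrightarrow> \<exists>U \<phi> V \<psi> A. (U, \<phi>) \<in> charts M \<and> (V, \<psi>) \<in> charts N \<and>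
      openin (mtop M) A \<and> p \<in> A \<and> A \<subseteq> U \<and> f ` A \<subseteq> V \<and> smooth_on (\<phi> ` A) (\<lambda>y. \<psi> (f (inv_into U \<phi> y)))"
  shows "smooth_map M N f"
proof -
  have im: "f p \<in> topspace (mtop N)" if p: "p \<in> topspace (mtop M)" for p
  proof -
    obtain U \<phi> V \<psi> A where c: "(U, \<phi>) \<in> charts M" "(V, \<psi>) \<in> charts N" "openin (mtop M) A" "p \<in> A" "A \<subseteq> U"
      "f ` A \<subseteq> V" "smooth_on (\<phi> ` A) (\<lambda>y. \<psi> (f (inv_into U \<phi> y)))"
      using f[OF p] by (elim exE conjE)
    then have "f p \<in> V" by blast
    then show ?thesis using openin_subset[OF smooth_atlas_chartD(1)[OF N c(2)]] by blast
  qed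
  have cont: "openin (mtop M) {p \<in> topspace (mtop M). f p \<in> G}" if G: "openin (mtop N) G" for G
  proof (subst openin_subopen, intro ballI)
    fix p assume "p \<in> {p \<in> topspace (mtop M). f p \<in> G}"
    then have p: "p \<in> topspace (mtop M)" "f p \<in> G" by auto
    obtain U \<phi> V \<psi> A where c: "(U, \<phi>) \<in> charts M" "(V, \<psi>) \<in> charts N" "openin (mtop M) A" "p \<in> A" "A \<subseteq> U"
      "f ` A \<subseteq> V" "smooth_on (\<phi> ` A) (\<lambda>y. \<psi> (f (inv_into U \<phi> y)))"
      using f[OF p(1)] by (elim exE conjE)
    note cM = smooth_atlas_chartD[OF M c(1)] and cN = smooth_atlas_chartD[OF N c(2)]
    have oA: "open (\<phi> ` A)" by (rule cM(3)[OF c(3,5)])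
    have oG: "open (\<psi> ` (G \<inter> V))" by (rule cN(3)[OF openin_Int[OF G cN(1)]]) simp
    define W where "W = (\<lambda>y. \<psi> (f (inv_into U \<phi> y))) -` (\<psi> ` (G \<inter> V)) \<inter> \<phi> ` A"
    have "open W" unfolding W_def
      using continuous_on_open_vimage[OF oA] smooth_on_imp_continuous_on[OF c(7)] oG by blast
    have W: "\<phi> q \<in> W \<longleftrightarrow> q \<in> A \<and> f q \<in> G" if q: "q \<in> U" for q
    proof -
      have e: "\<phi> q \<in> \<phi> ` A \<longleftrightarrow> q \<in> A" using inj_on_image_mem_iff[OF cM(2) q c(5)] .
      have i: "inv_into U \<phi> (\<phi> q) = q" using cM(2) q by simp
      show ?thesis
      proof (cases "q \<in> A")
        case True
        then have "f q \<in> V" using c(6) by blast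
        then have "\<psi> (f q) \<in> \<psi> ` (G \<inter> V) \<longleftrightarrow> f q \<in> G \<inter> V"
          using inj_on_image_mem_iff[OF cN(2), of "f q" "G \<inter> V"] by blast
        then show ?thesis using True \<open>f q \<in> V\<close> e i by (simp add: W_def)
      qed (simp add: W_def e)
    qed
    \<comment> \<open>A neighbourhood of \<open>p\<close> that \<open>f\<close> maps into
      \<open>G\<close>.\<close>
    have "openin (mtop M) (U \<inter> \<phi> -` W)" by (rule cM(4)[OF \<open>open W\<close>])
    moreover have "p \<in> U \<inter> \<phi> -` W" using W[of p] p c(4,5) by auto
    moreover have "U \<inter> \<phi> -` W \<subseteq> {p \<in> topspace (mtop M). f p \<in> G}"
      using W openin_subset[OF cM(1)] by auto
    ultimately show "\<exists>T. openin (mtop M) T \<and> p \<in> T \<and> T \<subseteq> {p \<in> topspace (mtop M). f p \<in> G}" by blast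
  qed
  have "smooth_on (\<phi>1 ` (U1 \<inter> f -` V1)) (\<lambda>y. \<psi>1 (f (inv_into U1 \<phi>1 y)))"
    if c1: "(U1, \<phi>1) \<in> charts M" "(V1, \<psi>1) \<in> charts N" for U1 \<phi>1 V1 \<psi>1
  proof (rule smooth_on_local)
    fix y assume "y \<in> \<phi>1 ` (U1 \<inter> f -` V1)"
    then obtain p where p: "p \<in> U1" "f p \<in> V1" "y = \<phi>1 p" by blast
    note c1M = smooth_atlas_chartD[OF M c1(1)] and c1N = smooth_atlas_chartD[OF N c1(2)]
    have pM: "p \<in> topspace (mtop M)" using p(1) openin_subset[OF c1M(1)] by blast
    obtain U \<phi> V \<psi> A where c: "(U, \<phi>) \<in> charts M" "(V, \<psi>) \<in> charts N" "openin (mtop M) A" "p \<in> A" "A \<subseteq> U"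
      "f ` A \<subseteq> V" "smooth_on (\<phi> ` A) (\<lambda>y. \<psi> (f (inv_into U \<phi> y)))"
      using f[OF pM] by (elim exE conjE)
    note cM = smooth_atlas_chartD[OF M c(1)] and cN = smooth_atlas_chartD[OF N c(2)]
    define B where "B = A \<inter> U1 \<inter> {p \<in> topspace (mtop M). f p \<in> V1}"
    have oB: "openin (mtop M) B" unfolding B_def
      using c(3) c1M(1) cont[OF c1N(1)] by (intro openin_Int)
    have BU: "B \<subseteq> U1" "B \<subseteq> U" "B \<subseteq> A" using c(5) by (auto simp: B_def)
    have oB1: "open (\<phi>1 ` B)" using c1M(3)[OF oB BU(1)] .
    have i1: "inv_into U1 \<phi>1 (\<phi>1 q) = q" if "q \<in> B" for q using that BU c1M(2) by (simp add: subset_iff)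
    have i: "inv_into U \<phi> (\<phi> q) = q" if "q \<in> B" for q using that BU cM(2) by (simp add: subset_iff)
    have fB: "f q \<in> V" "f q \<in> V1" if "q \<in> B" for q using that c(6) by (auto simp: B_def)
    have s1: "smooth_on (\<phi>1 ` B) (\<lambda>z. \<phi> (inv_into U1 \<phi>1 z))"
      by (rule smooth_on_subset[OF smooth_atlas_transition[OF M c1(1) c(1)]]) (use BU in auto)
    have s2: "smooth_on (\<phi> ` B) (\<lambda>y. \<psi> (f (inv_into U \<phi> y)))"
      by (rule smooth_on_subset[OF c(7)]) (use BU in auto)
    have s12: "smooth_on (\<phi>1 ` B) (\<lambda>z. \<psi> (f (inv_into U \<phi> (\<phi> (inv_into U1 \<phi>1 z)))))"
      by (rule smooth_on_compose[OF s1 s2]) (auto simp: i1)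
    have s3: "smooth_on (\<psi> ` (V \<inter> V1)) (\<lambda>y. \<psi>1 (inv_into V \<psi> y))"
      by (rule smooth_atlas_transition[OF N c(2) c1(2)])
    have "smooth_on (\<phi>1 ` B) (\<lambda>z. \<psi>1 (inv_into V \<psi> (\<psi> (f (inv_into U \<phi> (\<phi> (inv_into U1 \<phi>1 z)))))))"
      by (rule smooth_on_compose[OF s12 s3]) (auto simp: i1 i fB)
    then have "smooth_on (\<phi>1 ` B) (\<lambda>y. \<psi>1 (f (inv_into U1 \<phi>1 y)))"
      by (rule smooth_on_cong) (auto simp: i1 i fB inv_into_f_f[OF cN(2)])
    moreover have "\<phi>1 ` (U1 \<inter> f -` V1) \<inter> \<phi>1 ` B \<subseteq> \<phi>1 ` B" by blast
    ultimately have "smooth_on (\<phi>1 ` (U1 \<inter> f -` V1) \<inter> \<phi>1 ` B) (\<lambda>y. \<psi>1 (f (inv_into U1 \<phi>1 y)))"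
      by (rule smooth_on_subset)
    moreover have "y \<in> \<phi>1 ` B" using p pM c(4) by (auto simp: B_def)
    ultimately show "\<exists>T. open T \<and> y \<in> T \<and> smooth_on (\<phi>1 ` (U1 \<inter> f -` V1) \<inter> T) (\<lambda>y. \<psi>1 (f (inv_into U1 \<phi>1 y)))"
      using oB1 by (intro exI[of _ "\<phi>1 ` B"]) simp
  qed
  then show ?thesis unfolding smooth_map_def comp_def continuous_map_def
    using im cont by (auto simp: Pi_iff)
qed

lemma smooth_map_topspace: "smooth_map M N f \<Longrightarrow> p \<in> topspace (mtop M) \<Longrightarrow> f p \<in> topspace (mtop N)"
  unfolding smooth_map_def by (auto dest: continuous_map_image_subset_topspace)

lemma smooth_map_charts:
  assumes "smooth_map M N f" "(U, \<phi>) \<in> charts M" "(V, \<psi>) \<in> charts N"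
  shows "smooth_on (\<phi> ` (U \<inter> f -` V)) (\<lambda>y. \<psi> (f (inv_into U \<phi> y)))"
proof -
  have "\<forall>(U, \<phi>)\<in>charts M. \<forall>(V, \<psi>)\<in>charts N. smooth_on (\<phi> ` (U \<inter> f -` V)) (\<psi> \<circ> f \<circ> inv_into U \<phi>)"
    using assms(1) unfolding smooth_map_def by (elim conjE)
  from bspec[OF bspec[OF this assms(2), unfolded prod.case] assms(3)] show ?thesis
    by (simp add: comp_def)
qed

text \<open>This makes the domain of a coordinate expression open.\<close>
lemma smooth_map_vimage_open:
  assumes "smooth_atlas M" "smooth_map M N f" "(U, \<phi>) \<in> charts M" "openin (mtop N) G"
  shows "openin (mtop M) (U \<inter> f -` G)"
proof -
  have U: "openin (mtop M) U" by (rule smooth_atlas_chartD(1)[OF assms(1,3)])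
  have "openin (mtop M) {p \<in> topspace (mtop M). f p \<in> G}"
    using assms(2,4) unfolding smooth_map_def by (auto intro: openin_continuous_map_preimage)
  then have "openin (mtop M) (U \<inter> {p \<in> topspace (mtop M). f p \<in> G})" using U by (intro openin_Int)
  moreover have "U \<inter> {p \<in> topspace (mtop M). f p \<in> G} = U \<inter> f -` G"
    using openin_subset[OF U] by auto
  ultimately show ?thesis by simp
qed

lemma smooth_map_compose:
  assumes M: "smooth_atlas M" and N: "smooth_atlas N" and K: "smooth_atlas K"
    and f: "smooth_map M N f" and g: "smooth_map N K g"
  shows "smooth_map M K (\<lambda>x. g (f x))"
proof (rule smooth_mapI[OF M K])
  fix p assume p: "p \<in> topspace (mtop M)"
  have fp: "f p \<in> topspace (mtop N)" by (rule smooth_map_topspace[OF f p])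
  obtain U \<phi> where U: "(U, \<phi>) \<in> charts M" "p \<in> U" by (rule smooth_atlas_coverE[OF M p]) (rule that)
  obtain V \<psi> where V: "(V, \<psi>) \<in> charts N" "f p \<in> V" by (rule smooth_atlas_coverE[OF N fp]) (rule that)
  obtain W \<kappa> where W: "(W, \<kappa>) \<in> charts K" "g (f p) \<in> W"
    by (rule smooth_atlas_coverE[OF K smooth_map_topspace[OF g fp]]) (rule that)
  define A where "A = U \<inter> f -` (V \<inter> g -` W)"
  have "openin (mtop M) A" unfolding A_def
    by (intro smooth_map_vimage_open[OF M f U(1)] smooth_map_vimage_open[OF N g V(1)]
        smooth_atlas_chartD(1)[OF K W(1)])
  moreover have "smooth_on (\<phi> ` A) (\<lambda>y. \<kappa> (g (f (inv_into U \<phi> y))))"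
  proof -
    have i: "inv_into U \<phi> (\<phi> q) = q" if "q \<in> U" for q
      using that smooth_atlas_chartD(2)[OF M U(1)] by simp
    have j: "inv_into V \<psi> (\<psi> q) = q" if "q \<in> V" for q
      using that smooth_atlas_chartD(2)[OF N V(1)] by simp
    have "smooth_on (\<phi> ` A) (\<lambda>y. \<psi> (f (inv_into U \<phi> y)))"
      by (rule smooth_on_subset[OF smooth_map_charts[OF f U(1) V(1)]]) (auto simp: A_def)
    then have "smooth_on (\<phi> ` A) (\<lambda>y. \<kappa> (g (inv_into V \<psi> (\<psi> (f (inv_into U \<phi> y))))))"
      by (rule smooth_on_compose[OF _ smooth_map_charts[OF g V(1) W(1)]]) (auto simp: A_def i)
    then show ?thesis by (rule smooth_on_cong) (auto simp: A_def i j)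
  qed
  ultimately show "\<exists>U \<phi> V \<psi> A. (U, \<phi>) \<in> charts M \<and> (V, \<psi>) \<in> charts K \<and> openin (mtop M) A \<and> p \<in> A \<and>
      A \<subseteq> U \<and> (\<lambda>x. g (f x)) ` A \<subseteq> V \<and> smooth_on (\<phi> ` A) (\<lambda>y. \<psi> (g (f (inv_into U \<phi> y))))"
    using U V W by (intro exI[of _ U] exI[of _ \<phi>] exI[of _ W] exI[of _ \<kappa>] exI[of _ A]) (auto simp: A_def)
qed

lemma smooth_atlas_open_mfd:
  assumes M: "smooth_atlas M" and W: "openin (mtop M) W"
  shows "smooth_atlas (open_mfd M W)"
proof -
  have chE: "\<exists>U0. U = U0 \<inter> W \<and> (U0, \<phi>) \<in> charts M" if "(U, \<phi>) \<in> charts (open_mfd M W)" for U \<phi>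
    using that by (auto simp: open_mfd_def)
  have top: "openin (mtop (open_mfd M W)) A \<longleftrightarrow> openin (mtop M) A \<and> A \<subseteq> W" for A
    using W by (simp add: open_mfd_def openin_open_subtopology)
  show ?thesis
  proof (rule smooth_atlasI)
    fix U \<phi> assume "(U, \<phi>) \<in> charts (open_mfd M W)"
    then obtain U0 where U: "U = U0 \<inter> W" "(U0, \<phi>) \<in> charts M" using chE by blast
    note cM = smooth_atlas_chartD[OF M U(2)]
    show "openin (mtop (open_mfd M W)) U" using cM(1) W by (simp add: top U(1) openin_Int)
    show inj: "inj_on \<phi> U" by (rule inj_on_subset[OF cM(2)]) (simp add: U(1))
    show "open (\<phi> ` A)" if "openin (mtop (open_mfd M W)) A" "A \<subseteq> U" for A
      by (rule cM(3)) (use that in \<open>simp_all add: U(1) top\<close>)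
    show "openin (mtop (open_mfd M W)) (U \<inter> \<phi> -` G)" if "open G" for G
    proof -
      have "U \<inter> \<phi> -` G = (U0 \<inter> \<phi> -` G) \<inter> W" by (auto simp: U(1))
      then show ?thesis using openin_Int[OF cM(4)[OF that] W] by (simp add: top)
    qed
    fix V \<psi> assume "(V, \<psi>) \<in> charts (open_mfd M W)"
    then obtain V0 where V: "V = V0 \<inter> W" "(V0, \<psi>) \<in> charts M" using chE by blast
    have "smooth_on (\<phi> ` (U \<inter> V)) (\<lambda>y. \<psi> (inv_into U0 \<phi> y))"
      by (rule smooth_on_subset[OF smooth_atlas_transition[OF M U(2) V(2)]]) (auto simp: U(1) V(1))
    then show "smooth_on (\<phi> ` (U \<inter> V)) (\<lambda>y. \<psi> (inv_into U \<phi> y))"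
    proof (rule smooth_on_cong)
      fix z assume "z \<in> \<phi> ` (U \<inter> V)"
      then obtain q where "q \<in> U" "q \<in> U0" "z = \<phi> q" by (auto simp: U(1))
      then show "\<psi> (inv_into U0 \<phi> z) = \<psi> (inv_into U \<phi> z)"
        using cM(2) inj by simp
    qed
  next
    fix p assume "p \<in> topspace (mtop (open_mfd M W))"
    then have p: "p \<in> topspace (mtop M)" "p \<in> W" by (auto simp: open_mfd_def)
    obtain U \<phi> where "(U, \<phi>) \<in> charts M" "p \<in> U" by (rule smooth_atlas_coverE[OF M p(1)]) (rule that)
    then show "\<exists>U \<phi>. (U, \<phi>) \<in> charts (open_mfd M W) \<and> p \<in> U"
      using p(2) by (intro exI[of _ "U \<inter> W"] exI[of _ \<phi>]) (auto simp: open_mfd_def)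
  qed
qed

lemma smooth_atlas_prod_mfd:
  assumes M: "smooth_atlas M" and N: "smooth_atlas N"
  shows "smooth_atlas (prod_mfd M N)"
proof -
  have chE: "\<exists>U1 \<phi>1 U2 \<phi>2. U = U1 \<times> U2 \<and> \<phi> = map_prod \<phi>1 \<phi>2 \<and> (U1, \<phi>1) \<in> charts M \<and> (U2, \<phi>2) \<in> charts N"
    if "(U, \<phi>) \<in> charts (prod_mfd M N)" for U \<phi>
    using that unfolding prod_mfd_def mfd.simps mem_Collect_eq prod.inject
    by (elim exE conjE) (intro exI conjI; assumption)
  have top: "mtop (prod_mfd M N) = prod_topology (mtop M) (mtop N)" by (simp add: prod_mfd_def)
  show ?thesis
  proof (rule smooth_atlasI, unfold top)
    fix U \<phi> assume "(U, \<phi>) \<in> charts (prod_mfd M N)"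
    from chE[OF this] obtain U1 \<phi>1 U2 \<phi>2 where U: "U = U1 \<times> U2" "\<phi> = map_prod \<phi>1 \<phi>2"
      "(U1, \<phi>1) \<in> charts M" "(U2, \<phi>2) \<in> charts N" by (elim exE conjE)
    note cM = smooth_atlas_chartD[OF M U(3)] and cN = smooth_atlas_chartD[OF N U(4)]
    show oU: "openin (prod_topology (mtop M) (mtop N)) U"
      using cM(1) cN(1) by (simp add: U(1) openin_prod_Times_iff)
    show inj: "inj_on \<phi> U" unfolding U(1,2) using cM(2) cN(2) by (rule map_prod_inj_on)
    show "open (\<phi> ` A)" if A: "openin (prod_topology (mtop M) (mtop N)) A" "A \<subseteq> U" for A
      unfolding open_prod_def
    proof
      fix z assume "z \<in> \<phi> ` A"
      then obtain a b where ab: "(a, b) \<in> A" "z = (\<phi>1 a, \<phi>2 b)" by (auto simp: U(2))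
      from A(1)[unfolded openin_prod_topology_alt, rule_format, OF ab(1)]
      obtain B C where BC: "openin (mtop M) B" "openin (mtop N) C" "a \<in> B" "b \<in> C" "B \<times> C \<subseteq> A"
        by (elim exE conjE)
      have abU: "a \<in> U1" "b \<in> U2" using ab(1) A(2) U(1) by auto
      have "open (\<phi>1 ` (B \<inter> U1))" "open (\<phi>2 ` (C \<inter> U2))"
        by (auto intro!: cM(3) cN(3) openin_Int BC cM(1) cN(1))
      moreover have "\<phi>1 ` (B \<inter> U1) \<times> \<phi>2 ` (C \<inter> U2) \<subseteq> \<phi> ` A"
        using BC(5) by (force simp: U(2))
      ultimately show "\<exists>G H. open G \<and> open H \<and> z \<in> G \<times> H \<and> G \<times> H \<subseteq> \<phi> ` A"
        using BC(3,4) abU ab(2)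
        by (intro exI[of _ "\<phi>1 ` (B \<inter> U1)"] exI[of _ "\<phi>2 ` (C \<inter> U2)"]) auto
    qed
    show "openin (prod_topology (mtop M) (mtop N)) (U \<inter> \<phi> -` W)" if W: "open W" for W
      unfolding openin_prod_topology_alt
    proof (intro allI impI)
      fix a b assume "(a, b) \<in> U \<inter> \<phi> -` W"
      then have ab: "a \<in> U1" "b \<in> U2" "(\<phi>1 a, \<phi>2 b) \<in> W" by (auto simp: U(1,2))
      obtain G H where GH: "open G" "open H" "(\<phi>1 a, \<phi>2 b) \<in> G \<times> H" "G \<times> H \<subseteq> W"
        using W ab(3) by (rule open_prod_elim)
      show "\<exists>B C. openin (mtop M) B \<and> openin (mtop N) C \<and> a \<in> B \<and> b \<in> C \<and> B \<times> C \<subseteq> U \<inter> \<phi> -` W"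
        using cM(4)[OF GH(1)] cN(4)[OF GH(2)] GH(3,4) ab
        by (intro exI[of _ "U1 \<inter> \<phi>1 -` G"] exI[of _ "U2 \<inter> \<phi>2 -` H"]) (auto simp: U(1,2))
    qed
    fix V \<psi> assume "(V, \<psi>) \<in> charts (prod_mfd M N)"
    from chE[OF this] obtain V1 \<psi>1 V2 \<psi>2 where V: "V = V1 \<times> V2" "\<psi> = map_prod \<psi>1 \<psi>2"
      "(V1, \<psi>1) \<in> charts M" "(V2, \<psi>2) \<in> charts N" by (elim exE conjE)
    have "smooth_on (\<phi> ` (U \<inter> V)) (\<lambda>y. (\<psi>1 (inv_into U1 \<phi>1 (fst y)), \<psi>2 (inv_into U2 \<phi>2 (snd y))))"
      by (intro smooth_on_Pair
          smooth_on_compose[OF smooth_on_linear[OF bounded_linear_fst] smooth_atlas_transition[OF M U(3) V(3)]]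
          smooth_on_compose[OF smooth_on_linear[OF bounded_linear_snd] smooth_atlas_transition[OF N U(4) V(4)]])
         (auto simp: U(1,2) V(1,2))
    then show "smooth_on (\<phi> ` (U \<inter> V)) (\<lambda>y. \<psi> (inv_into U \<phi> y))"
    proof (rule smooth_on_cong)
      fix z assume "z \<in> \<phi> ` (U \<inter> V)"
      then obtain q where q: "q \<in> U" "z = \<phi> q" by blast
      then have "fst q \<in> U1" "snd q \<in> U2" by (auto simp: U(1))
      then show "(\<psi>1 (inv_into U1 \<phi>1 (fst z)), \<psi>2 (inv_into U2 \<phi>2 (snd z))) = \<psi> (inv_into U \<phi> z)"
        unfolding q(2) inv_into_f_f[OF inj q(1)] unfolding U(2) V(2)
        by (cases q) (simp add: inv_into_f_f[OF cM(2)] inv_into_f_f[OF cN(2)])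
    qed
  next
    fix p assume "p \<in> topspace (prod_topology (mtop M) (mtop N))"
    then have p: "fst p \<in> topspace (mtop M)" "snd p \<in> topspace (mtop N)" by auto
    obtain U \<phi> where U: "(U, \<phi>) \<in> charts M" "fst p \<in> U" by (rule smooth_atlas_coverE[OF M p(1)]) (rule that)
    obtain V \<psi> where V: "(V, \<psi>) \<in> charts N" "snd p \<in> V" by (rule smooth_atlas_coverE[OF N p(2)]) (rule that)
    have "(U \<times> V, map_prod \<phi> \<psi>) \<in> charts (prod_mfd M N)"
      unfolding prod_mfd_def mfd.simps using U(1) V(1) by blast
    moreover have "p \<in> U \<times> V" using U(2) V(2) by (simp add: mem_Times_iff)
    ultimately show "\<exists>U \<phi>. (U, \<phi>) \<in> charts (prod_mfd M N) \<and> p \<in> U" by blast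
  qed
qed

section \<open>Smoothness at a point, sections and submersions\<close>
text \<open>The hypothesis of \<open>smooth_mapI\<close> at a single point.\<close>
definition smooth_at ::
  "('a, 'e::euclidean_space) mfd \<Rightarrow> ('b, 'f::euclidean_space) mfd \<Rightarrow> ('a \<Rightarrow> 'b) \<Rightarrow> 'a \<Rightarrow> bool" where
  "smooth_at M N f p \<longleftrightarrow> (\<exists>U \<phi> V \<psi> A. (U, \<phi>) \<in> charts M \<and> (V, \<psi>) \<in> charts N \<and>
      openin (mtop M) A \<and> p \<in> A \<and> A \<subseteq> U \<and> f ` A \<subseteq> V \<and> smooth_on (\<phi> ` A) (\<lambda>y. \<psi> (f (inv_into U \<phi> y))))"

lemma smooth_atI:
  assumes "(U, \<phi>) \<in> charts M" "(V, \<psi>) \<in> charts N" "openin (mtop M) A" "p \<in> A" "A \<subseteq> U" "f ` A \<subseteq> V"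
    "smooth_on (\<phi> ` A) (\<lambda>y. \<psi> (f (inv_into U \<phi> y)))"
  shows "smooth_at M N f p"
  unfolding smooth_at_def by (intro exI conjI) (rule assms)+

lemma smooth_atE:
  assumes "smooth_at M N f p"
  obtains U \<phi> V \<psi> A where "(U, \<phi>) \<in> charts M" "(V, \<psi>) \<in> charts N" "openin (mtop M) A" "p \<in> A" "A \<subseteq> U"
    "f ` A \<subseteq> V" "smooth_on (\<phi> ` A) (\<lambda>y. \<psi> (f (inv_into U \<phi> y)))"
  using assms unfolding smooth_at_def by (elim exE conjE) (rule that)

lemma smooth_map_iff_smooth_at:
  assumes M: "smooth_atlas M" and N: "smooth_atlas N"
  shows "smooth_map M N f \<longleftrightarrow> (\<forall>p\<in>topspace (mtop M). smooth_at M N f p)"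
proof (intro iffI ballI)
  fix p assume f: "smooth_map M N f" and p: "p \<in> topspace (mtop M)"
  obtain U \<phi> where U: "(U, \<phi>) \<in> charts M" "p \<in> U" by (rule smooth_atlas_coverE[OF M p]) (rule that)
  obtain V \<psi> where V: "(V, \<psi>) \<in> charts N" "f p \<in> V"
    by (rule smooth_atlas_coverE[OF N smooth_map_topspace[OF f p]]) (rule that)
  show "smooth_at M N f p"
    by (rule smooth_atI[OF U(1) V(1) smooth_map_vimage_open[OF M f U(1) smooth_atlas_chartD(1)[OF N V(1)]]])
       (use U(2) V(2) smooth_map_charts[OF f U(1) V(1)] in auto)
next
  assume "\<forall>p\<in>topspace (mtop M). smooth_at M N f p"
  then show "smooth_map M N f"
    by (intro smooth_mapI[OF M N]) (simp only: smooth_at_def)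
qed

lemma smooth_at_cong:
  assumes "smooth_atlas M" "smooth_at M N f p" "\<And>q. q \<in> topspace (mtop M) \<Longrightarrow> f q = g q"
  shows "smooth_at M N g p"
proof -
  obtain U \<phi> V \<psi> A where c: "(U, \<phi>) \<in> charts M" "(V, \<psi>) \<in> charts N" "openin (mtop M) A" "p \<in> A" "A \<subseteq> U"
    "f ` A \<subseteq> V" "smooth_on (\<phi> ` A) (\<lambda>y. \<psi> (f (inv_into U \<phi> y)))"
    by (rule smooth_atE[OF assms(2)]) (rule that)
  have e: "f q = g q" if "q \<in> A" for q using assms(3) openin_subset[OF c(3)] that by blast
  have i: "inv_into U \<phi> (\<phi> q) = q" if "q \<in> A" for q
    using smooth_atlas_chartD(2)[OF assms(1) c(1)] c(5) that by (simp add: subset_iff)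
  show ?thesis
  proof (rule smooth_atI[OF c(1-5)])
    show "g ` A \<subseteq> V" using c(6) e by auto
    show "smooth_on (\<phi> ` A) (\<lambda>y. \<psi> (g (inv_into U \<phi> y)))"
      by (rule smooth_on_cong[OF c(7)]) (auto simp: i e)
  qed
qed

text \<open>Both directions only shrink or enlarge the domain of the chart; the inverses of the two
  restrictions of the coordinate function agree where both are defined.\<close>
lemma smooth_at_open_mfd:
  assumes M: "smooth_atlas M" and W: "openin (mtop M) W" "p \<in> W"
  shows "smooth_at (open_mfd M W) N f p \<longleftrightarrow> smooth_at M N f p"
proof
  assume "smooth_at (open_mfd M W) N f p"
  then obtain U \<phi> V \<psi> A where c: "(U, \<phi>) \<in> charts (open_mfd M W)" "(V, \<psi>) \<in> charts N"
    "openin (mtop (open_mfd M W)) A" "p \<in> A" "A \<subseteq> U"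
    "f ` A \<subseteq> V" "smooth_on (\<phi> ` A) (\<lambda>y. \<psi> (f (inv_into U \<phi> y)))"
    by (rule smooth_atE) (rule that)
  obtain U0 where U0: "U = U0 \<inter> W" "(U0, \<phi>) \<in> charts M"
    using c(1) by (auto simp: open_mfd_def)
  have A: "openin (mtop M) A" using c(3) W(1) by (simp add: open_mfd_def openin_open_subtopology)
  have inj: "inj_on \<phi> U0" by (rule smooth_atlas_chartD(2)[OF M U0(2)])
  then have injU: "inj_on \<phi> U" unfolding U0(1) by (rule inj_on_subset) simp
  show "smooth_at M N f p"
  proof (rule smooth_atI[OF U0(2) c(2) A c(4) _ c(6)])
    show "smooth_on (\<phi> ` A) (\<lambda>y. \<psi> (f (inv_into U0 \<phi> y)))"
    proof (rule smooth_on_cong[OF c(7)])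
      fix y assume "y \<in> \<phi> ` A"
      then obtain q where "q \<in> U" "q \<in> U0" "y = \<phi> q" using c(5) U0(1) by auto
      then show "\<psi> (f (inv_into U \<phi> y)) = \<psi> (f (inv_into U0 \<phi> y))" using inj injU by simp
    qed
  qed (use c(5) U0(1) in simp)
next
  assume "smooth_at M N f p"
  then obtain U \<phi> V \<psi> A where c: "(U, \<phi>) \<in> charts M" "(V, \<psi>) \<in> charts N"
    "openin (mtop M) A" "p \<in> A" "A \<subseteq> U"
    "f ` A \<subseteq> V" "smooth_on (\<phi> ` A) (\<lambda>y. \<psi> (f (inv_into U \<phi> y)))"
    by (rule smooth_atE) (rule that)
  have inj: "inj_on \<phi> U" by (rule smooth_atlas_chartD(2)[OF M c(1)])
  then have injW: "inj_on \<phi> (U \<inter> W)" by (rule inj_on_subset) simp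
  have cW: "(U \<inter> W, \<phi>) \<in> charts (open_mfd M W)" unfolding open_mfd_def mfd.simps using c(1) by blast
  show "smooth_at (open_mfd M W) N f p"
  proof (rule smooth_atI[OF cW c(2), of "A \<inter> W"])
    show "openin (mtop (open_mfd M W)) (A \<inter> W)"
      using c(3) W(1) by (simp add: open_mfd_def openin_open_subtopology openin_Int)
    have "smooth_on (\<phi> ` (A \<inter> W)) (\<lambda>y. \<psi> (f (inv_into U \<phi> y)))"
      by (rule smooth_on_subset[OF c(7)]) blast
    then show "smooth_on (\<phi> ` (A \<inter> W)) (\<lambda>y. \<psi> (f (inv_into (U \<inter> W) \<phi> y)))"
    proof (rule smooth_on_cong)
      fix y assume "y \<in> \<phi> ` (A \<inter> W)"
      then obtain q where "q \<in> U" "q \<in> U \<inter> W" "y = \<phi> q" using c(5) by auto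
      then show "\<psi> (f (inv_into U \<phi> y)) = \<psi> (f (inv_into (U \<inter> W) \<phi> y))" using inj injW by simp
    qed
  qed (use c(4,5,6) W(2) in auto)
qed

lemma topspace_open_mfd: "openin (mtop M) W \<Longrightarrow> topspace (mtop (open_mfd M W)) = W"
  using openin_subset[of "mtop M" W] by (auto simp: open_mfd_def)

lemma smooth_map_cong:
  assumes "smooth_atlas M" "smooth_atlas N" "smooth_map M N f" "\<And>q. q \<in> topspace (mtop M) \<Longrightarrow> f q = g q"
  shows "smooth_map M N g"
  unfolding smooth_map_iff_smooth_at[OF assms(1,2)]
proof
  fix p assume "p \<in> topspace (mtop M)"
  then have "smooth_at M N f p" using assms(3) by (simp add: smooth_map_iff_smooth_at[OF assms(1,2)])
  then show "smooth_at M N g p" by (rule smooth_at_cong[OF assms(1)]) (rule assms(4))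
qed

lemma smooth_map_open_mfd:
  assumes "smooth_atlas M" "smooth_atlas N" "smooth_map M N f" "openin (mtop M) W"
  shows "smooth_map (open_mfd M W) N f"
  using assms(3) openin_subset[OF assms(4)]
  by (auto simp: smooth_map_iff_smooth_at[OF assms(1,2)] topspace_open_mfd[OF assms(4)]
      smooth_map_iff_smooth_at[OF smooth_atlas_open_mfd[OF assms(1,4)] assms(2)]
      smooth_at_open_mfd[OF assms(1,4)])

lemma smooth_map_local:
  assumes "smooth_atlas M" "smooth_atlas N"
    and "\<And>p. p \<in> topspace (mtop M) \<Longrightarrow> \<exists>W. openin (mtop M) W \<and> p \<in> W \<and> smooth_map (open_mfd M W) N f"
  shows "smooth_map M N f"
  unfolding smooth_map_iff_smooth_at[OF assms(1,2)]
proof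
  fix p assume p: "p \<in> topspace (mtop M)"
  from assms(3)[OF p] obtain W where W: "openin (mtop M) W" "p \<in> W" "smooth_map (open_mfd M W) N f"
    by (elim exE conjE)
  then have "smooth_at (open_mfd M W) N f p"
    unfolding smooth_map_iff_smooth_at[OF smooth_atlas_open_mfd[OF assms(1) W(1)] assms(2)]
      topspace_open_mfd[OF W(1)] by simp
  then show "smooth_at M N f p" by (simp add: smooth_at_open_mfd[OF assms(1) W(1,2)])
qed

lemma smooth_map_into_open_mfd:
  assumes M: "smooth_atlas M" and N: "smooth_atlas N" and f: "smooth_map M N f"
    and W: "openin (mtop N) W" "f ` topspace (mtop M) \<subseteq> W"
  shows "smooth_map M (open_mfd N W) f"
  unfolding smooth_map_iff_smooth_at[OF M smooth_atlas_open_mfd[OF N W(1)]]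
proof
  fix p assume p: "p \<in> topspace (mtop M)"
  have "smooth_at M N f p" using f p unfolding smooth_map_iff_smooth_at[OF M N] by (rule bspec)
  then obtain U \<phi> V \<psi> A where c: "(U, \<phi>) \<in> charts M" "(V, \<psi>) \<in> charts N" "openin (mtop M) A" "p \<in> A" "A \<subseteq> U"
    "f ` A \<subseteq> V" "smooth_on (\<phi> ` A) (\<lambda>y. \<psi> (f (inv_into U \<phi> y)))"
    by (rule smooth_atE) (rule that)
  have cW: "(V \<inter> W, \<psi>) \<in> charts (open_mfd N W)" unfolding open_mfd_def mfd.simps using c(2) by blast
  have "f ` A \<subseteq> V \<inter> W" using c(6) W(2) openin_subset[OF c(3)] by blast
  then show "smooth_at M (open_mfd N W) f p" by (rule smooth_atI[OF c(1) cW c(3-5) _ c(7)])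
qed

lemma topspace_prod_mfd: "topspace (mtop (prod_mfd M N)) = topspace (mtop M) \<times> topspace (mtop N)"
  by (simp add: prod_mfd_def)

lemma smooth_map_Pair:
  assumes M: "smooth_atlas M" and N: "smooth_atlas N" and K: "smooth_atlas K"
    and f: "smooth_map M N f" and g: "smooth_map M K g"
  shows "smooth_map M (prod_mfd N K) (\<lambda>x. (f x, g x))"
  unfolding smooth_map_iff_smooth_at[OF M smooth_atlas_prod_mfd[OF N K]]
proof
  fix p assume p: "p \<in> topspace (mtop M)"
  obtain U \<phi> where U: "(U, \<phi>) \<in> charts M" "p \<in> U" by (rule smooth_atlas_coverE[OF M p]) (rule that)
  obtain V \<psi> where V: "(V, \<psi>) \<in> charts N" "f p \<in> V"
    by (rule smooth_atlas_coverE[OF N smooth_map_topspace[OF f p]]) (rule that)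
  obtain W \<kappa> where W: "(W, \<kappa>) \<in> charts K" "g p \<in> W"
    by (rule smooth_atlas_coverE[OF K smooth_map_topspace[OF g p]]) (rule that)
  have c: "(V \<times> W, map_prod \<psi> \<kappa>) \<in> charts (prod_mfd N K)"
    unfolding prod_mfd_def mfd.simps using V(1) W(1) by blast
  let ?A = "(U \<inter> f -` V) \<inter> (U \<inter> g -` W)"
  have A: "openin (mtop M) ?A"
    by (intro openin_Int smooth_map_vimage_open[OF M f U(1)] smooth_map_vimage_open[OF M g U(1)]
        smooth_atlas_chartD(1)[OF N V(1)] smooth_atlas_chartD(1)[OF K W(1)])
  show "smooth_at M (prod_mfd N K) (\<lambda>x. (f x, g x)) p"
  proof (rule smooth_atI[OF U(1) c A])
    have "smooth_on (\<phi> ` ?A) (\<lambda>y. (\<psi> (f (inv_into U \<phi> y)), \<kappa> (g (inv_into U \<phi> y))))"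
      by (intro smooth_on_Pair smooth_on_subset[OF smooth_map_charts[OF f U(1) V(1)]]
          smooth_on_subset[OF smooth_map_charts[OF g U(1) W(1)]]) auto
    then show "smooth_on (\<phi> ` ?A) (\<lambda>y. map_prod \<psi> \<kappa> (f (inv_into U \<phi> y), g (inv_into U \<phi> y)))"
      by simp
  qed (use U(2) V(2) W(2) in auto)
qed

lemma smooth_map_projections:
  assumes M: "smooth_atlas M" and N: "smooth_atlas N"
  shows "smooth_map (prod_mfd M N) M fst" "smooth_map (prod_mfd M N) N snd"
proof -
  note P = smooth_atlas_prod_mfd[OF M N]
  have "smooth_at (prod_mfd M N) M fst p \<and> smooth_at (prod_mfd M N) N snd p"
    if "p \<in> topspace (mtop (prod_mfd M N))" for p
  proof -
    have p: "fst p \<in> topspace (mtop M)" "snd p \<in> topspace (mtop N)"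
      using that by (auto simp: topspace_prod_mfd)
    obtain U \<phi> where U: "(U, \<phi>) \<in> charts M" "fst p \<in> U" by (rule smooth_atlas_coverE[OF M p(1)]) (rule that)
    obtain V \<psi> where V: "(V, \<psi>) \<in> charts N" "snd p \<in> V" by (rule smooth_atlas_coverE[OF N p(2)]) (rule that)
    have c: "(U \<times> V, map_prod \<phi> \<psi>) \<in> charts (prod_mfd M N)"
      unfolding prod_mfd_def mfd.simps using U(1) V(1) by blast
    have pUV: "p \<in> U \<times> V" using U V by (simp add: mem_Times_iff)
    have "inj_on (map_prod \<phi> \<psi>) (U \<times> V)" by (rule smooth_atlas_chartD(2)[OF P c])
    from inv_into_f_f[OF this]
    have i: "inv_into (U \<times> V) (map_prod \<phi> \<psi>) (\<phi> x, \<psi> y) = (x, y)" if "x \<in> U" "y \<in> V" for x y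
      using that by force
    have "smooth_on (map_prod \<phi> \<psi> ` (U \<times> V)) (\<lambda>y. \<phi> (fst (inv_into (U \<times> V) (map_prod \<phi> \<psi>) y)))"
      by (rule smooth_on_cong[OF smooth_on_linear[OF bounded_linear_fst]]) (auto simp: i)
    moreover have "smooth_on (map_prod \<phi> \<psi> ` (U \<times> V)) (\<lambda>y. \<psi> (snd (inv_into (U \<times> V) (map_prod \<phi> \<psi>) y)))"
      by (rule smooth_on_cong[OF smooth_on_linear[OF bounded_linear_snd]]) (auto simp: i)
    ultimately show ?thesis
      using smooth_atI[OF c U(1) smooth_atlas_chartD(1)[OF P c] pUV]
        smooth_atI[OF c V(1) smooth_atlas_chartD(1)[OF P c] pUV] by auto
  qed
  then show "smooth_map (prod_mfd M N) M fst" "smooth_map (prod_mfd M N) N snd"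
    by (simp_all add: smooth_map_iff_smooth_at[OF P M] smooth_map_iff_smooth_at[OF P N])
qed

definition smooth_section_at ::
  "('a, 'e::euclidean_space) mfd \<Rightarrow> ('b, 'f::euclidean_space) mfd \<Rightarrow> ('a \<Rightarrow> 'b) \<Rightarrow> 'a \<Rightarrow> 'b set \<Rightarrow> ('b \<Rightarrow> 'a) \<Rightarrow> bool" where
  "smooth_section_at M N f p W s \<longleftrightarrow> openin (mtop N) W \<and> f p \<in> W \<and>
     smooth_map (open_mfd N W) M s \<and> s (f p) = p \<and> (\<forall>q\<in>W. f (s q) = q)"

text \<open>In charts the submersion has a surjective derivative, so \<open>smooth_local_section\<close>
  applies to its coordinate expression; the section is carried back by the charts.\<close>
lemma submersion_imp_section:
  assumes M: "smooth_atlas M" and N: "smooth_atlas N" and f: "submersion M N f"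
    and p: "p \<in> topspace (mtop M)"
  shows "\<exists>W s. smooth_section_at M N f p W s"
proof -
  have sm: "smooth_map M N f" using f by (simp add: submersion_def)
  obtain U \<phi> where U: "(U, \<phi>) \<in> charts M" "p \<in> U" by (rule smooth_atlas_coverE[OF M p]) (rule that)
  obtain V \<psi> where V: "(V, \<psi>) \<in> charts N" "f p \<in> V"
    by (rule smooth_atlas_coverE[OF N smooth_map_topspace[OF sm p]]) (rule that)
  note cM = smooth_atlas_chartD[OF M U(1)] and cN = smooth_atlas_chartD[OF N V(1)]
  define B where "B = U \<inter> f -` V"
  have B: "openin (mtop M) B" unfolding B_def by (rule smooth_map_vimage_open[OF M sm U(1) cN(1)])
  have oB: "open (\<phi> ` B)" by (rule cM(3)[OF B]) (simp add: B_def)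
  define F where "F y = \<psi> (f (inv_into U \<phi> y))" for y
  have F: "smooth_on (\<phi> ` B) F" unfolding F_def B_def by (rule smooth_map_charts[OF sm U(1) V(1)])
  have pB: "\<phi> p \<in> \<phi> ` B" using U(2) V(2) by (simp add: B_def)
  have "\<forall>(U, \<phi>)\<in>charts M. \<forall>(V, \<psi>)\<in>charts N. \<forall>p\<in>U \<inter> f -` V.
        surj (frechet_derivative (\<psi> \<circ> f \<circ> inv_into U \<phi>) (at (\<phi> p)))"
    using f unfolding submersion_def by (elim conjE)
  from bspec[OF bspec[OF this U(1), unfolded prod.case] V(1), unfolded prod.case, rule_format, of p]
  have "surj (frechet_derivative F (at (\<phi> p)))"
    using U(2) V(2) by (simp add: F_def[abs_def] comp_def)
  from smooth_local_section[OF oB pB F smooth_on_has_derivative[OF F oB pB] this]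
  obtain G s where G: "open G" "F (\<phi> p) \<in> G" "smooth_on G s" "s (F (\<phi> p)) = \<phi> p" "s ` G \<subseteq> \<phi> ` B"
    and Fs: "\<And>y. y \<in> G \<Longrightarrow> F (s y) = y" by metis
  have i: "inv_into U \<phi> (\<phi> q) = q" if "q \<in> U" for q using that cM(2) by simp
  have j: "inv_into V \<psi> (\<psi> q) = q" if "q \<in> V" for q using that cN(2) by simp
  define W where "W = V \<inter> \<psi> -` G"
  have W: "openin (mtop N) W" unfolding W_def by (rule cN(4)[OF G(1)])
  define t where "t q = inv_into U \<phi> (s (\<psi> q))" for q
  have tB: "t q \<in> B" "\<phi> (t q) = s (\<psi> q)" if "q \<in> W" for q
  proof -
    have "s (\<psi> q) \<in> \<phi> ` B" using that G(5) by (auto simp: W_def)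
    then obtain b where "b \<in> B" "s (\<psi> q) = \<phi> b" by blast
    then show "t q \<in> B" "\<phi> (t q) = s (\<psi> q)" using i by (auto simp: t_def B_def)
  qed
  have ft: "f (t q) = q" if "q \<in> W" for q
  proof -
    have "f (t q) \<in> V" "q \<in> V" using tB(1)[OF that] that by (auto simp: B_def W_def)
    moreover have "\<psi> (f (t q)) = \<psi> q" using Fs[of "\<psi> q"] that by (simp add: F_def t_def W_def)
    ultimately show ?thesis using cN(2) by (simp add: inj_on_eq_iff)
  qed
  have "smooth_at (open_mfd N W) M t q" if q: "q \<in> W" for q
    unfolding smooth_at_open_mfd[OF N W q]
  proof (rule smooth_atI[OF V(1) U(1) W q])
    show "W \<subseteq> V" by (simp add: W_def)
    show "t ` W \<subseteq> U" using tB(1) by (auto simp: B_def)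
    have "smooth_on (\<psi> ` W) s" by (rule smooth_on_subset[OF G(3)]) (auto simp: W_def)
    then show "smooth_on (\<psi> ` W) (\<lambda>y. \<phi> (t (inv_into V \<psi> y)))"
    proof (rule smooth_on_cong)
      fix y assume "y \<in> \<psi> ` W"
      then obtain q where "q \<in> W" "q \<in> V" "y = \<psi> q" by (auto simp: W_def)
      then show "s y = \<phi> (t (inv_into V \<psi> y))" using tB(2) j by simp
    qed
  qed
  then have "smooth_map (open_mfd N W) M t"
    by (simp add: smooth_map_iff_smooth_at[OF smooth_atlas_open_mfd[OF N W] M] topspace_open_mfd[OF W])
  moreover have "f p \<in> W" using V(2) G(2) i[OF U(2)] by (simp add: W_def F_def)
  moreover have "t (f p) = p" using G(4) i[OF U(2)] by (simp add: F_def t_def)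
  ultimately have "smooth_section_at M N f p W t" using W ft by (simp add: smooth_section_at_def)
  then show ?thesis by blast
qed

text \<open>If \<open>f \<circ> s\<close> is the identity, then so is the composition of the
  derivatives, and the derivative of \<open>f\<close> is onto. This covers all charts at
  once, with no tangent vectors to be computed.\<close>
lemma submersionI:
  assumes M: "smooth_atlas M" and N: "smooth_atlas N" and sm: "smooth_map M N f"
    and onto: "f ` topspace (mtop M) = topspace (mtop N)"
    and sec: "\<And>p. p \<in> topspace (mtop M) \<Longrightarrow> \<exists>W s. smooth_section_at M N f p W s"
  shows "submersion M N f"
proof -
  have "surj (frechet_derivative (\<psi> \<circ> f \<circ> inv_into U \<phi>) (at (\<phi> p)))"
    if U: "(U, \<phi>) \<in> charts M" and V: "(V, \<psi>) \<in> charts N" and p: "p \<in> U \<inter> f -` V" for U \<phi> V \<psi> p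
  proof -
    note cM = smooth_atlas_chartD[OF M U] and cN = smooth_atlas_chartD[OF N V]
    have pM: "p \<in> topspace (mtop M)" using p openin_subset[OF cM(1)] by blast
    obtain W s where "smooth_section_at M N f p W s" using sec[OF pM] by (elim exE)
    then have W: "openin (mtop N) W" "f p \<in> W" and s: "smooth_map (open_mfd N W) M s" "s (f p) = p"
      and fs: "\<And>q. q \<in> W \<Longrightarrow> f (s q) = q"
      by (simp_all add: smooth_section_at_def)
    define B where "B = U \<inter> f -` V"
    have B: "openin (mtop M) B" unfolding B_def by (rule smooth_map_vimage_open[OF M sm U cN(1)])
    have oB: "open (\<phi> ` B)" by (rule cM(3)[OF B]) (simp add: B_def)
    define F where "F y = \<psi> (f (inv_into U \<phi> y))" for y
    have F: "smooth_on (\<phi> ` B) F" unfolding F_def B_def by (rule smooth_map_charts[OF sm U V])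
    have pB: "\<phi> p \<in> \<phi> ` B" using p by (auto simp: B_def)
    have dF: "(F has_derivative frechet_derivative F (at (\<phi> p))) (at (\<phi> p))"
      by (rule smooth_on_has_derivative[OF F oB pB])
    note NW = smooth_atlas_open_mfd[OF N W(1)]
    have VW: "(V \<inter> W, \<psi>) \<in> charts (open_mfd N W)" unfolding open_mfd_def mfd.simps using V by blast
    define C where "C = (V \<inter> W) \<inter> s -` B"
    have "openin (mtop (open_mfd N W)) C" unfolding C_def by (rule smooth_map_vimage_open[OF NW s(1) VW B])
    then have oC: "open (\<psi> ` C)"
      by (rule smooth_atlas_chartD(3)[OF NW VW]) (auto simp: C_def)
    define S where "S y = \<phi> (s (inv_into (V \<inter> W) \<psi> y))" for y
    have S: "smooth_on (\<psi> ` C) S" unfolding S_def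
      by (rule smooth_on_subset[OF smooth_map_charts[OF s(1) VW U]]) (auto simp: C_def B_def)
    have pC: "f p \<in> C" using p W(2) s(2) by (auto simp: C_def B_def)
    then have pC': "\<psi> (f p) \<in> \<psi> ` C" by blast
    have inj: "inj_on \<psi> (V \<inter> W)" by (rule smooth_atlas_chartD(2)[OF NW VW])
    have j: "inv_into (V \<inter> W) \<psi> (\<psi> q) = q" if "q \<in> C" for q using that inj by (simp add: C_def)
    have i: "inv_into U \<phi> (\<phi> q) = q" if "q \<in> U" for q using that cM(2) by simp
    have FS: "F (S y) = y" if "y \<in> \<psi> ` C" for y
    proof -
      from that obtain q where q: "q \<in> C" "y = \<psi> q" by (rule imageE)
      then have "s q \<in> U" "q \<in> W" by (auto simp: C_def B_def)
      then show ?thesis using q j i fs by (simp add: F_def S_def)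
    qed
    have Sp: "S (\<psi> (f p)) = \<phi> p" using j[OF pC] s(2) by (simp add: S_def)
    have dS: "(S has_derivative frechet_derivative S (at (\<psi> (f p)))) (at (\<psi> (f p)))"
      by (rule smooth_on_has_derivative[OF S oC pC'])
    have "((\<lambda>y. F (S y)) has_derivative
        (\<lambda>v. frechet_derivative F (at (\<phi> p)) (frechet_derivative S (at (\<psi> (f p))) v))) (at (\<psi> (f p)))"
      by (rule has_derivative_compose[OF dS]) (simp only: Sp dF)
    then have "((\<lambda>y. y) has_derivative
        (\<lambda>v. frechet_derivative F (at (\<phi> p)) (frechet_derivative S (at (\<psi> (f p))) v))) (at (\<psi> (f p)))"
      by (rule has_derivative_transform_within_open[OF _ oC pC' FS])
    then have e: "(\<lambda>v. frechet_derivative F (at (\<phi> p)) (frechet_derivative S (at (\<psi> (f p))) v)) = (\<lambda>v. v)"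
      by (rule has_derivative_unique[OF _ has_derivative_ident])
    have "surj (frechet_derivative F (at (\<phi> p)))"
      by (rule surjI[of _ "frechet_derivative S (at (\<psi> (f p)))"]) (rule fun_cong[OF e])
    then show ?thesis by (simp add: F_def[abs_def] comp_def)
  qed
  then show ?thesis unfolding submersion_def using sm onto by auto
qed

section \<open>Embedded submanifolds and transported structures\<close>
text \<open>An atlas of embedded charts that need not contain all of them. Products and open
  submanifolds of embedded submanifolds carry such atlases, but not the full set of embedded
  charts.\<close>
definition submanifold_atlas :: "('a::euclidean_space, 'e::euclidean_space) mfd \<Rightarrow> 'a set \<Rightarrow> bool" where
  "submanifold_atlas M S \<longleftrightarrow> mtop M = top_of_set S \<and> charts M \<subseteq> charts (embedded_mfd S) \<and>
     (\<forall>p\<in>S. \<exists>(U, \<phi>)\<in>charts M. p \<in> U)"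

lemma embedded_chart_iff:
  "(U, \<phi>) \<in> charts (embedded_mfd S) \<longleftrightarrow> openin (top_of_set S) U \<and> inj_on \<phi> U \<and> open (\<phi> ` U) \<and>
     smooth_on U \<phi> \<and> smooth_on (\<phi> ` U) (inv_into U \<phi>)"
  by (simp add: embedded_mfd_def)

lemma submanifold_atlas_chartD:
  assumes "submanifold_atlas M S" "(U, \<phi>) \<in> charts M"
  shows "openin (top_of_set S) U" "inj_on \<phi> U" "open (\<phi> ` U)" "smooth_on U \<phi>" "smooth_on (\<phi> ` U) (inv_into U \<phi>)"
  using subsetD[OF _ assms(2), of "charts (embedded_mfd S)"] assms(1)
  by (simp_all add: submanifold_atlas_def embedded_chart_iff)

lemma submanifold_atlas_mtop: "submanifold_atlas M S \<Longrightarrow> mtop M = top_of_set S"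
  by (simp add: submanifold_atlas_def)

lemma submanifold_atlas_coverE:
  assumes "submanifold_atlas M S" "p \<in> S"
  obtains U \<phi> where "(U, \<phi>) \<in> charts M" "p \<in> U"
proof -
  have "\<exists>(U, \<phi>)\<in>charts M. p \<in> U" using assms by (simp add: submanifold_atlas_def)
  then show thesis using that by auto
qed

lemma submanifold_atlas_embedded:
  fixes S :: "'a::euclidean_space set"
  assumes "\<And>p. p \<in> S \<Longrightarrow> \<exists>(U, \<phi>)\<in>charts (embedded_mfd S :: ('a, 'e::euclidean_space) mfd). p \<in> U"
  shows "submanifold_atlas (embedded_mfd S :: ('a, 'e) mfd) S"
  using assms by (simp add: submanifold_atlas_def) (simp add: embedded_mfd_def)

lemma second_countable_top_of_set: "second_countable (top_of_set (S :: 'a::second_countable_topology set))"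
proof (rule second_countable_subtopology)
  obtain B :: "'a set set" where B: "countable B" "topological_basis B" using ex_countable_basis by blast
  show "second_countable (euclidean :: 'a topology)"
    unfolding second_countable_def
  proof (intro exI[of _ B] conjI ballI allI impI)
    show "openin euclidean V" if "V \<in> B" for V using B(2) that by (simp add: topological_basis_open)
    fix U :: "'a set" and x assume "openin euclidean U \<and> x \<in> U"
    then show "\<exists>V\<in>B. x \<in> V \<and> V \<subseteq> U" using topological_basisE[OF B(2), of U x] by (metis open_openin)
  qed (rule B(1))
qed

text \<open>The topological axioms are inherited from the ambient space. A transition map is the
  composition of a smooth inverse chart with a chart that extends smoothly to the ambient
  space.\<close>
lemma submanifold_atlas_imp_manifold:
  assumes "submanifold_atlas M S"
  shows "smooth_manifold M"
  unfolding smooth_manifold_def submanifold_atlas_mtop[OF assms]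
proof (intro conjI)
  show "Hausdorff_space (top_of_set S)" by (intro Hausdorff_space_subtopology Hausdorff_space_euclidean)
  show "second_countable (top_of_set S)" by (rule second_countable_top_of_set)
  have "openin (top_of_set S) U \<and> open (\<phi> ` U) \<and>
      homeomorphic_map (subtopology (top_of_set S) U) (top_of_set (\<phi> ` U)) \<phi>"
    if c: "(U, \<phi>) \<in> charts M" for U \<phi>
  proof -
    note D = submanifold_atlas_chartD[OF assms c]
    have "U \<subseteq> S" using openin_subset[OF D(1)] by simp
    then have e: "subtopology (top_of_set S) U = top_of_set U"
      by (simp add: subtopology_subtopology inf.absorb2)
    have "homeomorphic_maps (top_of_set U) (top_of_set (\<phi> ` U)) \<phi> (inv_into U \<phi>)"
      unfolding homeomorphic_maps_def using D(2) smooth_on_imp_continuous_on[OF D(4)]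
        smooth_on_imp_continuous_on[OF D(5)] by (auto simp: inv_into_into)
    then show ?thesis using D(1,3) by (simp add: e homeomorphic_maps_map)
  qed
  then show "\<forall>(U, \<phi>)\<in>charts M. openin (top_of_set S) U \<and> open (\<phi> ` U) \<and>
        homeomorphic_map (subtopology (top_of_set S) U) (top_of_set (\<phi> ` U)) \<phi>"
    by (intro ballI) (simp only: split_paired_all prod.case)
  show "(\<Union>(U, \<phi>)\<in>charts M. U) = topspace (top_of_set S)"
  proof (intro subset_antisym subsetI)
    fix p assume "p \<in> (\<Union>(U, \<phi>)\<in>charts M. U)"
    then obtain U \<phi> where c: "(U, \<phi>) \<in> charts M" "p \<in> U" by auto
    then show "p \<in> topspace (top_of_set S)"
      using openin_subset[OF submanifold_atlas_chartD(1)[OF assms c(1)]] by blast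
  next
    fix p assume "p \<in> topspace (top_of_set S)"
    then have "p \<in> S" by simp
    then obtain U \<phi> where "(U, \<phi>) \<in> charts M" "p \<in> U" by (rule submanifold_atlas_coverE[OF assms])
    then show "p \<in> (\<Union>(U, \<phi>)\<in>charts M. U)" by (intro UN_I[of "(U, \<phi>)"]) simp_all
  qed
  have "smooth_on (\<phi> ` (U \<inter> V)) (\<psi> \<circ> inv_into U \<phi>)"
    if c: "(U, \<phi>) \<in> charts M" and d: "(V, \<psi>) \<in> charts M" for U \<phi> V \<psi>
    unfolding comp_def
  proof (rule smooth_on_compose[where f = "inv_into U \<phi>" and g = \<psi> and T = V])
    note C = submanifold_atlas_chartD[OF assms c]
    show "smooth_on (\<phi> ` (U \<inter> V)) (inv_into U \<phi>)" by (rule smooth_on_subset[OF C(5)]) auto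
    show "smooth_on V \<psi>" by (rule submanifold_atlas_chartD(4)[OF assms d])
    show "inv_into U \<phi> ` \<phi> ` (U \<inter> V) \<subseteq> V" using C(2) by auto
  qed
  then show "\<forall>(U, \<phi>)\<in>charts M. \<forall>(V, \<psi>)\<in>charts M. smooth_on (\<phi> ` (U \<inter> V)) (\<psi> \<circ> inv_into U \<phi>)"
    by (intro ballI, simp only: split_paired_all prod.case, intro ballI, simp only: split_paired_all prod.case)
qed

lemma submanifold_atlas_imp_atlas: "submanifold_atlas M S \<Longrightarrow> smooth_atlas M"
  by (rule smooth_manifold_imp_atlas) (rule submanifold_atlas_imp_manifold)

text \<open>Between submanifolds, smoothness is checked in the ambient spaces; charts disappear from all
  computations with matrices.\<close>
lemma smooth_map_submanifold:
  assumes M: "submanifold_atlas M S" and N: "submanifold_atlas N T"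
    and f: "smooth_on S f" "f ` S \<subseteq> T"
  shows "smooth_map M N f"
proof -
  have "smooth_on (\<phi> ` (U \<inter> f -` V)) (\<psi> \<circ> f \<circ> inv_into U \<phi>)"
    if c: "(U, \<phi>) \<in> charts M" and d: "(V, \<psi>) \<in> charts N" for U \<phi> V \<psi>
  proof -
    note C = submanifold_atlas_chartD[OF M c] and D = submanifold_atlas_chartD[OF N d]
    have "U \<subseteq> S" using openin_subset[OF C(1)] by simp
    have "smooth_on (\<phi> ` (U \<inter> f -` V)) (inv_into U \<phi>)" by (rule smooth_on_subset[OF C(5)]) auto
    from smooth_on_compose[OF this f(1)]
    have "smooth_on (\<phi> ` (U \<inter> f -` V)) (\<lambda>y. f (inv_into U \<phi> y))" using C(2) \<open>U \<subseteq> S\<close> by force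
    from smooth_on_compose[OF this D(4)] show ?thesis unfolding comp_def using C(2) by force
  qed
  then have "\<forall>(U, \<phi>)\<in>charts M. \<forall>(V, \<psi>)\<in>charts N. smooth_on (\<phi> ` (U \<inter> f -` V)) (\<psi> \<circ> f \<circ> inv_into U \<phi>)"
    by (intro ballI, simp only: split_paired_all prod.case, intro ballI, simp only: split_paired_all prod.case)
  moreover have "continuous_map (mtop M) (mtop N) f"
    using smooth_on_imp_continuous_on[OF f(1)] f(2)
    by (auto simp: submanifold_atlas_mtop[OF M] submanifold_atlas_mtop[OF N])
  ultimately show ?thesis unfolding smooth_map_def by (intro conjI)
qed

lemma submanifold_atlas_prod_mfd:
  assumes M: "submanifold_atlas M S" and N: "submanifold_atlas N T"
  shows "submanifold_atlas (prod_mfd M N) (S \<times> T)"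
  unfolding submanifold_atlas_def
proof (intro conjI ballI subsetI)
  show "mtop (prod_mfd M N) = top_of_set (S \<times> T)"
    by (simp add: prod_mfd_def submanifold_atlas_mtop[OF M] submanifold_atlas_mtop[OF N])
next
  fix x assume "x \<in> charts (prod_mfd M N)"
  then obtain U \<phi> V \<psi> where x: "x = (U \<times> V, map_prod \<phi> \<psi>)" and c: "(U, \<phi>) \<in> charts M" and d: "(V, \<psi>) \<in> charts N"
    unfolding prod_mfd_def mfd.simps mem_Collect_eq by (elim exE conjE)
  note C = submanifold_atlas_chartD[OF M c] and D = submanifold_atlas_chartD[OF N d]
  have im: "map_prod \<phi> \<psi> ` (U \<times> V) = (\<phi> ` U) \<times> (\<psi> ` V)" by (rule map_prod_surj_on) simp_all
  have inj: "inj_on (map_prod \<phi> \<psi>) (U \<times> V)" using C(2) D(2) by (rule map_prod_inj_on)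
  have "openin (top_of_set (S \<times> T)) (U \<times> V)" using C(1) D(1) by (rule openin_Times)
  moreover have "open ((\<phi> ` U) \<times> (\<psi> ` V))" using C(3) D(3) by (rule open_Times)
  moreover have "smooth_on (U \<times> V) (map_prod \<phi> \<psi>)"
    unfolding map_prod_def case_prod_unfold
    by (intro smooth_on_Pair smooth_on_compose[OF smooth_on_linear[OF bounded_linear_fst] C(4)]
        smooth_on_compose[OF smooth_on_linear[OF bounded_linear_snd] D(4)]) auto
  moreover have "smooth_on ((\<phi> ` U) \<times> (\<psi> ` V)) (inv_into (U \<times> V) (map_prod \<phi> \<psi>))"
  proof (rule smooth_on_cong)
    show "smooth_on ((\<phi> ` U) \<times> (\<psi> ` V)) (\<lambda>y. (inv_into U \<phi> (fst y), inv_into V \<psi> (snd y)))"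
      by (intro smooth_on_Pair smooth_on_compose[OF smooth_on_linear[OF bounded_linear_fst] C(5)]
        smooth_on_compose[OF smooth_on_linear[OF bounded_linear_snd] D(5)]) auto
    fix y assume "y \<in> (\<phi> ` U) \<times> (\<psi> ` V)"
    then obtain a b where ab: "a \<in> U" "b \<in> V" "y = map_prod \<phi> \<psi> (a, b)" by auto
    have "inv_into (U \<times> V) (map_prod \<phi> \<psi>) y = (a, b)"
      unfolding ab(3) by (rule inv_into_f_f[OF inj]) (use ab in simp)
    then show "(inv_into U \<phi> (fst y), inv_into V \<psi> (snd y)) = inv_into (U \<times> V) (map_prod \<phi> \<psi>) y"
      using ab C(2) D(2) by simp
  qed
  ultimately show "x \<in> charts (embedded_mfd (S \<times> T))"
    unfolding x embedded_chart_iff im using inj by (intro conjI)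
next
  fix p assume "p \<in> S \<times> T"
  then have p: "fst p \<in> S" "snd p \<in> T" by auto
  obtain U \<phi> where U: "(U, \<phi>) \<in> charts M" "fst p \<in> U" using p(1) by (rule submanifold_atlas_coverE[OF M])
  obtain V \<psi> where V: "(V, \<psi>) \<in> charts N" "snd p \<in> V" using p(2) by (rule submanifold_atlas_coverE[OF N])
  have "(U \<times> V, map_prod \<phi> \<psi>) \<in> charts (prod_mfd M N)"
    unfolding prod_mfd_def mfd.simps using U(1) V(1) by blast
  moreover have "p \<in> U \<times> V" using U(2) V(2) by (simp add: mem_Times_iff)
  ultimately show "\<exists>(U, \<phi>)\<in>charts (prod_mfd M N). p \<in> U" by (intro bexI) simp_all
qed

lemma submanifold_atlas_open_mfd:
  assumes M: "submanifold_atlas M S" and W: "openin (top_of_set S) W"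
  shows "submanifold_atlas (open_mfd M W) W"
  unfolding submanifold_atlas_def
proof (intro conjI ballI subsetI)
  have WS: "W \<subseteq> S" using openin_subset[OF W] by simp
  show "mtop (open_mfd M W) = top_of_set W"
    using WS by (simp add: open_mfd_def submanifold_atlas_mtop[OF M] subtopology_subtopology inf.absorb2)
  fix x assume "x \<in> charts (open_mfd M W)"
  then obtain U \<phi> where x: "x = (U \<inter> W, \<phi>)" and c: "(U, \<phi>) \<in> charts M"
    unfolding open_mfd_def mfd.simps mem_Collect_eq by (elim exE conjE)
  note C = submanifold_atlas_chartD[OF M c]
  have o: "openin (mtop M) (U \<inter> W)" unfolding submanifold_atlas_mtop[OF M] using C(1) W by (rule openin_Int)
  have "openin (top_of_set W) (U \<inter> W)"
    by (rule openin_subset_trans[OF o[unfolded submanifold_atlas_mtop[OF M]]]) (use WS in auto)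
  moreover have inj: "inj_on \<phi> (U \<inter> W)" by (rule inj_on_subset[OF C(2)]) simp
  moreover have "open (\<phi> ` (U \<inter> W))"
    by (rule smooth_atlas_chartD(3)[OF submanifold_atlas_imp_atlas[OF M] c o]) simp
  moreover have "smooth_on (U \<inter> W) \<phi>" by (rule smooth_on_subset[OF C(4)]) simp
  moreover have "smooth_on (\<phi> ` (U \<inter> W)) (inv_into (U \<inter> W) \<phi>)"
  proof (rule smooth_on_cong)
    show "smooth_on (\<phi> ` (U \<inter> W)) (inv_into U \<phi>)" by (rule smooth_on_subset[OF C(5)]) auto
  qed (use C(2) inj in auto)
  ultimately show "x \<in> charts (embedded_mfd W)"
    unfolding x embedded_chart_iff by (intro conjI)
next
  fix p assume "p \<in> W"
  moreover then have "p \<in> S" using openin_subset[OF W] by auto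
  then obtain U \<phi> where U: "(U, \<phi>) \<in> charts M" "p \<in> U" by (rule submanifold_atlas_coverE[OF M])
  moreover have "(U \<inter> W, \<phi>) \<in> charts (open_mfd M W)"
    unfolding open_mfd_def mfd.simps using U(1) by blast
  ultimately show "\<exists>(U, \<phi>)\<in>charts (open_mfd M W). p \<in> U" by (intro bexI) simp_all
qed

text \<open>The manifold structure on \<open>X\<close> that makes \<open>j\<close> a diffeomorphism onto
  \<open>N\<close>; it will be used for the orbit space.\<close>
definition transport_mfd :: "'b set \<Rightarrow> ('b \<Rightarrow> 'a) \<Rightarrow> ('a, 'e) mfd \<Rightarrow> ('b, 'e) mfd" where
  "transport_mfd X j N =
     \<lparr>mtop = pullback_topology X j (mtop N), charts = {(X \<inter> j -` U, \<phi> \<circ> j) | U \<phi>. (U, \<phi>) \<in> charts N}\<rparr>"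

lemma transport_homeomorphic_map:
  assumes "bij_betw j X (topspace (mtop N))"
  shows "homeomorphic_map (mtop (transport_mfd X j N)) (mtop N) j"
proof -
  have j: "j ` X = topspace (mtop N)" "inj_on j X" using assms by (auto simp: bij_betw_def)
  have t: "topspace (pullback_topology X j (mtop N)) = X"
    unfolding topspace_pullback_topology using j(1) by auto
  show ?thesis
    unfolding transport_mfd_def mfd.simps
  proof (rule bijective_open_imp_homeomorphic_map)
    show "continuous_map (pullback_topology X j (mtop N)) (mtop N) j"
      using continuous_map_pullback[OF continuous_map_id, of X j "mtop N"] by simp
    show "open_map (pullback_topology X j (mtop N)) (mtop N) j"
      unfolding open_map_def openin_pullback_topology
    proof (intro allI impI)
      fix A assume "\<exists>U. openin (mtop N) U \<and> A = j -` U \<inter> X"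
      then obtain U where U: "openin (mtop N) U" "A = j -` U \<inter> X" by (elim exE conjE)
      have "j ` A = U \<inter> j ` X" unfolding U(2) by auto
      then have "j ` A = U" using j(1) openin_subset[OF U(1)] by auto
      then show "openin (mtop N) (j ` A)" using U(1) by simp
    qed
  qed (use j t in simp_all)
qed

lemma topspace_transport_mfd:
  assumes "bij_betw j X (topspace (mtop N))"
  shows "topspace (mtop (transport_mfd X j N)) = X"
  using assms by (auto simp: transport_mfd_def topspace_pullback_topology bij_betw_def)

text \<open>The map \<open>j\<close> is a homeomorphism for the pulled back topology, and it cancels in
  the transition maps.\<close>
lemma smooth_manifold_transport_mfd:
  assumes N: "smooth_manifold N" and j: "bij_betw j X (topspace (mtop N))"
  shows "smooth_manifold (transport_mfd X j N)"
proof -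
  let ?Q = "transport_mfd X j N"
  note h = transport_homeomorphic_map[OF j]
  note A = smooth_manifold_imp_atlas[OF N]
  have hs: "mtop ?Q homeomorphic_space mtop N" using h by (rule homeomorphic_map_imp_homeomorphic_space)
  have injj: "inj_on j X" and jX: "j ` X = topspace (mtop N)" using j by (auto simp: bij_betw_def)
  have chE: "\<exists>U0 \<phi>0. U = X \<inter> j -` U0 \<and> \<phi> = \<phi>0 \<circ> j \<and> (U0, \<phi>0) \<in> charts N" if "(U, \<phi>) \<in> charts ?Q" for U \<phi>
    using that unfolding transport_mfd_def mfd.simps mem_Collect_eq prod.inject
    by (elim exE conjE) (intro exI conjI; assumption)
  have jU: "j ` (X \<inter> j -` U0) = U0" if "(U0, \<phi>0) \<in> charts N" for U0 \<phi>0
  proof -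
    have "j ` (X \<inter> j -` U0) = U0 \<inter> j ` X" by auto
    then show ?thesis using jX openin_subset[OF smooth_atlas_chartD(1)[OF A that]] by auto
  qed
  have o: "openin (mtop ?Q) (X \<inter> j -` U0)" if "openin (mtop N) U0" for U0
    unfolding transport_mfd_def mfd.simps openin_pullback_topology using that by (intro exI[of _ U0]) auto
  show ?thesis
    unfolding smooth_manifold_def
  proof (intro conjI)
    show "Hausdorff_space (mtop ?Q)"
      using N homeomorphic_Hausdorff_space[OF hs] by (simp add: smooth_manifold_def)
    show "second_countable (mtop ?Q)"
      using N homeomorphic_space_second_countability[OF hs] by (simp add: smooth_manifold_def)
    have "openin (mtop ?Q) U \<and> open (\<phi> ` U) \<and>
        homeomorphic_map (subtopology (mtop ?Q) U) (top_of_set (\<phi> ` U)) \<phi>"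
      if "(U, \<phi>) \<in> charts ?Q" for U \<phi>
    proof -
      from chE[OF that] obtain U0 \<phi>0 where U: "U = X \<inter> j -` U0" "\<phi> = \<phi>0 \<circ> j" "(U0, \<phi>0) \<in> charts N"
        by (elim exE conjE)
      note C = smooth_atlas_chartD[OF A U(3)]
      have im: "\<phi> ` U = \<phi>0 ` U0" using jU[OF U(3)] by (metis U(1,2) image_comp)
      have "\<forall>(U, \<phi>)\<in>charts N. openin (mtop N) U \<and> open (\<phi> ` U) \<and>
          homeomorphic_map (subtopology (mtop N) U) (top_of_set (\<phi> ` U)) \<phi>"
        using N unfolding smooth_manifold_def by (elim conjE)
      from bspec[OF this U(3)] have h0: "open (\<phi>0 ` U0)"
        "homeomorphic_map (subtopology (mtop N) U0) (top_of_set (\<phi>0 ` U0)) \<phi>0" by simp_all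
      have "homeomorphic_map (subtopology (mtop ?Q) U) (subtopology (mtop N) U0) j"
        by (rule homeomorphic_map_subtopologies[OF h])
           (use jU[OF U(3)] openin_subset[OF C(1)] in \<open>auto simp: topspace_transport_mfd[OF j] U(1)\<close>)
      from homeomorphic_map_compose[OF this h0(2)] h0(1) o[OF C(1), folded U(1)] show ?thesis
        unfolding im by (simp only: U(2) simp_thms)
    qed
    then show "\<forall>(U, \<phi>)\<in>charts ?Q. openin (mtop ?Q) U \<and> open (\<phi> ` U) \<and>
        homeomorphic_map (subtopology (mtop ?Q) U) (top_of_set (\<phi> ` U)) \<phi>"
      by (intro ballI) (simp only: split_paired_all prod.case)
    show "(\<Union>(U, \<phi>)\<in>charts ?Q. U) = topspace (mtop ?Q)"
      unfolding topspace_transport_mfd[OF j]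
    proof (intro subset_antisym subsetI)
      fix p assume "p \<in> (\<Union>(U, \<phi>)\<in>charts ?Q. U)"
      then show "p \<in> X" by (auto dest: chE)
    next
      fix p assume p: "p \<in> X"
      then have "j p \<in> topspace (mtop N)" using jX by blast
      then obtain U \<phi> where c: "(U, \<phi>) \<in> charts N" "j p \<in> U" by (rule smooth_atlas_coverE[OF A])
      have "(X \<inter> j -` U, \<phi> \<circ> j) \<in> charts ?Q" unfolding transport_mfd_def mfd.simps using c(1) by blast
      then show "p \<in> (\<Union>(U, \<phi>)\<in>charts ?Q. U)" using c(2) p by (intro UN_I[of "(X \<inter> j -` U, \<phi> \<circ> j)"]) simp_all
    qed
    have "smooth_on (\<phi> ` (U \<inter> V)) (\<psi> \<circ> inv_into U \<phi>)"
      if c: "(U, \<phi>) \<in> charts ?Q" and d: "(V, \<psi>) \<in> charts ?Q" for U \<phi> V \<psi>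
    proof -
      from chE[OF c] obtain U0 \<phi>0 where U: "U = X \<inter> j -` U0" "\<phi> = \<phi>0 \<circ> j" "(U0, \<phi>0) \<in> charts N"
        by (elim exE conjE)
      from chE[OF d] obtain V0 \<psi>0 where V: "V = X \<inter> j -` V0" "\<psi> = \<psi>0 \<circ> j" "(V0, \<psi>0) \<in> charts N"
        by (elim exE conjE)
      note C = smooth_atlas_chartD[OF A U(3)]
      have inj: "inj_on \<phi> U" unfolding U(2)
        by (rule comp_inj_on[OF inj_on_subset[OF injj] inj_on_subset[OF C(2)]]) (auto simp: U(1))
      have "smooth_on (\<phi> ` (U \<inter> V)) (\<lambda>y. \<psi>0 (inv_into U0 \<phi>0 y))"
        by (rule smooth_on_subset[OF smooth_atlas_transition[OF A U(3) V(3)]]) (auto simp: U(1,2) V(1))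
      then show ?thesis
      proof (rule smooth_on_cong)
        fix y assume "y \<in> \<phi> ` (U \<inter> V)"
        then obtain q where q: "q \<in> U" "y = \<phi> q" by blast
        have "inv_into U \<phi> y = q" unfolding q(2) by (rule inv_into_f_f[OF inj q(1)])
        moreover have "inv_into U0 \<phi>0 y = j q" unfolding q(2) U(2) using q(1) C(2) by (simp add: U(1))
        ultimately show "\<psi>0 (inv_into U0 \<phi>0 y) = (\<psi> \<circ> inv_into U \<phi>) y" by (simp add: V(2))
      qed
    qed
    then show "\<forall>(U, \<phi>)\<in>charts ?Q. \<forall>(V, \<psi>)\<in>charts ?Q. smooth_on (\<phi> ` (U \<inter> V)) (\<psi> \<circ> inv_into U \<phi>)"
      by (intro ballI, simp only: split_paired_all prod.case, intro ballI, simp only: split_paired_all prod.case)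
  qed
qed

text \<open>The charts of the transported structure are those of \<open>N\<close> composed with
  \<open>j\<close>, so the coordinate expressions of \<open>f\<close> are those of \<open>j
  \<circ> f\<close>.\<close>
lemma submersion_transport_mfd:
  assumes P: "smooth_atlas P" and j: "bij_betw j X (topspace (mtop N))"
    and f: "f ` topspace (mtop P) = X" and sub: "submersion P N (j \<circ> f)"
  shows "submersion P (transport_mfd X j N) f"
proof -
  let ?Q = "transport_mfd X j N"
  have chE: "\<exists>U0 \<phi>0. U = X \<inter> j -` U0 \<and> \<phi> = \<phi>0 \<circ> j \<and> (U0, \<phi>0) \<in> charts N" if "(U, \<phi>) \<in> charts ?Q" for U \<phi>
    using that unfolding transport_mfd_def mfd.simps mem_Collect_eq prod.inject
    by (elim exE conjE) (intro exI conjI; assumption)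
  have sm: "smooth_map P N (j \<circ> f)" using sub by (simp add: submersion_def)
  have sur: "\<forall>(U, \<phi>)\<in>charts P. \<forall>(V, \<psi>)\<in>charts N. \<forall>p\<in>U \<inter> (j \<circ> f) -` V.
        surj (frechet_derivative (\<psi> \<circ> (j \<circ> f) \<circ> inv_into U \<phi>) (at (\<phi> p)))"
    using sub unfolding submersion_def by (elim conjE)
  have "continuous_map (mtop P) (mtop ?Q) f"
    unfolding transport_mfd_def mfd.simps
    by (rule continuous_map_pullback') (use sm f in \<open>auto simp: smooth_map_def\<close>)
  moreover have "smooth_on (\<phi> ` (U \<inter> f -` V)) (\<psi> \<circ> f \<circ> inv_into U \<phi>) \<and>
      (\<forall>p\<in>U \<inter> f -` V. surj (frechet_derivative (\<psi> \<circ> f \<circ> inv_into U \<phi>) (at (\<phi> p))))"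
    if c: "(U, \<phi>) \<in> charts P" and d: "(V, \<psi>) \<in> charts ?Q" for U \<phi> V \<psi>
  proof -
    from chE[OF d] obtain V0 \<psi>0 where V: "V = X \<inter> j -` V0" "\<psi> = \<psi>0 \<circ> j" "(V0, \<psi>0) \<in> charts N"
      by (elim exE conjE)
    have e: "U \<inter> f -` V = U \<inter> (j \<circ> f) -` V0"
      using f openin_subset[OF smooth_atlas_chartD(1)[OF P c]] by (auto simp: V(1))
    show ?thesis
      using smooth_map_charts[OF sm c V(3)] bspec[OF bspec[OF sur c, unfolded prod.case] V(3)]
      unfolding e V(2) by (simp add: comp_def)
  qed
  then have "\<forall>(U, \<phi>)\<in>charts P. \<forall>(V, \<psi>)\<in>charts ?Q. smooth_on (\<phi> ` (U \<inter> f -` V)) (\<psi> \<circ> f \<circ> inv_into U \<phi>)"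
    "\<forall>(U, \<phi>)\<in>charts P. \<forall>(V, \<psi>)\<in>charts ?Q. \<forall>p\<in>U \<inter> f -` V.
        surj (frechet_derivative (\<psi> \<circ> f \<circ> inv_into U \<phi>) (at (\<phi> p)))"
    by fast+
  ultimately show ?thesis unfolding submersion_def smooth_map_def
    using f topspace_transport_mfd[OF j] by simp
qed

section \<open>Matrix algebra\<close>
lemma diag_mat_mult_left: "(diag_mat z ** A) $ i $ j = z $ i * A $ i $ j"
  by (simp add: matrix_matrix_mult_def diag_mat_def if_distrib[where f = "\<lambda>a. a * _"] sum.delta cong: if_cong)

lemma diag_mat_mult_right: "(A ** diag_mat z) $ i $ j = A $ i $ j * z $ j"
  by (simp add: matrix_matrix_mult_def diag_mat_def if_distrib[where f = "\<lambda>a. _ * a"] sum.delta' cong: if_cong)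

lemma diag_mat_mult: "diag_mat z ** diag_mat w = diag_mat (z * w)"
  by (simp add: vec_eq_iff diag_mat_mult_left) (simp add: diag_mat_def)

lemma diag_mat_one: "diag_mat 1 = mat 1"
  by (simp add: diag_mat_def mat_def vec_eq_iff)

lemma diag_mat_inject: "diag_mat z = diag_mat w \<longleftrightarrow> z = w"
proof
  assume "diag_mat z = diag_mat w"
  then have "diag_mat z $ i $ i = diag_mat w $ i $ i" for i by simp
  then show "z = w" by (simp add: diag_mat_def vec_eq_iff)
qed simp

lemma mat_eq_diag_mat: "mat c = diag_mat (\<chi> i. c)"
  by (simp add: mat_def diag_mat_def vec_eq_iff)

lemma diag_mat_vec: "(diag_mat z *v v) $ i = z $ i * v $ i"
  by (simp add: matrix_vector_mult_def diag_mat_def if_distrib[where f = "\<lambda>a. a * _"] sum.delta cong: if_cong)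

lemma matrix_mult_diff_left: "(A - B) ** C = A ** C - B ** (C :: 'a::ring_1^'k^'n)"
  by (simp add: vec_eq_iff matrix_matrix_mult_def algebra_simps sum_subtractf)

lemma matrix_mult_diff_right: "C ** (A - B) = C ** A - C ** (B :: 'a::ring_1^'k^'n)"
  by (simp add: vec_eq_iff matrix_matrix_mult_def algebra_simps sum_subtractf)

lemma ctrans_ctrans: "ctrans (ctrans A) = A"
  by (simp add: ctrans_def vec_eq_iff)

lemma ctrans_mult: "ctrans (A ** B) = ctrans B ** ctrans A"
  by (simp add: ctrans_def vec_eq_iff matrix_matrix_mult_def mult.commute)

lemma ctrans_diag_mat: "ctrans (diag_mat z) = diag_mat (cnj_vec z)"
  by (simp add: ctrans_def diag_mat_def cnj_vec_def vec_eq_iff)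

lemma ctrans_mat_1: "ctrans (mat 1) = mat 1"
  by (simp add: ctrans_def mat_def vec_eq_iff)

lemma unitary_groupD:
  assumes "U \<in> unitary_group"
  shows "ctrans U ** U = mat 1" "U ** ctrans U = mat 1"
  using assms by (auto simp: unitary_group_def)

lemma unitary_groupI: "ctrans U ** U = mat 1 \<Longrightarrow> U \<in> unitary_group"
  using matrix_left_right_inverse[of "ctrans U" U] by (simp add: unitary_group_def)

lemma unitary_groupI': "U ** ctrans U = mat 1 \<Longrightarrow> U \<in> unitary_group"
  using matrix_left_right_inverse[of U "ctrans U"] by (simp add: unitary_group_def)

lemma unitary_cancel:
  assumes "U \<in> unitary_group"
  shows "ctrans U ** (U ** A) = A" "U ** (ctrans U ** A) = A"
  using unitary_groupD[OF assms] by (simp_all add: matrix_mul_assoc)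

lemma unitary_group_mult:
  assumes "U \<in> unitary_group" "V \<in> unitary_group"
  shows "U ** V \<in> unitary_group"
proof (rule unitary_groupI)
  have "ctrans (U ** V) ** (U ** V) = ctrans V ** (ctrans U ** (U ** V))"
    by (simp add: ctrans_mult matrix_mul_assoc)
  then show "ctrans (U ** V) ** (U ** V) = mat 1"
    by (simp only: unitary_cancel(1)[OF assms(1)] unitary_groupD(1)[OF assms(2)])
qed

lemma unitary_group_ctrans: "U \<in> unitary_group \<Longrightarrow> ctrans U \<in> unitary_group"
  by (auto simp: unitary_group_def ctrans_ctrans)

lemma carrier_torus: "t \<in> carrier torus \<longleftrightarrow> (\<forall>i. norm (t $ i) = 1)"
  by (simp add: torus_def)

lemma torus_cnj_mult: "t \<in> carrier torus \<Longrightarrow> cnj_vec t * t = 1" "t \<in> carrier torus \<Longrightarrow> t * cnj_vec t = 1"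
  by (auto simp: carrier_torus cnj_vec_def vec_eq_iff complex_norm_square[symmetric] mult.commute)

text \<open>This identifies the unitary matrix relating two decompositions with a point of the torus
  once it is known to be diagonal.\<close>
lemma diag_mat_unitary_iff: "diag_mat t \<in> unitary_group \<longleftrightarrow> t \<in> carrier torus"
proof
  assume "diag_mat t \<in> unitary_group"
  from unitary_groupD(1)[OF this] have "diag_mat (cnj_vec t * t) = diag_mat 1"
    by (simp add: ctrans_diag_mat diag_mat_mult diag_mat_one)
  then have e: "cnj_vec t * t = 1" unfolding diag_mat_inject .
  have "norm (t $ i) = 1" for i
  proof -
    have "cnj (t $ i) * t $ i = 1" using arg_cong[OF e, of "\<lambda>v. v $ i"] by (simp add: cnj_vec_def)
    then have "norm (t $ i) * norm (t $ i) = 1" by (metis complex_mod_cnj norm_mult norm_one)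
    then have "(norm (t $ i))\<^sup>2 = 1\<^sup>2" by (simp add: power2_eq_square)
    then show ?thesis by (rule power2_eq_imp_eq) simp_all
  qed
  then show "t \<in> carrier torus" by (simp add: carrier_torus)
next
  assume "t \<in> carrier torus"
  then show "diag_mat t \<in> unitary_group"
    by (intro unitary_groupI) (simp add: ctrans_diag_mat diag_mat_mult torus_cnj_mult diag_mat_one)
qed

text \<open>The standard Hermitian inner product, conjugate-linear in the first argument.\<close>
definition cdot :: "('n::finite) cvec \<Rightarrow> 'n cvec \<Rightarrow> complex" where
  "cdot v w = (\<Sum>i\<in>UNIV. cnj (v $ i) * w $ i)"

lemma cdot_adjoint: "cdot v (A *v w) = cdot (ctrans A *v v) w"
proof -
  have "cdot v (A *v w) = (\<Sum>i\<in>UNIV. \<Sum>j\<in>UNIV. cnj (v $ i) * (A $ i $ j * w $ j))"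
    by (simp add: cdot_def matrix_vector_mult_def sum_distrib_left)
  also have "\<dots> = (\<Sum>j\<in>UNIV. \<Sum>i\<in>UNIV. cnj (v $ i) * (A $ i $ j * w $ j))" by (rule sum.swap)
  also have "\<dots> = cdot (ctrans A *v v) w"
    by (simp add: cdot_def matrix_vector_mult_def ctrans_def sum_distrib_left sum_distrib_right mult_ac)
  finally show ?thesis .
qed

lemma cdot_self: "cdot v v = complex_of_real (\<Sum>i\<in>UNIV. (norm (v $ i))\<^sup>2)"
  unfolding cdot_def of_real_sum by (intro sum.cong) (simp_all add: complex_norm_square mult.commute del: of_real_power)

lemma cdot_self_pos: "v \<noteq> 0 \<Longrightarrow> 0 < (\<Sum>i\<in>UNIV. (norm ((v::('n::finite) cvec) $ i))\<^sup>2)"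
proof -
  assume "v \<noteq> 0"
  then obtain i where "v $ i \<noteq> 0" by (auto simp: vec_eq_iff)
  then show ?thesis by (intro sum_pos2[of _ i]) auto
qed

lemma cdot_scale: "cdot v (c *s w) = c * cdot v w" "cdot (c *s v) w = cnj c * cdot v w"
  by (simp_all add: cdot_def sum_distrib_left mult_ac)

lemma positive_definite_iff:
  "positive_definite A \<longleftrightarrow> ctrans A = A \<and> (\<forall>v. v \<noteq> 0 \<longrightarrow> 0 < Re (cdot v (A *v v)))"
  by (simp add: positive_definite_def cdot_def)

text \<open>The quadratic form of \<open>Z Z*\<close> is \<open>norm (Z* v)\<^sup>2\<close>; in
  particular it is real and nonnegative.\<close>
lemma cdot_gram: "cdot v ((Z ** ctrans Z) *v v) = complex_of_real (\<Sum>i\<in>UNIV. (norm ((ctrans Z *v v) $ i))\<^sup>2)"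
  by (simp add: matrix_vector_mul_assoc[symmetric] cdot_adjoint cdot_self del: of_real_sum)

section \<open>Characteristic polynomials\<close>

lemma poly_det: "poly (det M) z = det (\<chi> i j. poly (M $ i $ j) z)"
  by (simp add: det_def poly_sum poly_prod)

lemma poly_char_poly: "poly (char_poly A) z = det (mat z - A)"
  unfolding char_poly_def poly_det
  by (rule arg_cong[where f = det]) (simp add: vec_eq_iff mat_def)

text \<open>Unitary conjugation commutes with \<open>mat z\<close> and does not change determinants, so
  both sides have the same value at every \<open>z\<close>.\<close>
lemma char_poly_unitary_diagonal:
  fixes U :: "('n::finite) cmat"
  assumes "U \<in> unitary_group"
  shows "char_poly (U ** diag_mat d ** ctrans U) = (\<Prod>i\<in>UNIV. [:- (d $ i), 1:])"
proof -
  have "poly (char_poly (U ** diag_mat d ** ctrans U)) z = poly (\<Prod>i\<in>UNIV. [:- (d $ i), 1:]) z" for z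
  proof -
    have dm: "diag_mat (\<chi> i. z - d $ i) = mat z - diag_mat d"
      by (simp add: diag_mat_def mat_def vec_eq_iff)
    have "U ** mat z = mat z ** U"
      unfolding mat_eq_diag_mat by (simp add: vec_eq_iff diag_mat_mult_left diag_mat_mult_right)
    then have "U ** mat z ** ctrans U = mat z"
      using unitary_groupD(2)[OF assms] by (simp add: matrix_mul_assoc[symmetric])
    then have "mat z - U ** diag_mat d ** ctrans U = U ** diag_mat (\<chi> i. z - d $ i) ** ctrans U"
      by (simp add: dm matrix_mult_diff_left matrix_mult_diff_right)
    then have "det (mat z - U ** diag_mat d ** ctrans U) = det (diag_mat (\<chi> i. z - d $ i)) * det (U ** ctrans U)"
      by (simp add: det_mul)
    also have "\<dots> = (\<Prod>i\<in>UNIV. z - d $ i)"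
      using unitary_groupD(2)[OF assms] by (subst det_diagonal) (simp_all add: diag_mat_def)
    finally show ?thesis by (simp add: poly_char_poly poly_prod)
  qed
  then show ?thesis by (simp add: poly_eq_poly_eq_iff[symmetric] fun_eq_iff)
qed

text \<open>In the expansion of the determinant only the identity permutation contributes degree
  \<open>n\<close>: every other one meets an off-diagonal entry, which is constant.\<close>
lemma degree_char_poly: "degree (char_poly (A :: ('n::finite) cmat)) = CARD('n)"
proof -
  define M where "M = (\<chi> i j. (if i = j then [:0, 1:] else 0) - [:A $ i $ j:])"
  have deg: "degree (M $ i $ j) \<le> (if i = j then 1 else 0)" for i j by (simp add: M_def)
  let ?t = "\<lambda>p. of_int (sign p) * (\<Prod>i\<in>UNIV. M $ i $ p i)"
  let ?P = "{p :: 'n \<Rightarrow> 'n. p permutes UNIV}"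
  have "degree (?t id) = CARD('n)"
  proof -
    have "(\<Prod>i\<in>UNIV. M $ i $ id i) = (\<Prod>i\<in>UNIV. [:- (A $ i $ i), 1:])" by (simp add: M_def)
    then show ?thesis by (simp add: degree_prod_eq_sum_degree sign_id)
  qed
  moreover have "degree (\<Sum>p\<in>?P - {id}. ?t p) < CARD('n)"
  proof -
    have "degree (?t p) < CARD('n)" if p: "p \<in> ?P - {id}" for p
    proof -
      have "degree (?t p) \<le> degree (\<Prod>i\<in>UNIV. M $ i $ p i)"
        by (cases p rule: sign_cases) (simp_all)
      also have "\<dots> \<le> (\<Sum>i\<in>UNIV. degree (M $ i $ p i))"
        using degree_prod_sum_le[of UNIV "\<lambda>i. M $ i $ p i"] by (simp add: comp_def)
      also have "\<dots> \<le> (\<Sum>i\<in>UNIV. if i = p i then 1 else 0)" by (intro sum_mono deg)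
      also have "\<dots> = card {i. i = p i}" by (simp add: sum.If_cases)
      also have "\<dots> < CARD('n)"
      proof (rule psubset_card_mono)
        obtain i where "p i \<noteq> i" using p by (auto simp: fun_eq_iff)
        then have "i \<notin> {i. i = p i}" by simp
        then show "{i. i = p i} \<subset> UNIV" by blast
      qed simp
      finally show ?thesis .
    qed
    then have "degree (?t p) \<le> CARD('n) - 1" if "p \<in> ?P - {id}" for p using that by fastforce
    then have "degree (\<Sum>p\<in>?P - {id}. ?t p) \<le> CARD('n) - 1"
      by (intro degree_sum_le) (simp_all add: finite_permutations)
    moreover have "CARD('n) > 0" by simp
    ultimately show ?thesis by linarith
  qed
  ultimately have "degree (?t id + (\<Sum>p\<in>?P - {id}. ?t p)) = CARD('n)"
    by (subst degree_add_eq_left) simp_all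
  moreover have "det M = ?t id + (\<Sum>p\<in>?P - {id}. ?t p)"
    unfolding det_def by (rule sum.remove) (simp_all add: permutes_id finite_permutations)
  ultimately show ?thesis by (simp add: char_poly_def M_def)
qed

lemma char_poly_root_iff_eigenvalue: "poly (char_poly A) c = 0 \<longleftrightarrow> eigenvalue A c"
proof -
  have m: "mat c *v v = c *s v" for v by (simp add: mat_eq_diag_mat vec_eq_iff diag_mat_vec)
  have e: "(mat c - A) *v v = 0 \<longleftrightarrow> A *v v = c *s v" for v
    unfolding matrix_vector_mult_diff_rdistrib m by auto
  have "det (mat c - A) = 0 \<longleftrightarrow> \<not> (\<exists>B. B ** (mat c - A) = mat 1)"
    using invertible_det_nz[of "mat c - A"] invertible_left_inverse[of "mat c - A"] by auto
  also have "\<dots> \<longleftrightarrow> (\<exists>v. v \<noteq> 0 \<and> (mat c - A) *v v = 0)"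
    unfolding matrix_left_invertible_ker by auto
  finally show ?thesis by (simp add: poly_char_poly eigenvalue_def e)
qed

text \<open>Over the complex numbers the characteristic polynomial splits; if all its roots are simple,
  their number is its degree.\<close>
lemma card_eigenvalues_simple:
  fixes A :: "('n::finite) cmat"
  assumes "\<And>c. eigenvalue A c \<Longrightarrow> eigenvalue_multiplicity A c = 1"
  shows "finite {c. eigenvalue A c}" "card {c. eigenvalue A c} = CARD('n)"
proof -
  let ?p = "char_poly A" and ?R = "{c. eigenvalue A c}"
  have "degree ?p \<noteq> 0" by (simp add: degree_char_poly)
  then have "?p \<noteq> 0" by auto
  have R: "{c. poly ?p c = 0} = ?R" by (simp add: char_poly_root_iff_eigenvalue)
  show fin: "finite ?R" using poly_roots_finite[OF \<open>?p \<noteq> 0\<close>] R by simp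
  have "?p = smult (lead_coeff ?p) (\<Prod>z\<in>?R. [:-z, 1:] ^ Polynomial.order z ?p)"
    using complex_poly_decompose[of ?p] R by simp
  also have "(\<Prod>z\<in>?R. [:-z, 1:] ^ Polynomial.order z ?p) = (\<Prod>z\<in>?R. [:-z, 1:])"
    using assms by (intro prod.cong) (auto simp: eigenvalue_multiplicity_def)
  finally have "degree ?p = degree (smult (lead_coeff ?p) (\<Prod>z\<in>?R. [:-z, 1:]))" by (rule arg_cong)
  also have "\<dots> = degree (\<Prod>z\<in>?R. [:-z, 1:])" using \<open>?p \<noteq> 0\<close> by simp
  also have "\<dots> = card ?R" by (simp add: degree_prod_eq_sum_degree)
  finally show "card ?R = CARD('n)" by (simp add: degree_char_poly)
qed


text \<open>The \<open>i\<close>-th value is the entry of the decreasingly sorted list at the position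
  given by the number of indices below \<open>i\<close>.\<close>
lemma finite_real_set_decreasing_enumeration:
  fixes L :: "real set"
  assumes "finite L" "card L = CARD('n::{finite,linorder})"
  obtains l :: "'n::{finite,linorder} \<Rightarrow> real" where "range l = L" "\<And>i j. i < j \<Longrightarrow> l j < l i"
proof -
  define xs where "xs = rev (sorted_list_of_set L)"
  have len: "length xs = CARD('n)" using assms by (simp add: xs_def)
  have set: "set xs = L" using assms(1) by (simp add: xs_def)
  have srt: "sorted_wrt (\<lambda>a b. b < a) xs"
    unfolding xs_def sorted_wrt_rev by (rule strict_sorted_list_of_set)
  define r where "r i = card {..<i}" for i :: 'n
  have r: "r i < r j" if "i < j" for i j
    unfolding r_def using that by (intro psubset_card_mono) auto
  have rn: "r i < CARD('n)" for i
    unfolding r_def by (rule psubset_card_mono) auto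
  define l where "l i = xs ! r i" for i
  have dec: "l j < l i" if "i < j" for i j
    unfolding l_def using sorted_wrt_nth_less[OF srt r[OF that]] rn len by simp
  have "inj l" by (rule injI) (metis dec less_irrefl neqE)
  moreover have "range l \<subseteq> L" using rn len set nth_mem by (fastforce simp: l_def)
  ultimately have "range l = L" using assms by (intro card_subset_eq) (simp_all add: card_image)
  then show thesis using dec by (rule that)
qed

text \<open>The number of values larger than \<open>x i\<close> is the number of indices below
  \<open>i\<close>, so the position of a value in the range determines its index.\<close>
lemma decreasing_range_unique:
  fixes x y :: "'n::{finite,linorder} \<Rightarrow> real"
  assumes x: "\<And>i j. i < j \<Longrightarrow> x j < x i" and y: "\<And>i j. i < j \<Longrightarrow> y j < y i" and r: "range x = range y"
  shows "x = y"
proof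
  fix i
  have card: "card {e \<in> range z. z i < e} = card {..<i}" if z: "\<And>i j. i < j \<Longrightarrow> z j < z i" for z :: "'n \<Rightarrow> real" and i
  proof -
    have "inj z" by (rule injI) (metis z less_irrefl neqE)
    have "z i < z a \<longleftrightarrow> a < i" for a
      using z[of i a] z[of a i] by (cases a i rule: linorder_cases) auto
    then have "{e \<in> range z. z i < e} = z ` {..<i}" by auto
    then show ?thesis using \<open>inj z\<close> by (simp add: card_image inj_on_subset)
  qed
  have "x i \<in> range y" using r by blast
  then obtain j where j: "x i = y j" by blast
  have "card {..<i} = card {..<j}"
    using card[where z = x and i = i, OF x] card[where z = y and i = j, OF y] r j by simp
  moreover have "card {..<a} < card {..<b}" if "a < b" for a b :: 'n
    using that by (intro psubset_card_mono) auto
  ultimately have "i = j" by (metis less_irrefl neqE)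
  then show "x i = y i" using j by simp
qed

section \<open>The singular value decomposition\<close>

lemma svd_gram:
  assumes "V \<in> unitary_group"
  shows "(U ** diag_mat (complex_vec x) ** V) ** ctrans (U ** diag_mat (complex_vec x) ** V)
      = U ** diag_mat (complex_vec (x * x)) ** ctrans U"
proof -
  have c: "cnj_vec (complex_vec x) = complex_vec x" by (simp add: cnj_vec_def complex_vec_def vec_eq_iff)
  have xx: "complex_vec x * complex_vec x = complex_vec (x * x)" by (simp add: complex_vec_def vec_eq_iff)
  have "(U ** diag_mat (complex_vec x) ** V) ** ctrans (U ** diag_mat (complex_vec x) ** V)
      = U ** (diag_mat (complex_vec x) ** (V ** ctrans V) ** diag_mat (complex_vec x)) ** ctrans U"
    by (simp add: ctrans_mult ctrans_diag_mat c matrix_mul_assoc)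
  then show ?thesis using unitary_groupD(2)[OF assms] by (simp add: diag_mat_mult xx)
qed

text \<open>The matrix \<open>Z Z* = U D(x\<^sup>2) U*\<close> is unitarily similar to a diagonal matrix
  with distinct positive entries.\<close>
lemma svd_in_regular_matrices:
  fixes U :: "('n::{finite,linorder}) cmat"
  assumes U: "U \<in> unitary_group" and V: "V \<in> unitary_group" and x: "x \<in> decreasing_cone"
  shows "U ** diag_mat (complex_vec x) ** V \<in> regular_matrices"
proof -
  define Z where "Z = U ** diag_mat (complex_vec x) ** V"
  define d where "d = complex_vec (x * x)"
  have G: "Z ** ctrans Z = U ** diag_mat d ** ctrans U" unfolding Z_def d_def by (rule svd_gram[OF V])
  have xpos: "x $ i > 0" for i using x by (simp add: decreasing_cone_def)
  have dinj: "i = j" if "d $ i = d $ j" for i j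
  proof (rule ccontr)
    assume "i \<noteq> j"
    then have "x $ i \<noteq> x $ j"
      using x unfolding decreasing_cone_def by (cases i j rule: linorder_cases) force+
    moreover have "x $ i * x $ i = x $ j * x $ j"
      using that unfolding d_def complex_vec_def by (simp flip: of_real_mult)
    ultimately show False using xpos[of i] xpos[of j] by (simp add: square_eq_iff)
  qed
  have ker: "v = 0" if "(Z ** ctrans Z) *v v = 0" for v
  proof -
    have "diag_mat d *v (ctrans U *v v) = ctrans U *v ((Z ** ctrans Z) *v v)"
      by (simp add: G matrix_vector_mul_assoc matrix_mul_assoc unitary_groupD(1)[OF U])
    then have "diag_mat d *v (ctrans U *v v) = 0" using that by simp
    then have "(diag_mat d *v (ctrans U *v v)) $ i = 0" for i by simp
    then have "d $ i * (ctrans U *v v) $ i = 0" for i unfolding diag_mat_vec .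
    moreover have "d $ i \<noteq> 0" for i using xpos[of i] by (simp add: d_def complex_vec_def)
    ultimately have "ctrans U *v v = 0" by (simp add: vec_eq_iff)
    then have "U *v (ctrans U *v v) = 0" by simp
    then show ?thesis by (simp add: matrix_vector_mul_assoc unitary_groupD(2)[OF U])
  qed
  have "0 < Re (cdot v ((Z ** ctrans Z) *v v))" if "v \<noteq> 0" for v
  proof -
    have "ctrans Z *v v \<noteq> 0"
    proof
      assume "ctrans Z *v v = 0"
      then have "(Z ** ctrans Z) *v v = 0" by (simp add: matrix_vector_mul_assoc[symmetric])
      then show False using ker that by blast
    qed
    then show ?thesis unfolding cdot_gram Re_complex_of_real by (rule cdot_self_pos)
  qed
  then have "positive_definite (Z ** ctrans Z)"
    by (simp add: positive_definite_iff ctrans_mult ctrans_ctrans)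
  moreover have "eigenvalue_multiplicity (Z ** ctrans Z) c = 1" if "eigenvalue (Z ** ctrans Z) c" for c
  proof -
    have cp: "char_poly (Z ** ctrans Z) = (\<Prod>i\<in>UNIV. [:- (d $ i), 1:])"
      unfolding G by (rule char_poly_unitary_diagonal[OF U])
    have "poly (char_poly (Z ** ctrans Z)) c = 0" using that by (simp add: char_poly_root_iff_eigenvalue)
    then have "(\<Prod>i\<in>UNIV. c - d $ i) = 0" by (simp add: cp poly_prod)
    then obtain i where i: "c = d $ i" by auto
    have split: "(\<Prod>j\<in>UNIV. [:- (d $ j), 1:]) = [:- c, 1:] * (\<Prod>j\<in>UNIV - {i}. [:- (d $ j), 1:])"
      unfolding i by (rule prod.remove) simp_all
    have nz: "poly (\<Prod>j\<in>UNIV - {i}. [:- (d $ j), 1:]) c \<noteq> 0"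
      using dinj by (auto simp: poly_prod i)
    then have ne: "(\<Prod>j\<in>UNIV - {i}. [:- (d $ j), 1:]) \<noteq> 0" by (intro notI) (simp only: poly_0)
    have "[:- c, 1:] \<noteq> 0" by simp
    from no_zero_divisors[OF this ne]
    have "Polynomial.order c ([:- c, 1:] * (\<Prod>j\<in>UNIV - {i}. [:- (d $ j), 1:]))
        = Polynomial.order c [:- c, 1:] + Polynomial.order c (\<Prod>j\<in>UNIV - {i}. [:- (d $ j), 1:])"
      by (rule order_mult)
    also have "Polynomial.order c (\<Prod>j\<in>UNIV - {i}. [:- (d $ j), 1:]) = 0"
      using nz by (rule order_0I)
    also have "Polynomial.order c [:- c, 1:] = 1" using order_power_n_n[of c 1] by simp
    finally show ?thesis unfolding eigenvalue_multiplicity_def cp split by simp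
  qed
  ultimately show ?thesis unfolding regular_matrices_def Z_def by simp
qed

text \<open>The eigenvalues of \<open>A = Z Z*\<close> are real and positive because \<open>A\<close> is
  positive definite, and there are \<open>n\<close> of them because they are simple.
  Eigenvectors for different eigenvalues of a Hermitian matrix are orthogonal, so normalised
  ones form a unitary \<open>U\<close>. The decreasing list of square roots is
  \<open>x\<close>, and \<open>V = D(x)\<^sup>-\<^sup>1 U* Z\<close> is then unitary.\<close>
lemma regular_matrix_has_svd:
  fixes Z :: "('n::{finite,linorder}) cmat"
  assumes "Z \<in> regular_matrices"
  obtains U V x where "U \<in> unitary_group" "V \<in> unitary_group" "x \<in> decreasing_cone"
    "Z = U ** diag_mat (complex_vec x) ** V"
proof -
  define A where "A = Z ** ctrans Z"
  have pd: "positive_definite A" and simple: "\<And>c. eigenvalue A c \<Longrightarrow> eigenvalue_multiplicity A c = 1"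
    using assms by (auto simp: regular_matrices_def A_def)
  have herm: "ctrans A = A" using pd by (simp add: positive_definite_iff)
  have real: "\<exists>r. c = complex_of_real r \<and> r > 0" if c: "eigenvalue A c" for c
  proof -
    obtain v where v: "v \<noteq> 0" "A *v v = c *s v" using c by (auto simp: eigenvalue_def)
    define a where "a = (\<Sum>i\<in>UNIV. (norm (v $ i))\<^sup>2)"
    define b where "b = (\<Sum>i\<in>UNIV. (norm ((ctrans Z *v v) $ i))\<^sup>2)"
    have a: "a > 0" unfolding a_def by (rule cdot_self_pos[OF v(1)])
    have e: "c * complex_of_real a = complex_of_real b"
      using cdot_gram[of v Z] v(2) unfolding A_def[symmetric] by (simp add: cdot_scale cdot_self a_def b_def del: of_real_sum)
    have "0 < Re (cdot v (A *v v))" using pd v(1) by (simp add: positive_definite_iff)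
    then have "b > 0" using cdot_gram[of v Z] unfolding A_def[symmetric] b_def by (simp del: of_real_sum)
    have "c = complex_of_real (b / a)" using e a by (simp add: field_simps)
    then show ?thesis using a \<open>b > 0\<close> by (intro exI[of _ "b / a"]) simp
  qed
  define L where "L = Re ` {c. eigenvalue A c}"
  have RL: "complex_of_real (Re c) = c" if "eigenvalue A c" for c using real[OF that] by auto
  have "inj_on Re {c. eigenvalue A c}" by (rule inj_onI) (metis RL mem_Collect_eq)
  then have "finite L" "card L = CARD('n)"
    using card_eigenvalues_simple[OF simple] by (simp_all add: L_def card_image)
  then obtain l :: "'n \<Rightarrow> real" where l: "range l = L" and dec: "\<And>i j. i < j \<Longrightarrow> l j < l i"
    by (rule finite_real_set_decreasing_enumeration) (rule that)
  have ev: "eigenvalue A (complex_of_real (l i))" for i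
  proof -
    have "l i \<in> L" using l by blast
    then obtain c where "eigenvalue A c" "l i = Re c" unfolding L_def by blast
    then show ?thesis using RL by simp
  qed
  have lpos: "l i > 0" for i using real[OF ev[of i]] by auto
  then have lnz: "l i \<noteq> 0" for i by (metis less_irrefl)
  have "\<exists>u. A *v u = complex_of_real (l i) *s u \<and> cdot u u = 1" for i
  proof -
    obtain v where v: "v \<noteq> 0" "A *v v = complex_of_real (l i) *s v" using ev[of i] by (auto simp: eigenvalue_def)
    define a where "a = (\<Sum>i\<in>UNIV. (norm (v $ i))\<^sup>2)"
    have a: "a > 0" unfolding a_def by (rule cdot_self_pos[OF v(1)])
    define k where "k = complex_of_real (1 / sqrt a)"
    have "A *v (k *s v) = complex_of_real (l i) *s (k *s v)"
      using v(2) by (simp add: vector_scalar_commute mult.commute)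
    moreover have "cdot (k *s v) (k *s v) = 1"
    proof -
      have "cnj k * k = complex_of_real (1 / a)"
        unfolding k_def complex_cnj_complex_of_real of_real_mult[symmetric] using a by simp
      moreover have "cdot v v = complex_of_real a" by (simp only: cdot_self a_def)
      moreover have "cdot (k *s v) (k *s v) = cnj k * k * cdot v v" by (simp add: cdot_scale)
      ultimately have "cdot (k *s v) (k *s v) = complex_of_real (1 / a * a)" by (simp only: of_real_mult)
      then show ?thesis using a by simp
    qed
    ultimately show ?thesis by blast
  qed
  then obtain u where u: "\<And>i. A *v u i = complex_of_real (l i) *s u i" "\<And>i. cdot (u i) (u i) = 1" by metis
  have orth: "cdot (u i) (u j) = 0" if "i \<noteq> j" for i j
  proof -
    have "complex_of_real (l j) * cdot (u i) (u j) = cdot (u i) (A *v u j)" by (simp add: u(1) cdot_scale)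
    also have "\<dots> = cdot (A *v u i) (u j)" by (simp add: cdot_adjoint herm)
    also have "\<dots> = complex_of_real (l i) * cdot (u i) (u j)" by (simp add: u(1) cdot_scale)
    finally have "complex_of_real (l j) = complex_of_real (l i) \<or> cdot (u i) (u j) = 0" by auto
    moreover have "l j \<noteq> l i" using dec[of i j] dec[of j i] that by (cases i j rule: linorder_cases) auto
    ultimately show ?thesis by simp
  qed
  define U where "U = (\<chi> i j. u j $ i)"
  have "(ctrans U ** U) $ i $ j = cdot (u i) (u j)" for i j
    by (simp add: matrix_matrix_mult_def ctrans_def U_def cdot_def)
  then have U: "U \<in> unitary_group"
    by (intro unitary_groupI) (simp add: vec_eq_iff mat_def orth u(2))
  have AU: "A ** U = U ** diag_mat (complex_vec (\<chi> i. l i))"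
  proof -
    have "(A ** U) $ i $ j = (A *v u j) $ i" for i j
      by (simp add: matrix_matrix_mult_def matrix_vector_mult_def U_def)
    then show ?thesis
      by (simp add: vec_eq_iff diag_mat_mult_right u(1) complex_vec_def) (simp add: U_def)
  qed
  define x where "x = (\<chi> i. sqrt (l i))"
  define y where "y = (\<chi> i. 1 / sqrt (l i))"
  have x: "x \<in> decreasing_cone" using lpos dec by (simp add: x_def decreasing_cone_def)
  \<comment> \<open>The only candidate, since \<open>U D(x) V = Z\<close>.\<close>
  define V where "V = diag_mat (complex_vec y) ** ctrans U ** Z"
  have cy: "cnj_vec (complex_vec y) = complex_vec y" by (simp add: cnj_vec_def complex_vec_def vec_eq_iff)
  have yy: "complex_vec y * (complex_vec (\<chi> i. l i) * complex_vec y) = 1"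
    using lpos by (simp add: vec_eq_iff complex_vec_def y_def less_imp_le lnz flip: of_real_mult)
  have xy: "complex_vec x * complex_vec y = 1"
    using lpos by (simp add: vec_eq_iff complex_vec_def x_def y_def lnz flip: of_real_mult)
  have "V ** ctrans V = diag_mat (complex_vec y) ** (ctrans U ** (A ** U)) ** diag_mat (complex_vec y)"
    by (simp add: V_def A_def ctrans_mult ctrans_ctrans ctrans_diag_mat cy matrix_mul_assoc)
  also have "\<dots> = mat 1"
    unfolding AU unitary_cancel(1)[OF U] by (simp add: diag_mat_mult mult.assoc yy diag_mat_one)
  finally have V: "V \<in> unitary_group" by (rule unitary_groupI')
  have "U ** diag_mat (complex_vec x) ** V = U ** ((diag_mat (complex_vec x) ** diag_mat (complex_vec y)) ** (ctrans U ** Z))"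
    by (simp add: V_def matrix_mul_assoc)
  also have "\<dots> = Z" by (simp add: diag_mat_mult xy diag_mat_one unitary_cancel(2)[OF U])
  finally show thesis using that[OF U V x] by simp
qed

text \<open>With \<open>W = U'* U\<close>, the two diagonalisations of \<open>Z Z*\<close> give \<open>W
  D(x\<^sup>2) = D(x'\<^sup>2) W\<close>. A nonzero entry of \<open>W\<close> forces
  \<open>x\<^sub>j = x'\<^sub>i\<close>. Each row and column of \<open>W\<close> has one, so
  \<open>x\<close> and \<open>x'\<close> have the same values in the same order; as the
  values are distinct, \<open>W\<close> is diagonal and thus \<open>D(t)\<close> for some
  \<open>t\<close> in the torus.\<close>
lemma svd_unique_up_to_torus:
  fixes U :: "('n::{finite,linorder}) cmat"
  assumes U: "U \<in> unitary_group" and V: "V \<in> unitary_group" and x: "x \<in> decreasing_cone"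
    and U': "U' \<in> unitary_group" and V': "V' \<in> unitary_group" and x': "x' \<in> decreasing_cone"
    and eq: "U ** diag_mat (complex_vec x) ** V = U' ** diag_mat (complex_vec x') ** V'"
  shows "x' = x" "\<exists>t\<in>carrier torus. U' = U ** diag_mat (cnj_vec t) \<and> V' = diag_mat t ** V"
proof -
  define W where "W = ctrans U' ** U"
  have W: "W \<in> unitary_group" unfolding W_def by (intro unitary_group_mult unitary_group_ctrans U U')
  have xpos: "x $ i > 0" "x' $ i > 0" for i using x x' by (simp_all add: decreasing_cone_def)
  have "U ** diag_mat (complex_vec (x * x)) ** ctrans U = U' ** diag_mat (complex_vec (x' * x')) ** ctrans U'"
    using svd_gram[OF V, of U x] svd_gram[OF V', of U' x'] eq by simp
  then have "ctrans U' ** (U ** diag_mat (complex_vec (x * x)) ** ctrans U) ** U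
      = ctrans U' ** (U' ** diag_mat (complex_vec (x' * x')) ** ctrans U') ** U" by simp
  moreover have "ctrans U' ** (U ** diag_mat (complex_vec (x * x)) ** ctrans U) ** U
      = W ** diag_mat (complex_vec (x * x)) ** (ctrans U ** U)" by (simp add: W_def matrix_mul_assoc)
  moreover have "ctrans U' ** (U' ** diag_mat (complex_vec (x' * x')) ** ctrans U') ** U
      = (ctrans U' ** U') ** diag_mat (complex_vec (x' * x')) ** W" by (simp add: W_def matrix_mul_assoc)
  ultimately have "W ** diag_mat (complex_vec (x * x)) = diag_mat (complex_vec (x' * x')) ** W"
    by (simp add: unitary_groupD(1)[OF U] unitary_groupD(1)[OF U'])
  then have "(W ** diag_mat (complex_vec (x * x))) $ i $ j = (diag_mat (complex_vec (x' * x')) ** W) $ i $ j" for i j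
    by simp
  then have "W $ i $ j * complex_of_real (x $ j * x $ j) = complex_of_real (x' $ i * x' $ i) * W $ i $ j" for i j
    unfolding diag_mat_mult_left diag_mat_mult_right by (simp add: complex_vec_def)
  then have "W $ i $ j = 0 \<or> complex_of_real (x $ j * x $ j) = complex_of_real (x' $ i * x' $ i)" for i j
    by (simp add: mult.commute[of "W $ i $ j"] del: of_real_mult)
  then have Wx0: "W $ i $ j = 0 \<or> x $ j * x $ j = x' $ i * x' $ i" for i j
    unfolding of_real_eq_iff .
  have Wx: "W $ i $ j = 0 \<or> x $ j = x' $ i" for i j
    using Wx0[of i j] xpos(1)[of j] xpos(2)[of i] by (auto simp: square_eq_iff)
  have col: "\<exists>i. W $ i $ j \<noteq> 0" for j
  proof (rule ccontr)
    assume "\<not> ?thesis"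
    then have "(ctrans W ** W) $ j $ j = 0" by (simp add: matrix_matrix_mult_def)
    then show False unfolding unitary_groupD(1)[OF W] by (simp add: mat_def)
  qed
  have row: "\<exists>j. W $ i $ j \<noteq> 0" for i
  proof (rule ccontr)
    assume "\<not> ?thesis"
    then have "(W ** ctrans W) $ i $ i = 0" by (simp add: matrix_matrix_mult_def)
    then show False unfolding unitary_groupD(2)[OF W] by (simp add: mat_def)
  qed
  have "range (($) x) = range (($) x')"
  proof (intro subset_antisym subsetI)
    fix e assume "e \<in> range (($) x)"
    then obtain j where "e = x $ j" by auto
    moreover obtain i where "W $ i $ j \<noteq> 0" using col[of j] by auto
    ultimately show "e \<in> range (($) x')" using Wx[of i j] by simp
  next
    fix e assume "e \<in> range (($) x')"
    then obtain i where "e = x' $ i" by auto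
    moreover obtain j where "W $ i $ j \<noteq> 0" using row[of i] by auto
    ultimately have "e = x $ j" using Wx[of i j] by simp
    then show "e \<in> range (($) x)" by (rule image_eqI) simp
  qed
  then have "($) x = ($) x'"
    by (rule decreasing_range_unique[rotated 2]) (use x x' in \<open>simp_all add: decreasing_cone_def\<close>)
  then show xx: "x' = x" by (simp add: vec_eq_iff)
  have inj: "x $ j \<noteq> x $ i" if "i \<noteq> j" for i j
    using x that unfolding decreasing_cone_def by (cases i j rule: linorder_cases) (force, simp, force)
  have Wd: "W $ i $ j = 0" if "i \<noteq> j" for i j using Wx[of i j] inj[OF that] xx by auto
  define t where "t = (\<chi> i. W $ i $ i)"
  have Wt: "W = diag_mat t" using Wd by (simp add: vec_eq_iff diag_mat_def t_def)
  have t: "t \<in> carrier torus" using W unfolding Wt diag_mat_unitary_iff .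
  have UU': "U = U' ** diag_mat t"
    unfolding Wt[symmetric] W_def by (simp add: unitary_cancel(2)[OF U'])
  have "diag_mat (complex_vec x) ** V' = ctrans U' ** (U' ** diag_mat (complex_vec x) ** V')"
    by (simp only: matrix_mul_assoc[symmetric] unitary_cancel(1)[OF U'])
  also have "\<dots> = ctrans U' ** (U' ** diag_mat t ** diag_mat (complex_vec x) ** V)"
    using eq unfolding xx by (simp add: UU')
  also have "\<dots> = diag_mat t ** diag_mat (complex_vec x) ** V"
    by (simp only: matrix_mul_assoc[symmetric] unitary_cancel(1)[OF U'])
  also have "\<dots> = diag_mat (complex_vec x) ** (diag_mat t ** V)"
    by (simp add: matrix_mul_assoc diag_mat_mult mult.commute)
  finally have e: "diag_mat (complex_vec x) ** V' = diag_mat (complex_vec x) ** (diag_mat t ** V)" .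
  have "V' = diag_mat t ** V"
  proof -
    have "complex_of_real (x $ i) * V' $ i $ j = complex_of_real (x $ i) * (diag_mat t ** V) $ i $ j" for i j
      using arg_cong[OF e, of "\<lambda>A. A $ i $ j"] by (simp add: diag_mat_mult_left complex_vec_def)
    then show ?thesis using xpos(1) by (simp add: vec_eq_iff) (metis less_irrefl)
  qed
  moreover have "U ** diag_mat (cnj_vec t) = U'"
    unfolding UU' by (simp add: matrix_mul_assoc[symmetric] diag_mat_mult torus_cnj_mult(2)[OF t] diag_mat_one)
  ultimately show "\<exists>t\<in>carrier torus. U' = U ** diag_mat (cnj_vec t) \<and> V' = diag_mat t ** V"
    using t by blast
qed

section \<open>Smoothness of matrix operations\<close>
lemma matrix_mult_add_left: "(A + B) ** C = A ** C + B ** (C :: ('n::finite) cmat)"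
  by (simp add: vec_eq_iff matrix_matrix_mult_def algebra_simps sum.distrib)

lemma matrix_scaleR_left: "(c *\<^sub>R A) ** B = c *\<^sub>R (A ** (B :: ('n::finite) cmat))"
  by (simp add: vec_eq_iff matrix_matrix_mult_def scaleR_sum_right)

lemma matrix_scaleR_right: "A ** (c *\<^sub>R B) = c *\<^sub>R (A ** (B :: ('n::finite) cmat))"
  by (simp add: vec_eq_iff matrix_matrix_mult_def scaleR_sum_right)

lemma bounded_bilinear_matrix_mult: "bounded_bilinear ((**) :: ('n::finite) cmat \<Rightarrow> 'n cmat \<Rightarrow> 'n cmat)"
  unfolding bilinear_conv_bounded_bilinear[symmetric] bilinear_def
  by (simp add: linear_iff matrix_add_ldistrib matrix_mult_add_left matrix_scaleR_left matrix_scaleR_right)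

lemma bounded_bilinear_vec_mult: "bounded_bilinear ((*) :: ('n::finite) cvec \<Rightarrow> 'n cvec \<Rightarrow> 'n cvec)"
  unfolding bilinear_conv_bounded_bilinear[symmetric] bilinear_def
  by (simp add: linear_iff vec_eq_iff algebra_simps)

lemma bounded_linear_ctrans: "bounded_linear (ctrans :: ('n::finite) cmat \<Rightarrow> 'n cmat)"
  unfolding linear_conv_bounded_linear[symmetric] by (simp add: linear_iff vec_eq_iff ctrans_def)

lemma bounded_linear_diag_mat: "bounded_linear (diag_mat :: ('n::finite) cvec \<Rightarrow> 'n cmat)"
  unfolding linear_conv_bounded_linear[symmetric] by (simp add: linear_iff vec_eq_iff diag_mat_def)

lemma bounded_linear_cnj_vec: "bounded_linear (cnj_vec :: ('n::finite) cvec \<Rightarrow> 'n cvec)"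
  unfolding linear_conv_bounded_linear[symmetric] by (simp add: linear_iff vec_eq_iff cnj_vec_def)

lemma bounded_linear_diag_complex_vec:
  "bounded_linear (\<lambda>x::('n::finite) rvec. diag_mat (complex_vec x))"
  unfolding linear_conv_bounded_linear[symmetric]
  by (simp add: linear_iff vec_eq_iff diag_mat_def complex_vec_def complex_eq_iff)

lemma ctrans_linear_simps: "ctrans (A + B) = ctrans A + ctrans B" "ctrans (c *\<^sub>R A) = c *\<^sub>R ctrans A"
  "ctrans (A - B) = ctrans A - ctrans B"
  by (simp_all add: vec_eq_iff ctrans_def)

section \<open>Hermitian matrices as real matrices\<close>

text \<open>For a Hermitian matrix the real part is symmetric and the imaginary part is antisymmetric.
  Their sum is an arbitrary real matrix that determines both, so this is a linear
  isomorphism from Hermitian matrices to real ones, and the condition \<open>U U* =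
  1\<close> becomes an equation with independent real components.\<close>
definition hermitian_code :: "('n::finite) cmat \<Rightarrow> 'n rmat" where
  "hermitian_code H = (\<chi> i j. Re (H $ i $ j) + Im (H $ i $ j))"

lemma bounded_linear_hermitian_code: "bounded_linear (hermitian_code :: ('n::finite) cmat \<Rightarrow> 'n rmat)"
  unfolding linear_conv_bounded_linear[symmetric]
  by (simp add: linear_iff vec_eq_iff hermitian_code_def algebra_simps)

lemma hermitian_code_inject:
  assumes "ctrans H = H" "ctrans K = K" "hermitian_code H = hermitian_code K"
  shows "H = K"
proof -
  have "H $ i $ j = K $ i $ j" for i j
  proof -
    have "cnj (H $ j $ i) = H $ i $ j" "cnj (K $ j $ i) = K $ i $ j"
      using arg_cong[OF assms(1), of "\<lambda>A. A $ i $ j"] arg_cong[OF assms(2), of "\<lambda>A. A $ i $ j"]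
      by (simp_all add: ctrans_def)
    moreover have "Re (H $ i $ j) + Im (H $ i $ j) = Re (K $ i $ j) + Im (K $ i $ j)"
      "Re (H $ j $ i) + Im (H $ j $ i) = Re (K $ j $ i) + Im (K $ j $ i)"
      using arg_cong[OF assms(3), of "\<lambda>A. A $ i $ j"] arg_cong[OF assms(3), of "\<lambda>A. A $ j $ i"]
      by (simp_all add: hermitian_code_def)
    ultimately show ?thesis by (auto simp: complex_eq_iff)
  qed
  then show ?thesis by (simp add: vec_eq_iff)
qed

lemma hermitian_code_surj: "\<exists>H. ctrans H = H \<and> hermitian_code H = K"
  by (rule exI[of _ "\<chi> i j. Complex ((K $ i $ j + K $ j $ i) / 2) ((K $ i $ j - K $ j $ i) / 2)"])
     (simp add: vec_eq_iff ctrans_def hermitian_code_def complex_eq_iff field_simps)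

text \<open>The constraint function of the unitary group.\<close>
definition unitary_defect :: "('n::finite) cmat \<Rightarrow> 'n rmat" where
  "unitary_defect U = hermitian_code (U ** ctrans U)"

lemma unitary_iff_defect: "U \<in> unitary_group \<longleftrightarrow> unitary_defect U = hermitian_code (mat 1)"
proof
  assume "unitary_defect U = hermitian_code (mat 1)"
  then have "U ** ctrans U = mat 1"
    unfolding unitary_defect_def by (rule hermitian_code_inject[rotated 2]) (simp_all add: ctrans_mult ctrans_ctrans ctrans_mat_1)
  then show "U \<in> unitary_group" by (rule unitary_groupI')
qed (simp add: unitary_defect_def unitary_groupD(2))

lemma smooth_on_unitary_defect: "smooth_on S unitary_defect"
  unfolding unitary_defect_def[abs_def]
  by (intro smooth_on_linear_compose[OF bounded_linear_hermitian_code]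
      smooth_on_bilinear[OF bounded_bilinear_matrix_mult] smooth_on_ident smooth_on_linear bounded_linear_ctrans)

lemma has_derivative_unitary_defect:
  "(unitary_defect has_derivative (\<lambda>X. hermitian_code (U ** ctrans X + X ** ctrans U))) (at U)"
  unfolding unitary_defect_def[abs_def]
  by (intro bounded_linear.has_derivative[OF bounded_linear_hermitian_code]
      bounded_bilinear.FDERIV[OF bounded_bilinear_matrix_mult] has_derivative_ident
      bounded_linear_imp_has_derivative bounded_linear_ctrans)

text \<open>The unitary group is a level set of \<open>unitary_defect\<close>. The derivative at
  \<open>U\<close> reaches a Hermitian \<open>H\<close> at \<open>H U / 2\<close>.\<close>
lemma submanifold_unitary: "submanifold_atlas (unitary_mfd :: (('n::finite) cmat, 'n rmat) mfd) unitary_group"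
  unfolding unitary_mfd_def
proof (rule submanifold_atlas_embedded)
  fix U :: "'n cmat" assume U: "U \<in> unitary_group"
  show "\<exists>(A, \<phi>)\<in>charts (embedded_mfd unitary_group :: ('n cmat, 'n rmat) mfd). U \<in> A"
  proof (rule level_set_chart[OF open_UNIV UNIV_I smooth_on_unitary_defect has_derivative_unitary_defect])
    show "surj (\<lambda>X. hermitian_code (U ** ctrans X + X ** ctrans U))"
    proof (rule surjI[where f = "\<lambda>K. (1/2) *\<^sub>R ((SOME H. ctrans H = H \<and> hermitian_code H = K) ** U)"])
      fix K :: "'n rmat"
      let ?H = "SOME H. ctrans H = H \<and> hermitian_code H = K"
      let ?X = "(1/2) *\<^sub>R (?H ** U)"
      have H: "ctrans ?H = ?H" "hermitian_code ?H = K" using someI_ex[OF hermitian_code_surj[of K]] by simp_all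
      have "U ** ctrans ?X + ?X ** ctrans U = (1/2) *\<^sub>R ((U ** ctrans U) ** ?H) + (1/2) *\<^sub>R (?H ** (U ** ctrans U))"
        by (simp add: ctrans_linear_simps ctrans_mult H(1) matrix_scaleR_left matrix_scaleR_right matrix_mul_assoc)
      also have "\<dots> = ?H" by (simp add: unitary_groupD(2)[OF U] scaleR_left_distrib[symmetric])
      finally show "hermitian_code (U ** ctrans ?X + ?X ** ctrans U) = K" using H(2) by simp
    qed
    show "DIM('n cmat) = DIM('n rmat) + DIM('n rmat)" by simp
    show "unitary_group \<inter> UNIV = {z \<in> UNIV. unitary_defect z = unitary_defect U}"
      using U by (auto simp: unitary_iff_defect)
  qed
qed

definition re_vec :: "('n::finite) cvec \<Rightarrow> 'n rvec" where
  "re_vec v = (\<chi> i. Re (v $ i))"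

lemma bounded_linear_re_vec: "bounded_linear (re_vec :: ('n::finite) cvec \<Rightarrow> 'n rvec)"
  unfolding linear_conv_bounded_linear[symmetric] by (simp add: linear_iff vec_eq_iff re_vec_def)

text \<open>The torus is the level set of \<open>t \<mapsto> (norm t\<^sub>i)\<^sup>2\<close>. The
  derivative at \<open>t\<close> reaches a real vector \<open>y\<close> at \<open>y t /
  2\<close>.\<close>
lemma submanifold_torus: "submanifold_atlas (torus_mfd :: (('n::finite) cvec, 'n rvec) mfd) (carrier torus)"
  unfolding torus_mfd_def
proof (rule submanifold_atlas_embedded)
  fix t :: "'n cvec" assume t: "t \<in> carrier torus"
  define f where "f t = re_vec (t * cnj_vec t)" for t :: "'n cvec"
  have f: "s \<in> carrier torus \<longleftrightarrow> f s = 1" for s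
  proof -
    have "Re (s $ i * cnj (s $ i)) = (norm (s $ i))\<^sup>2" for i
      by (metis Re_complex_of_real complex_norm_square)
    moreover have "(norm (s $ i))\<^sup>2 = 1 \<longleftrightarrow> norm (s $ i) = 1" for i
      using abs_square_eq_1[of "norm (s $ i)"] by simp
    ultimately show ?thesis by (simp add: f_def re_vec_def vec_eq_iff cnj_vec_def carrier_torus)
  qed
  show "\<exists>(A, \<phi>)\<in>charts (embedded_mfd (carrier torus) :: ('n cvec, 'n rvec) mfd). t \<in> A"
  proof (rule level_set_chart[OF open_UNIV UNIV_I])
    show "smooth_on UNIV f" unfolding f_def
      by (intro smooth_on_linear_compose[OF bounded_linear_re_vec] smooth_on_bilinear[OF bounded_bilinear_vec_mult]
          smooth_on_ident smooth_on_linear bounded_linear_cnj_vec)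
    show "(f has_derivative (\<lambda>v. re_vec (t * cnj_vec v + v * cnj_vec t))) (at t)" unfolding f_def
      by (intro bounded_linear.has_derivative[OF bounded_linear_re_vec]
          bounded_bilinear.FDERIV[OF bounded_bilinear_vec_mult] has_derivative_ident
          bounded_linear_imp_has_derivative bounded_linear_cnj_vec)
    show "surj (\<lambda>v. re_vec (t * cnj_vec v + v * cnj_vec t))"
    proof (rule surjI)
      fix y :: "'n rvec"
      let ?v = "complex_vec ((1/2) *\<^sub>R y) * t"
      have "t $ i * cnj (t $ i) = 1" for i
        using arg_cong[OF torus_cnj_mult(2)[OF t], of "\<lambda>v. v $ i"] by (simp add: cnj_vec_def)
      then have n: "Re (t $ i) * Re (t $ i) + Im (t $ i) * Im (t $ i) = 1" for i
        by (simp add: complex_eq_iff)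
      have "Re (t $ i) * (Re (t $ i) * a) + Im (t $ i) * (Im (t $ i) * a) = a" for a i
        using arg_cong[OF n[of i], of "\<lambda>b. b * a"] by (simp add: algebra_simps)
      then show "re_vec (t * cnj_vec ?v + ?v * cnj_vec t) = y"
        by (simp add: vec_eq_iff re_vec_def cnj_vec_def complex_vec_def algebra_simps)
    qed
    show "carrier torus \<inter> UNIV = {z \<in> UNIV. f z = f t}" using t by (auto simp: f)
  qed simp
qed

lemma submanifold_open: 
  assumes "open S"
  shows "submanifold_atlas (embedded_mfd S :: ('a::euclidean_space, 'a) mfd) S"
proof (rule submanifold_atlas_embedded)
  fix p assume p: "p \<in> S"
  have "smooth_on S (inv_into S (\<lambda>x. x))"
    by (rule smooth_on_cong[OF smooth_on_ident]) (simp add: inv_into_f_f[of "\<lambda>x. x", unfolded inj_on_def])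
  then have "(S, \<lambda>x. x) \<in> charts (embedded_mfd S :: ('a, 'a) mfd)"
    using assms by (simp add: embedded_chart_iff smooth_on_ident)
  then show "\<exists>(A, \<phi>)\<in>charts (embedded_mfd S :: ('a, 'a) mfd). p \<in> A" using p by (intro bexI) simp_all
qed

lemma open_decreasing_cone: "open (decreasing_cone :: ('n::{finite,linorder}) rvec set)"
proof -
  have 1: "open {x::'n rvec. i < j \<longrightarrow> x $ j < x $ i}" for i j
  proof (cases "i < j")
    case True
    have "open {x::'n rvec. x $ j < x $ i}"
      by (rule open_Collect_less) (intro continuous_on_component continuous_on_id)+
    then show ?thesis using True by simp
  qed simp
  have 2: "open {x::'n rvec. 0 < x $ i}" for i
    by (rule open_Collect_less) (intro continuous_on_component continuous_on_id continuous_on_const)+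
  have "open ((\<Inter>i. \<Inter>j. {x::'n rvec. i < j \<longrightarrow> x $ j < x $ i}) \<inter> (\<Inter>i. {x. 0 < x $ i}))"
    by (intro open_Int open_INT ballI finite 1 2)
  moreover have "decreasing_cone = (\<Inter>i. \<Inter>j. {x::'n rvec. i < j \<longrightarrow> x $ j < x $ i}) \<inter> (\<Inter>i. {x. 0 < x $ i})"
    by (auto simp: decreasing_cone_def)
  ultimately show ?thesis by simp
qed

lemma submanifold_cone: "submanifold_atlas (cone_mfd :: (('n::{finite,linorder}) rvec, 'n rvec) mfd) decreasing_cone"
  unfolding cone_mfd_def by (rule submanifold_open[OF open_decreasing_cone])

abbreviation svd_domain :: "(('n::{finite,linorder}) cmat \<times> 'n cmat \<times> 'n rvec) set" where
  "svd_domain \<equiv> unitary_group \<times> unitary_group \<times> decreasing_cone"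

lemma submanifold_UUR: "submanifold_atlas (UUR_mfd :: (('n::{finite,linorder}) cmat \<times> 'n cmat \<times> 'n rvec, _) mfd) svd_domain"
  by (intro submanifold_atlas_prod_mfd submanifold_unitary submanifold_cone)

lemma submanifold_UU: "submanifold_atlas (UU_mfd :: (('n::finite) cmat \<times> 'n cmat, _) mfd) (unitary_group \<times> unitary_group)"
  by (intro submanifold_atlas_prod_mfd submanifold_unitary)

section \<open>Smooth local singular value decompositions\<close>

text \<open>The linearised singular value decomposition. For \<open>i \<noteq> j\<close> the entry
  \<open>(i, j)\<close> and the conjugate of the entry \<open>(j, i)\<close> form a linear
  system for \<open>A\<^sub>i\<^sub>j\<close> and \<open>B\<^sub>i\<^sub>j\<close> with
  determinant \<open>x\<^sub>j\<^sup>2 - x\<^sub>i\<^sup>2\<close>. On the diagonal,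
  \<open>e\<close> takes the real part and \<open>B\<close> the imaginary part.\<close>
lemma skew_hermitian_equation:
  fixes N :: "('n::{finite,linorder}) cmat"
  assumes x: "x \<in> decreasing_cone"
  shows "\<exists>A B e. ctrans A = - A \<and> ctrans B = - B \<and>
    A ** diag_mat (complex_vec x) + diag_mat (complex_vec x) ** B + diag_mat (complex_vec e) = N"
proof -
  let ?x = "\<lambda>i. complex_of_real (x $ i)"
  let ?d = "\<lambda>i j. ?x j * ?x j - ?x i * ?x i"
  have xpos: "x $ i > 0" for i using x by (simp add: decreasing_cone_def)
  have dec: "x $ j < x $ i" if "i < j" for i j using x that by (simp add: decreasing_cone_def)
  have xnz: "?x i \<noteq> 0" for i using xpos[of i] by simp
  have dnz: "?d i j \<noteq> 0" if "i \<noteq> j" for i j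
  proof -
    have "x $ i \<noteq> x $ j" using that dec[of i j] dec[of j i] by (cases i j rule: linorder_cases) auto
    then have "x $ j * x $ j - x $ i * x $ i \<noteq> 0" using xpos[of i] xpos[of j] by (auto simp: square_eq_iff)
    then have "complex_of_real (x $ j * x $ j - x $ i * x $ i) \<noteq> 0" by (simp only: of_real_eq_0_iff not_False_eq_True)
    then show ?thesis by simp
  qed
  \<comment> \<open>On the diagonal only the sum of the entries of \<open>A\<close> and
    \<open>B\<close> is determined, and \<open>A\<close> is chosen to vanish there; the ambiguity is
    the direction of the torus orbit.\<close>
  define A where "A = (\<chi> i j. if i = j then 0 else (?x j * N $ i $ j + ?x i * cnj (N $ j $ i)) / ?d i j)"
  define B where "B = (\<chi> i j. if i = j then \<i> * complex_of_real (Im (N $ i $ i)) / ?x i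
      else (- ?x j * cnj (N $ j $ i) - ?x i * N $ i $ j) / ?d i j)"
  define e where "e = (\<chi> i. Re (N $ i $ i))"
  have sw: "a / ?d i j = - (a / ?d j i)" for a i j
  proof -
    have "a / ?d i j = a / (- ?d j i)" by simp
    also have "\<dots> = - (a / ?d j i)" by (rule minus_divide_right[symmetric])
    finally show ?thesis .
  qed
  have "ctrans A $ i $ j = (- A) $ i $ j" for i j
    by (cases "i = j") (simp_all add: ctrans_def A_def sw[of _ i j] add.commute)
  then have "ctrans A = - A" by (simp add: vec_eq_iff)
  moreover have "ctrans B $ i $ j = (- B) $ i $ j" for i j
    by (cases "i = j") (simp_all add: ctrans_def B_def sw[of _ i j] algebra_simps)
  then have "ctrans B = - B" by (simp add: vec_eq_iff)
  moreover have "(A ** diag_mat (complex_vec x) + diag_mat (complex_vec x) ** B + diag_mat (complex_vec e)) $ i $ j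
      = N $ i $ j" for i j
  proof (cases "i = j")
    case True
    have "\<i> * complex_of_real (Im (N $ i $ i)) + complex_of_real (Re (N $ i $ i)) = N $ i $ i"
      by (simp add: complex_eq_iff)
    then show ?thesis using True xnz[of i]
      by (simp add: diag_mat_mult_left diag_mat_mult_right A_def B_def e_def complex_vec_def)
        (simp add: diag_mat_def)
  next
    case False
    have "(?x j * a + ?x i * b) / ?d i j * ?x j + ?x i * ((- ?x j * b - ?x i * a) / ?d i j) = a" for a b
      using dnz[OF False] by (simp add: divide_simps) (simp add: algebra_simps)
    then show ?thesis using False
      by (simp add: diag_mat_mult_left diag_mat_mult_right A_def B_def complex_vec_def)
        (simp add: diag_mat_def)
  qed
  then have "A ** diag_mat (complex_vec x) + diag_mat (complex_vec x) ** B + diag_mat (complex_vec e) = N"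
    by (simp add: vec_eq_iff)
  ultimately show ?thesis by blast
qed

lemma svd_map_eq: "svd_map p = fst p ** diag_mat (complex_vec (snd (snd p))) ** fst (snd p)"
  by (simp add: svd_map_def case_prod_unfold)

lemma smooth_on_svd_map: "smooth_on S svd_map"
  unfolding svd_map_eq[abs_def]
  by (intro smooth_on_bilinear[OF bounded_bilinear_matrix_mult] smooth_on_fst smooth_on_snd
      smooth_on_linear_compose[OF bounded_linear_diag_complex_vec] smooth_on_ident)

text \<open>Treating unitarity as two further equations replaces a section between manifolds by a right
  inverse \<open>s\<close> of a polynomial map \<open>F\<close> on an open set. Restricting
  \<open>s\<close> to the values \<open>(code 1, code 1, Z)\<close> enforces unitarity.\<close>
lemma svd_smooth_section:
  fixes U0 :: "('n::{finite,linorder}) cmat"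
  assumes p: "p \<in> (svd_domain :: ('n cmat \<times> 'n cmat \<times> 'n rvec) set)"
  obtains N s where "open N" "svd_map p \<in> N" "smooth_on N s" "s (svd_map p) = p" "s ` N \<subseteq> svd_domain"
    "\<And>Z. Z \<in> N \<Longrightarrow> svd_map (s Z) = Z"
proof -
  obtain U V x where pe: "p = (U, V, x)" and U: "U \<in> unitary_group" and V: "V \<in> unitary_group" and x: "x \<in> decreasing_cone"
    using p by auto
  let ?D = "\<lambda>x. diag_mat (complex_vec x)"
  define F where "F p = (unitary_defect (fst p), unitary_defect (fst (snd p)), svd_map p)" for p :: "'n cmat \<times> 'n cmat \<times> 'n rvec"
  define L where "L q = (hermitian_code (U ** ctrans (fst q) + fst q ** ctrans U),
     hermitian_code (V ** ctrans (fst (snd q)) + fst (snd q) ** ctrans V),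
     (U ** ?D x) ** fst (snd q) + (U ** ?D (snd (snd q)) + fst q ** ?D x) ** V)" for q :: "'n cmat \<times> 'n cmat \<times> 'n rvec"
  define W where "W = (UNIV :: 'n cmat set) \<times> (UNIV :: 'n cmat set) \<times> (decreasing_cone :: 'n rvec set)"
  have oW: "open W" unfolding W_def by (intro open_Times open_UNIV open_decreasing_cone)
  have pW: "p \<in> W" using x by (simp add: W_def pe)
  have sF: "smooth_on W F" unfolding F_def
    by (intro smooth_on_Pair smooth_on_svd_map smooth_on_compose[OF _ smooth_on_unitary_defect[of UNIV]]
        smooth_on_fst smooth_on_snd smooth_on_ident subset_UNIV)
  have dF: "(F has_derivative L) (at p)"
    unfolding F_def[abs_def] L_def[abs_def] svd_map_eq
  proof (intro has_derivative_Pair)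
    show "((\<lambda>p. unitary_defect (fst p)) has_derivative (\<lambda>q. hermitian_code (U ** ctrans (fst q) + fst q ** ctrans U))) (at p)"
      by (rule has_derivative_compose[OF has_derivative_fst[OF has_derivative_ident]])
         (use has_derivative_unitary_defect[of U] in \<open>simp add: pe\<close>)
    show "((\<lambda>p. unitary_defect (fst (snd p))) has_derivative
        (\<lambda>q. hermitian_code (V ** ctrans (fst (snd q)) + fst (snd q) ** ctrans V))) (at p)"
      by (rule has_derivative_compose[OF has_derivative_fst[OF has_derivative_snd[OF has_derivative_ident]]])
         (use has_derivative_unitary_defect[of V] in \<open>simp add: pe\<close>)
    have d1: "((\<lambda>p. fst p ** ?D (snd (snd p))) has_derivative
        (\<lambda>q. fst p ** ?D (snd (snd q)) + fst q ** ?D (snd (snd p)))) (at p)"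
      by (intro bounded_bilinear.FDERIV[OF bounded_bilinear_matrix_mult] has_derivative_fst has_derivative_snd
          has_derivative_ident bounded_linear.has_derivative[OF bounded_linear_diag_complex_vec])
    have "((\<lambda>p. fst p ** ?D (snd (snd p)) ** fst (snd p)) has_derivative
        (\<lambda>q. (fst p ** ?D (snd (snd p))) ** fst (snd q) +
          (fst p ** ?D (snd (snd q)) + fst q ** ?D (snd (snd p))) ** fst (snd p))) (at p)"
      by (intro bounded_bilinear.FDERIV[OF bounded_bilinear_matrix_mult] d1 has_derivative_fst has_derivative_snd
          has_derivative_ident)
    then show "((\<lambda>p. fst p ** ?D (snd (snd p)) ** fst (snd p)) has_derivative
        (\<lambda>q. (U ** ?D x) ** fst (snd q) + (U ** ?D (snd (snd q)) + fst q ** ?D x) ** V)) (at p)"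
      by (simp add: pe)
  qed
  have "surj L"
    unfolding surj_def
  proof
    fix y :: "'n rmat \<times> 'n rmat \<times> 'n cmat"
    obtain K1 K2 M where y: "y = (K1, K2, M)" by (cases y)
    obtain H1 where H1: "ctrans H1 = H1" "hermitian_code H1 = K1" using hermitian_code_surj[of K1] by (elim exE conjE)
    obtain H2 where H2: "ctrans H2 = H2" "hermitian_code H2 = K2" using hermitian_code_surj[of K2] by (elim exE conjE)
    \<comment> \<open>\<open>R\<close> is the effect on \<open>U D(x) V\<close> of the increments
      \<open>H1 U / 2\<close> and \<open>H2 V / 2\<close>, which settle the unitarity equations;
      skew-Hermitian corrections leave those equations alone and produce \<open>M - R\<close>.\<close>
    define R where "R = (1/2) *\<^sub>R (H1 ** U ** ?D x ** V) + (1/2) *\<^sub>R (U ** ?D x ** H2 ** V)"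
    obtain A B e where AB: "ctrans A = - A" "ctrans B = - B"
      "A ** ?D x + ?D x ** B + ?D e = ctrans U ** (M - R) ** ctrans V"
      using skew_hermitian_equation[OF x, of "ctrans U ** (M - R) ** ctrans V"] by (elim exE conjE)
    define X where "X = (1/2) *\<^sub>R (H1 ** U) + U ** A"
    define Y where "Y = (1/2) *\<^sub>R (H2 ** V) + B ** V"
    have neg: "C ** (- E) = - (C ** E)" "(- C) ** E = - (C ** E)" for C E :: "'n cmat"
      by (simp_all add: vec_eq_iff matrix_matrix_mult_def sum_negf)
    have cX: "ctrans X = (1/2) *\<^sub>R (ctrans U ** H1) - A ** ctrans U"
      by (simp add: X_def ctrans_linear_simps ctrans_mult H1(1) AB(1) neg)
    have cY: "ctrans Y = (1/2) *\<^sub>R (ctrans V ** H2) - ctrans V ** B"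
      by (simp add: Y_def ctrans_linear_simps ctrans_mult H2(1) AB(2) neg)
    have "U ** ctrans X + X ** ctrans U = (1/2) *\<^sub>R ((U ** ctrans U) ** H1) + (1/2) *\<^sub>R (H1 ** (U ** ctrans U))"
      unfolding cX by (simp add: X_def matrix_add_ldistrib matrix_mult_add_left matrix_mult_diff_right
          matrix_scaleR_left matrix_scaleR_right matrix_mul_assoc)
    then have 1: "U ** ctrans X + X ** ctrans U = H1"
      by (simp add: unitary_groupD(2)[OF U] scaleR_left_distrib[symmetric])
    have "V ** ctrans Y + Y ** ctrans V = (1/2) *\<^sub>R ((V ** ctrans V) ** H2) + (1/2) *\<^sub>R (H2 ** (V ** ctrans V))
        + (B ** (V ** ctrans V) - (V ** ctrans V) ** B)"
      unfolding cY by (simp add: Y_def matrix_add_ldistrib matrix_mult_add_left matrix_mult_diff_right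
          matrix_scaleR_left matrix_scaleR_right matrix_mul_assoc)
    then have 2: "V ** ctrans Y + Y ** ctrans V = H2"
      by (simp add: unitary_groupD(2)[OF V] scaleR_left_distrib[symmetric])
    have "(U ** ?D x) ** Y + (U ** ?D e + X ** ?D x) ** V = R + U ** (A ** ?D x + ?D x ** B + ?D e) ** V"
      by (simp add: X_def Y_def R_def matrix_add_ldistrib matrix_mult_add_left
          matrix_scaleR_left matrix_scaleR_right matrix_mul_assoc)
    also have "U ** (A ** ?D x + ?D x ** B + ?D e) ** V = (U ** ctrans U) ** (M - R) ** (ctrans V ** V)"
      unfolding AB(3) by (simp add: matrix_mul_assoc)
    also have "\<dots> = M - R" by (simp add: unitary_groupD[OF U] unitary_groupD[OF V])
    finally have 3: "(U ** ?D x) ** Y + (U ** ?D e + X ** ?D x) ** V = M" by simp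
    have "y = L (X, Y, e)" by (simp add: L_def y 1 2 3 H1(2) H2(2))
    then show "\<exists>q. y = L q" by (rule exI)
  qed
  from smooth_local_section[OF oW pW sF dF this]
  obtain G s where G: "open G" "F p \<in> G" "smooth_on G s" "s (F p) = p" "s ` G \<subseteq> W"
    and Fs: "\<And>y. y \<in> G \<Longrightarrow> F (s y) = y" by metis
  define i where "i Z = (hermitian_code (mat 1 :: 'n cmat), hermitian_code (mat 1 :: 'n cmat), Z)" for Z :: "'n cmat"
  have si: "smooth_on T i" for T unfolding i_def by (intro smooth_on_Pair smooth_on_const smooth_on_ident)
  have Fp: "F p = i (svd_map p)" using U V by (simp add: F_def i_def pe unitary_iff_defect)
  define N where "N = i -` G"
  show thesis
  proof (rule that[of N "\<lambda>Z. s (i Z)"])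
    show "open N" unfolding N_def using G(1) smooth_on_imp_continuous_on[OF si[of UNIV]] by (simp add: open_vimage)
    show "svd_map p \<in> N" using G(2) by (simp add: N_def Fp)
    show "smooth_on N (\<lambda>Z. s (i Z))" by (rule smooth_on_compose[OF si G(3)]) (auto simp: N_def)
    show "s (i (svd_map p)) = p" using G(4) by (simp add: Fp)
    have Z: "F (s (i Z)) = i Z" "s (i Z) \<in> W" if "Z \<in> N" for Z using that Fs G(5) by (auto simp: N_def)
    show "(\<lambda>Z. s (i Z)) ` N \<subseteq> svd_domain"
    proof (intro image_subsetI)
      fix Z assume "Z \<in> N"
      from Z[OF this] show "s (i Z) \<in> svd_domain"
        by (auto simp: F_def i_def W_def unitary_iff_defect mem_Times_iff)
    qed
    show "svd_map (s (i Z)) = Z" if "Z \<in> N" for Z using Z(1)[OF that] by (simp add: F_def i_def)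
  qed
qed

section \<open>The map onto the regular matrices\<close>
lemma svd_map_in_regular: "p \<in> svd_domain \<Longrightarrow> svd_map p \<in> regular_matrices"
  by (auto simp: svd_map_def svd_in_regular_matrices)

lemma regular_svdE:
  assumes "Z \<in> regular_matrices"
  obtains p where "p \<in> svd_domain" "svd_map p = Z"
proof -
  obtain U V x where U: "U \<in> unitary_group" "V \<in> unitary_group" "x \<in> decreasing_cone"
    "Z = U ** diag_mat (complex_vec x) ** V"
    using assms by (rule regular_matrix_has_svd)
  show thesis by (rule that[of "(U, V, x)"]) (use U in \<open>simp_all add: svd_map_def\<close>)
qed

text \<open>Near \<open>Z\<close> a smooth section provides singular value decompositions with singular
  values in the cone, and a matrix that has such a decomposition is regular.\<close>
lemma open_regular_matrices: "open (regular_matrices :: ('n::{finite,linorder}) cmat set)"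
proof (subst open_subopen, intro ballI)
  fix Z :: "'n cmat" assume "Z \<in> regular_matrices"
  then obtain p where p: "p \<in> svd_domain" "svd_map p = Z" by (rule regular_svdE)
  obtain N s where N: "open N" "svd_map p \<in> N" "s ` N \<subseteq> svd_domain" "\<And>Z. Z \<in> N \<Longrightarrow> svd_map (s Z) = Z"
    by (rule svd_smooth_section[OF p(1)]) (rule that)
  have "N \<subseteq> regular_matrices"
  proof
    fix Y assume "Y \<in> N"
    then have "svd_map (s Y) \<in> regular_matrices" using N(3) by (intro svd_map_in_regular) blast
    then show "Y \<in> regular_matrices" using N(4)[OF \<open>Y \<in> N\<close>] by simp
  qed
  with N(1,2) p(2) show "\<exists>T. open T \<and> Z \<in> T \<and> T \<subseteq> regular_matrices" by (intro exI[of _ N]) simp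
qed

lemma submanifold_regular:
  "submanifold_atlas (regular_mfd :: (('n::{finite,linorder}) cmat, 'n cmat) mfd) regular_matrices"
  unfolding regular_mfd_def by (rule submanifold_open[OF open_regular_matrices])

lemma topspace_UUR: "topspace (mtop (UUR_mfd :: (('n::{finite,linorder}) cmat \<times> 'n cmat \<times> 'n rvec, _) mfd)) = svd_domain"
  by (simp add: submanifold_atlas_mtop[OF submanifold_UUR])

lemma topspace_regular: "topspace (mtop (regular_mfd :: (('n::{finite,linorder}) cmat, 'n cmat) mfd)) = regular_matrices"
  by (simp add: submanifold_atlas_mtop[OF submanifold_regular])

lemma smooth_map_svd: "smooth_map UUR_mfd regular_mfd (svd_map :: ('n::{finite,linorder}) cmat \<times> 'n cmat \<times> 'n rvec \<Rightarrow> 'n cmat)"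
  by (rule smooth_map_submanifold[OF submanifold_UUR submanifold_regular smooth_on_svd_map])
     (intro image_subsetI svd_map_in_regular)

lemma svd_section_in_regular:
  assumes p: "p \<in> (svd_domain :: (('n::{finite,linorder}) cmat \<times> 'n cmat \<times> 'n rvec) set)"
  obtains N s where "open N" "N \<subseteq> regular_matrices" "svd_map p \<in> N" "smooth_on N s" "s (svd_map p) = p"
    "s ` N \<subseteq> svd_domain" "\<And>Z. Z \<in> N \<Longrightarrow> svd_map (s Z) = Z"
proof -
  obtain N s where N: "open N" "svd_map p \<in> N" "smooth_on N s" "s (svd_map p) = p" "s ` N \<subseteq> svd_domain"
    "\<And>Z. Z \<in> N \<Longrightarrow> svd_map (s Z) = Z"
    by (rule svd_smooth_section[OF p]) (rule that)
  have "Z \<in> regular_matrices" if "Z \<in> N" for Z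
    using svd_map_in_regular[of "s Z"] N(5,6) that by auto
  then have "N \<subseteq> regular_matrices" by blast
  with N show thesis by (intro that[of N s])
qed

lemma submersion_svd:
  "submersion UUR_mfd regular_mfd (svd_map :: ('n::{finite,linorder}) cmat \<times> 'n cmat \<times> 'n rvec \<Rightarrow> 'n cmat)"
proof (rule submersionI)
  show "smooth_atlas (UUR_mfd :: ('n cmat \<times> 'n cmat \<times> 'n rvec, _) mfd)"
    by (rule submanifold_atlas_imp_atlas[OF submanifold_UUR])
  show R: "smooth_atlas (regular_mfd :: ('n cmat, 'n cmat) mfd)"
    by (rule submanifold_atlas_imp_atlas[OF submanifold_regular])
  show "smooth_map UUR_mfd regular_mfd (svd_map :: 'n cmat \<times> 'n cmat \<times> 'n rvec \<Rightarrow> 'n cmat)"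
    by (rule smooth_map_svd)
  show "(svd_map :: 'n cmat \<times> 'n cmat \<times> 'n rvec \<Rightarrow> 'n cmat) ` topspace (mtop UUR_mfd) = topspace (mtop regular_mfd)"
    unfolding topspace_UUR topspace_regular
  proof (intro subset_antisym image_subsetI subsetI svd_map_in_regular)
    fix Z :: "'n cmat" assume "Z \<in> regular_matrices"
    then obtain p where "p \<in> svd_domain" "svd_map p = Z" by (rule regular_svdE)
    then show "Z \<in> svd_map ` svd_domain" by (intro image_eqI[of _ _ p]) simp_all
  qed
  fix p :: "'n cmat \<times> 'n cmat \<times> 'n rvec" assume "p \<in> topspace (mtop UUR_mfd)"
  then have p: "p \<in> svd_domain" by (simp only: topspace_UUR)
  obtain N s where N: "open N" "N \<subseteq> regular_matrices" "svd_map p \<in> N" "smooth_on N s" "s (svd_map p) = p"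
    "s ` N \<subseteq> svd_domain" "\<And>Z. Z \<in> N \<Longrightarrow> svd_map (s Z) = Z"
    by (rule svd_section_in_regular[OF p]) (rule that)
  have oN: "openin (top_of_set regular_matrices) N" by (rule open_subset[OF N(2,1)]) 
  have "smooth_map (open_mfd regular_mfd N) UUR_mfd s"
    by (rule smooth_map_submanifold[OF submanifold_atlas_open_mfd[OF submanifold_regular oN] submanifold_UUR N(4,6)])
  then have "smooth_section_at UUR_mfd regular_mfd svd_map p N s"
    using oN N(3,5,7) by (simp add: smooth_section_at_def submanifold_atlas_mtop[OF submanifold_regular])
  then show "\<exists>W s. smooth_section_at UUR_mfd regular_mfd svd_map p W s" by blast
qed

section \<open>The torus action\<close>

lemma torus_simps [simp]: "mult torus = (*)" "one torus = 1"
  by (simp_all add: torus_def)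

lemma torus_closed: "t \<in> carrier torus \<Longrightarrow> u \<in> carrier torus \<Longrightarrow> t * u \<in> carrier torus"
  "1 \<in> carrier torus" "t \<in> carrier torus \<Longrightarrow> cnj_vec t \<in> carrier torus"
  by (simp_all add: carrier_torus norm_mult cnj_vec_def)

lemma group_torus: "group (torus :: ('n::finite) cvec monoid)"
proof (rule groupI)
  fix t :: "'n cvec" assume t: "t \<in> carrier torus"
  show "\<exists>u\<in>carrier torus. u \<otimes>\<^bsub>torus\<^esub> t = \<one>\<^bsub>torus\<^esub>"
    by (rule bexI[of _ "cnj_vec t"]) (simp_all add: torus_cnj_mult(1)[OF t] torus_closed(3)[OF t])
qed (simp_all add: torus_closed mult.assoc)

lemma inv_torus: "t \<in> carrier torus \<Longrightarrow> inv\<^bsub>torus\<^esub> t = cnj_vec t"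
  by (rule group.inv_equality[OF group_torus]) (simp_all add: torus_cnj_mult torus_closed)

lemma topspace_torus: "topspace (mtop (torus_mfd :: (('n::finite) cvec, 'n rvec) mfd)) = carrier torus"
  by (simp add: submanifold_atlas_mtop[OF submanifold_torus])

lemma lie_group_torus: "lie_group (torus :: ('n::finite) cvec monoid) (torus_mfd :: ('n cvec, 'n rvec) mfd)"
  unfolding lie_group_def
proof (intro conjI group_torus topspace_torus submanifold_atlas_imp_manifold[OF submanifold_torus])
  show "smooth_map (prod_mfd torus_mfd torus_mfd) torus_mfd (\<lambda>(g, h). g \<otimes>\<^bsub>torus\<^esub> h :: 'n cvec)"
  proof (rule smooth_map_submanifold[OF submanifold_atlas_prod_mfd[OF submanifold_torus submanifold_torus] submanifold_torus])
    show "smooth_on (carrier torus \<times> carrier torus) (\<lambda>(g, h). g \<otimes>\<^bsub>torus\<^esub> h :: 'n cvec)"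
      unfolding case_prod_unfold torus_simps
      by (intro smooth_on_bilinear[OF bounded_bilinear_vec_mult] smooth_on_fst smooth_on_snd smooth_on_ident)
  qed (auto intro: torus_closed)
  show "smooth_map torus_mfd torus_mfd (\<lambda>g :: 'n cvec. inv\<^bsub>torus\<^esub> g)"
  proof (rule smooth_map_submanifold[OF submanifold_torus submanifold_torus])
    show "smooth_on (carrier torus) (\<lambda>g :: 'n cvec. inv\<^bsub>torus\<^esub> g)"
      by (rule smooth_on_cong[OF smooth_on_linear[OF bounded_linear_cnj_vec]]) (simp add: inv_torus)
  qed (auto simp: inv_torus torus_closed)
qed

text \<open>The bijection group consists of extensional functions, so a homomorphism into it also has to
  be compared off \<open>E\<close>.\<close>
lemma group_actionI:
  assumes G: "group G"
    and ext: "\<And>g. g \<in> carrier G \<Longrightarrow> act g \<in> extensional E"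
    and closed: "\<And>g p. g \<in> carrier G \<Longrightarrow> p \<in> E \<Longrightarrow> act g p \<in> E"
    and one: "\<And>p. p \<in> E \<Longrightarrow> act \<one>\<^bsub>G\<^esub> p = p"
    and mult: "\<And>g h p. g \<in> carrier G \<Longrightarrow> h \<in> carrier G \<Longrightarrow> p \<in> E \<Longrightarrow> act (g \<otimes>\<^bsub>G\<^esub> h) p = act g (act h p)"
  shows "group_action G E act"
proof -
  have inv: "inv\<^bsub>G\<^esub> g \<in> carrier G" "inv\<^bsub>G\<^esub> g \<otimes>\<^bsub>G\<^esub> g = \<one>\<^bsub>G\<^esub>" "g \<otimes>\<^bsub>G\<^esub> inv\<^bsub>G\<^esub> g = \<one>\<^bsub>G\<^esub>"
    if "g \<in> carrier G" for g
    using group.inv_closed[OF G that] group.l_inv[OF G that] group.r_inv[OF G that] by simp_all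
  have Bij: "act g \<in> Bij E" if g: "g \<in> carrier G" for g
  proof -
    have "bij_betw (act g) E E"
    proof (rule bij_betw_byWitness[where f' = "act (inv\<^bsub>G\<^esub> g)"])
      show "\<forall>a\<in>E. act (inv\<^bsub>G\<^esub> g) (act g a) = a"
      proof
        fix a assume a: "a \<in> E"
        show "act (inv\<^bsub>G\<^esub> g) (act g a) = a"
          unfolding mult[OF inv(1)[OF g] g a, symmetric] inv(2)[OF g] by (rule one[OF a])
      qed
      show "\<forall>a\<in>E. act g (act (inv\<^bsub>G\<^esub> g) a) = a"
      proof
        fix a assume a: "a \<in> E"
        show "act g (act (inv\<^bsub>G\<^esub> g) a) = a"
          unfolding mult[OF g inv(1)[OF g] a, symmetric] inv(3)[OF g] by (rule one[OF a])
      qed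
      show "act g ` E \<subseteq> E" by (intro image_subsetI closed g)
      show "act (inv\<^bsub>G\<^esub> g) ` E \<subseteq> E" by (intro image_subsetI closed inv(1) g)
    qed
    then show ?thesis using ext[OF g] by (simp add: Bij_def)
  qed
  have "act \<in> hom G (BijGroup E)"
  proof (rule homI)
    show "act g \<in> carrier (BijGroup E)" if "g \<in> carrier G" for g using Bij[OF that] by (simp add: BijGroup_def)
    fix g h assume gh: "g \<in> carrier G" "h \<in> carrier G"
    have gh': "g \<otimes>\<^bsub>G\<^esub> h \<in> carrier G"
      using monoid.m_closed[OF group.is_monoid[OF G] gh] .
    have "act (g \<otimes>\<^bsub>G\<^esub> h) = compose E (act g) (act h)"
    proof
      fix p show "act (g \<otimes>\<^bsub>G\<^esub> h) p = compose E (act g) (act h) p"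
      proof (cases "p \<in> E")
        case True
        then show ?thesis using mult[OF gh True] by (simp add: compose_def)
      next
        case False
        then show ?thesis using extensional_arb[OF ext[OF gh'] False] by (simp add: compose_def)
      qed
    qed
    also have "\<dots> = act g \<otimes>\<^bsub>BijGroup E\<^esub> act h"
      using Bij[OF gh(1)] Bij[OF gh(2)] by (simp add: BijGroup_def)
    finally show "act (g \<otimes>\<^bsub>G\<^esub> h) = act g \<otimes>\<^bsub>BijGroup E\<^esub> act h" .
  qed
  then show ?thesis
    by (intro group_action.intro group_hom.intro group_hom_axioms.intro G group_BijGroup)
qed

lemma torus_diag_unitary: "t \<in> carrier torus \<Longrightarrow> diag_mat t \<in> unitary_group"
  by (simp add: diag_mat_unitary_iff)

lemma cnj_vec_simps: "cnj_vec (t * u) = cnj_vec t * cnj_vec u" "cnj_vec 1 = 1" "cnj_vec (cnj_vec t) = t"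
  by (simp_all add: cnj_vec_def vec_eq_iff)

lemma UUR_act_apply:
  "(U, V, x) \<in> svd_domain \<Longrightarrow> UUR_act t (U, V, x) = (U ** diag_mat (cnj_vec t), diag_mat t ** V, x)"
  by (simp add: UUR_act_def)

lemma UU_act_apply:
  "(U, V) \<in> unitary_group \<times> unitary_group \<Longrightarrow> UU_act t (U, V) = (U ** diag_mat (cnj_vec t), diag_mat t ** V)"
  by (simp add: UU_act_def)

lemma UUR_act_closed: "t \<in> carrier torus \<Longrightarrow> p \<in> svd_domain \<Longrightarrow> UUR_act t p \<in> svd_domain"
  by (auto simp: UUR_act_def intro!: unitary_group_mult torus_diag_unitary torus_closed)

lemma UU_act_closed:
  "t \<in> carrier torus \<Longrightarrow> p \<in> unitary_group \<times> unitary_group \<Longrightarrow> UU_act t p \<in> unitary_group \<times> unitary_group"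
  by (auto simp: UU_act_def intro!: unitary_group_mult torus_diag_unitary torus_closed)

lemma group_action_UUR:
  "group_action (torus :: ('n::{finite,linorder}) cvec monoid) svd_domain UUR_act"
proof (rule group_actionI[OF group_torus])
  show "UUR_act t \<in> extensional svd_domain" for t :: "'n cvec" unfolding UUR_act_def by (rule restrict_extensional)
  fix p :: "'n cmat \<times> 'n cmat \<times> 'n rvec" assume p: "p \<in> svd_domain"
  obtain U V x where pe: "p = (U, V, x)" by (cases p)
  show "UUR_act t p \<in> svd_domain" if "t \<in> carrier torus" for t using that p by (rule UUR_act_closed)
  show "UUR_act \<one>\<^bsub>torus\<^esub> p = p" using p by (simp add: pe UUR_act_apply cnj_vec_simps diag_mat_one)
  show "UUR_act (t \<otimes>\<^bsub>torus\<^esub> u) p = UUR_act t (UUR_act u p)" if t: "t \<in> carrier torus" "u \<in> carrier torus" for t u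
  proof -
    have "UUR_act u p \<in> svd_domain" using t(2) p by (rule UUR_act_closed)
    then show ?thesis
      using p by (simp add: pe UUR_act_apply cnj_vec_simps diag_mat_mult[symmetric] matrix_mul_assoc)
        (simp add: matrix_mul_assoc[symmetric] diag_mat_mult mult.commute)
  qed
qed

lemma svd_map_UUR_act:
  assumes "t \<in> carrier torus" "p \<in> svd_domain"
  shows "svd_map (UUR_act t p) = svd_map p"
proof -
  obtain U V x where p: "p = (U, V, x)" by (cases p)
  have "cnj_vec t * (complex_vec x * t) = complex_vec x * (cnj_vec t * t)" by (simp add: mult_ac)
  then have "diag_mat (cnj_vec t) ** (diag_mat (complex_vec x) ** diag_mat t) = diag_mat (complex_vec x)"
    by (simp add: diag_mat_mult torus_cnj_mult(1)[OF assms(1)])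
  then have "U ** (diag_mat (cnj_vec t) ** (diag_mat (complex_vec x) ** diag_mat t)) ** V = U ** diag_mat (complex_vec x) ** V"
    by simp
  then show ?thesis using assms(2) by (simp add: p UUR_act_apply svd_map_def matrix_mul_assoc)
qed

lemma svd_map_eq_imp_orbit:
  assumes "p \<in> svd_domain" "q \<in> svd_domain" "svd_map q = svd_map p"
  shows "\<exists>t\<in>carrier torus. q = UUR_act t p"
proof -
  obtain U V x where p: "p = (U, V, x)" by (cases p)
  obtain U' V' x' where q: "q = (U', V', x')" by (cases q)
  have e: "U ** diag_mat (complex_vec x) ** V = U' ** diag_mat (complex_vec x') ** V'"
    using assms(3) by (simp add: p q svd_map_def)
  have m: "U \<in> unitary_group" "V \<in> unitary_group" "x \<in> decreasing_cone" "U' \<in> unitary_group" "V' \<in> unitary_group"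
    "x' \<in> decreasing_cone" using assms(1,2) by (simp_all add: p q)
  have "x' = x" by (rule svd_unique_up_to_torus(1)[OF m e])
  moreover obtain t where "t \<in> carrier torus" "U' = U ** diag_mat (cnj_vec t)" "V' = diag_mat t ** V"
    using svd_unique_up_to_torus(2)[OF m e] by (elim bexE conjE)
  ultimately have "q = UUR_act t p"
    using UUR_act_apply[OF assms(1)[unfolded p], of t] by (simp add: p q)
  with \<open>t \<in> carrier torus\<close> show ?thesis by (intro bexI)
qed

text \<open>The torus element cancels in \<open>U D(cnj t) D(x) D(t) V\<close>; conversely,
  decompositions of the same matrix differ by a torus element.\<close>
lemma svd_fiber_eq_orbit:
  assumes p: "p \<in> svd_domain"
  shows "{q \<in> svd_domain. svd_map q = svd_map p} = orbit torus UUR_act p"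
proof (intro subset_antisym subsetI)
  fix q assume "q \<in> {q \<in> svd_domain. svd_map q = svd_map p}"
  then have "q \<in> svd_domain" "svd_map q = svd_map p" unfolding mem_Collect_eq by (rule conjunct1, rule conjunct2)
  from svd_map_eq_imp_orbit[OF p this] obtain t where t: "t \<in> carrier torus" "q = UUR_act t p" by (elim bexE)
  then show "q \<in> orbit torus UUR_act p" unfolding orbit_def by (intro CollectI exI conjI)
next
  fix q assume "q \<in> orbit torus UUR_act p"
  then obtain t where t: "q = UUR_act t p" "t \<in> carrier torus" unfolding orbit_def mem_Collect_eq by (elim exE conjE)
  show "q \<in> {q \<in> svd_domain. svd_map q = svd_map p}"
    unfolding t(1) by (intro CollectI conjI UUR_act_closed svd_map_UUR_act t(2) p)
qed

lemma svd_fibers_are_orbits: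
  assumes "Z \<in> regular_matrices"
  shows "{p \<in> svd_domain. svd_map p = Z} \<in> orbits torus svd_domain UUR_act"
proof -
  obtain p where p: "p \<in> svd_domain" "svd_map p = Z" using assms by (rule regular_svdE)
  have "{p \<in> svd_domain. svd_map p = Z} = orbit torus UUR_act p" using svd_fiber_eq_orbit[OF p(1)] p(2) by simp
  then show ?thesis unfolding orbits_def using p(1) by (intro CollectI exI conjI)
qed

text \<open>The second component \<open>D(t) V\<close> determines \<open>t\<close> because
  \<open>V\<close> is invertible.\<close>
lemma UUR_act_eq_imp:
  assumes "p \<in> svd_domain" "t \<in> carrier torus" "u \<in> carrier torus" "UUR_act t p = UUR_act u p"
  shows "t = u"
proof -
  obtain U V x where p: "p = (U, V, x)" by (cases p)
  have V: "V \<in> unitary_group" using assms(1) by (simp add: p)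
  have "diag_mat t ** V = diag_mat u ** V" using assms(1,4) by (simp add: p UUR_act_apply)
  then have "diag_mat t ** (V ** ctrans V) = diag_mat u ** (V ** ctrans V)" by (simp add: matrix_mul_assoc)
  then show ?thesis by (simp add: unitary_groupD(2)[OF V] diag_mat_inject)
qed

lemma free_action_UUR: "free_action (torus :: ('n::{finite,linorder}) cvec monoid) svd_domain UUR_act"
  unfolding free_action_def
proof (intro ballI impI)
  fix t :: "'n cvec" and p :: "'n cmat \<times> 'n cmat \<times> 'n rvec"
  assume t: "t \<in> carrier torus" and p: "p \<in> svd_domain" and "UUR_act t p = p"
  then have "UUR_act t p = UUR_act 1 p"
    by (cases p) (simp add: UUR_act_apply cnj_vec_simps diag_mat_one)
  then have "t = 1" by (rule UUR_act_eq_imp[OF p t torus_closed(2)])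
  then show "t = \<one>\<^bsub>torus\<^esub>" by simp
qed

lemma smooth_map_UUR_act:
  "smooth_map (prod_mfd torus_mfd UUR_mfd) UUR_mfd
     (\<lambda>(t, p). UUR_act t p :: ('n::{finite,linorder}) cmat \<times> 'n cmat \<times> 'n rvec)"
proof (rule smooth_map_submanifold[OF submanifold_atlas_prod_mfd[OF submanifold_torus submanifold_UUR] submanifold_UUR])
  let ?f = "\<lambda>q :: 'n cvec \<times> 'n cmat \<times> 'n cmat \<times> 'n rvec. (fst (snd q) ** diag_mat (cnj_vec (fst q)),
      diag_mat (fst q) ** fst (snd (snd q)), snd (snd (snd q)))"
  have "smooth_on (carrier torus \<times> svd_domain) ?f"
    by (intro smooth_on_Pair smooth_on_bilinear[OF bounded_bilinear_matrix_mult] smooth_on_fst smooth_on_snd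
        smooth_on_linear_compose[OF bounded_linear_diag_mat] smooth_on_linear_compose[OF bounded_linear_cnj_vec]
        smooth_on_ident)
  then show "smooth_on (carrier torus \<times> svd_domain) (\<lambda>(t, p). UUR_act t p :: 'n cmat \<times> 'n cmat \<times> 'n rvec)"
    by (rule smooth_on_cong) (auto simp: UUR_act_apply)
  show "(\<lambda>(t, p). UUR_act t p :: 'n cmat \<times> 'n cmat \<times> 'n rvec) ` (carrier torus \<times> svd_domain) \<subseteq> svd_domain"
  proof (rule image_subsetI)
    fix q :: "'n cvec \<times> 'n cmat \<times> 'n cmat \<times> 'n rvec" assume "q \<in> carrier torus \<times> svd_domain"
    then have "fst q \<in> carrier torus" "snd q \<in> svd_domain" unfolding mem_Times_iff[of q] by simp_all
    then show "(\<lambda>(t, p). UUR_act t p) q \<in> svd_domain"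
      unfolding case_prod_unfold by (rule UUR_act_closed)
  qed
qed

lemma compact_torus: "compact (carrier (torus :: ('n::finite) cvec monoid))"
proof -
  have "norm t \<le> of_nat CARD('n)" if "t \<in> carrier torus" for t :: "'n cvec"
  proof -
    have "norm t \<le> (\<Sum>i\<in>UNIV. norm (t $ i))" unfolding norm_vec_def by (rule L2_set_le_sum) simp
    also have "\<dots> = of_nat CARD('n)" using that by (simp add: carrier_torus)
    finally show ?thesis .
  qed
  then have "bounded (carrier (torus :: 'n cvec monoid))" by (rule boundedI)
  moreover have "carrier (torus :: 'n cvec monoid) = (\<Inter>i. {t. norm (t $ i) = 1})"
    by (auto simp: carrier_torus)
  then have "closed (carrier (torus :: 'n cvec monoid))"
    by (simp only:) (intro closed_INT ballI closed_Collect_eq continuous_on_norm continuous_on_component continuous_on_id continuous_on_const)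
  ultimately show ?thesis by (simp add: compact_eq_bounded_closed)
qed

lemma proper_map_snd_compact:
  assumes "compact_space X"
  shows "proper_map (prod_topology X Y) Y snd"
  unfolding proper_map_def
proof (intro conjI ballI)
  show "closed_map (prod_topology X Y) Y snd" using assms by (rule Abstract_Topological_Spaces.closed_map_snd)
  fix y assume y: "y \<in> topspace Y"
  have "{x \<in> topspace (prod_topology X Y). snd x = y} = topspace X \<times> {y}" using y by auto
  then show "compactin (prod_topology X Y) {x \<in> topspace (prod_topology X Y). snd x = y}"
    using assms y by (simp add: compactin_Times compact_space_def)
qed

lemma mtop_prod_mfd: "mtop (prod_mfd M N) = prod_topology (mtop M) (mtop N)"
  by (simp add: prod_mfd_def)

text \<open>The projection from the product with the compact torus is proper, and pairing a proper map
  with a continuous one into a Hausdorff space keeps it proper.\<close>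
lemma proper_action_UUR:
  "proper_action (torus_mfd :: (('n::{finite,linorder}) cvec, 'n rvec) mfd) UUR_mfd UUR_act"
proof -
  let ?P = "mtop (UUR_mfd :: ('n cmat \<times> 'n cmat \<times> 'n rvec, _) mfd)"
  let ?X = "prod_topology (mtop (torus_mfd :: ('n cvec, 'n rvec) mfd)) ?P"
  have "compact_space (mtop (torus_mfd :: ('n cvec, 'n rvec) mfd))"
    unfolding submanifold_atlas_mtop[OF submanifold_torus]
    by (rule compact_space_subtopology) (simp add: compact_torus)
  then have "proper_map ?X ?P snd" by (rule proper_map_snd_compact)
  moreover have "continuous_map ?X ?P (\<lambda>(t, p). UUR_act t p)"
    using smooth_map_UUR_act unfolding smooth_map_def mtop_prod_mfd by (elim conjE)
  moreover have "Hausdorff_space ?P"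
    by (simp add: submanifold_atlas_mtop[OF submanifold_UUR] Hausdorff_space_subtopology)
  ultimately have "proper_map ?X (prod_topology ?P ?P) (\<lambda>q. ((\<lambda>(t, p). UUR_act t p) q, snd q))"
    by (intro proper_map_paired disjI2 disjI1 conjI)
  then show ?thesis unfolding proper_action_def by (simp add: case_prod_unfold)
qed

section \<open>Local triviality\<close>

definition diag_vec :: "('n::finite) cmat \<Rightarrow> 'n cvec" where
  "diag_vec A = (\<chi> i. A $ i $ i)"

lemma bounded_linear_diag_vec: "bounded_linear (diag_vec :: ('n::finite) cmat \<Rightarrow> 'n cvec)"
  unfolding linear_conv_bounded_linear[symmetric] by (simp add: linear_iff vec_eq_iff diag_vec_def)

lemma diag_vec_diag_mat: "diag_vec (diag_mat z) = z"
  by (simp add: diag_vec_def diag_mat_def vec_eq_iff)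

text \<open>Over the domain \<open>N\<close> of a section \<open>s\<close> every point of the total
  space is \<open>t \<cdot> s Z\<close> for a unique \<open>t\<close>. The torus coordinate
  \<open>t\<close> is recovered from the second component as the diagonal of \<open>V (V(s
  Z))*\<close>, which is smooth in the point; hence the trivialisation and its inverse
  \<open>t \<cdot> s Z\<close> are smooth.\<close>
lemma principal_bundle_svd:
  "principal_bundle (torus :: ('n::{finite,linorder}) cvec monoid) torus_mfd UUR_mfd regular_mfd svd_map UUR_act"
  unfolding principal_bundle_def
proof (intro conjI ballI lie_group_torus submanifold_atlas_imp_manifold[OF submanifold_UUR]
    submanifold_atlas_imp_manifold[OF submanifold_regular] smooth_map_UUR_act smooth_map_svd)
  show "group_action (torus :: 'n cvec monoid) (topspace (mtop UUR_mfd)) UUR_act"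
    unfolding topspace_UUR by (rule group_action_UUR)
  fix Z :: "'n cmat" assume "Z \<in> topspace (mtop regular_mfd)"
  then have "Z \<in> regular_matrices" by (simp only: topspace_regular)
  then obtain p where p: "p \<in> svd_domain" "svd_map p = Z" by (rule regular_svdE)
  obtain N s where N: "open N" "N \<subseteq> regular_matrices" "svd_map p \<in> N" "smooth_on N s"
    "s ` N \<subseteq> svd_domain" "\<And>Z. Z \<in> N \<Longrightarrow> svd_map (s Z) = Z"
    by (rule svd_section_in_regular[OF p(1)]) (rule that)
  have sN: "s Z \<in> svd_domain" if "Z \<in> N" for Z using N(5) that by blast
  have oN: "openin (top_of_set regular_matrices) N" by (rule open_subset[OF N(2,1)])
  define PW where "PW = {p \<in> svd_domain. svd_map p \<in> N}"
  define \<tau> where "\<tau> p = (svd_map p, diag_vec (fst (snd p) ** ctrans (fst (snd (s (svd_map p))))))"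
    for p :: "'n cmat \<times> 'n cmat \<times> 'n rvec"
  define \<rho> where "\<rho> q = UUR_act (snd q) (s (fst q))" for q
  have PWE: "\<exists>t\<in>carrier torus. q = \<rho> (svd_map q, t)" if "q \<in> PW" for q
    using svd_map_eq_imp_orbit[OF sN, of "svd_map q" q] that N(6) by (simp add: PW_def \<rho>_def)
  have \<tau>\<rho>: "\<tau> (\<rho> (Y, t)) = (Y, t)" and \<rho>PW: "\<rho> (Y, t) \<in> PW" if "Y \<in> N" "t \<in> carrier torus" for Y t
  proof -
    obtain U V x where sY: "s Y = (U, V, x)" by (cases "s Y")
    have d: "(U, V, x) \<in> svd_domain" using sN[OF that(1)] by (simp add: sY)
    have e: "svd_map (\<rho> (Y, t)) = Y"
      using svd_map_UUR_act[OF that(2) sN[OF that(1)]] N(6)[OF that(1)] by (simp add: \<rho>_def)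
    show "\<rho> (Y, t) \<in> PW"
      using UUR_act_closed[OF that(2) sN[OF that(1)]] e that(1) by (simp add: PW_def \<rho>_def)
    have "diag_mat t ** V ** ctrans V = diag_mat t"
      using d unitary_groupD(2)[of V] by (simp add: matrix_mul_assoc[symmetric])
    then show "\<tau> (\<rho> (Y, t)) = (Y, t)"
      unfolding \<tau>_def e by (simp add: \<rho>_def sY UUR_act_apply[OF d] diag_vec_diag_mat)
  qed
  have PW_open: "openin (top_of_set svd_domain) PW"
  proof -
    have "openin (top_of_set svd_domain) (svd_domain \<inter> svd_map -` N)"
      by (rule continuous_openin_preimage_gen[OF smooth_on_imp_continuous_on[OF smooth_on_svd_map] N(1)])
    moreover have "svd_domain \<inter> svd_map -` N = PW" by (auto simp: PW_def)
    ultimately show ?thesis by simp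
  qed
  note aP = submanifold_atlas_open_mfd[OF submanifold_UUR PW_open]
    and aN = submanifold_atlas_open_mfd[OF submanifold_regular oN]
  note aNT = submanifold_atlas_prod_mfd[OF aN submanifold_torus]
  have \<tau>_im: "\<tau> q \<in> N \<times> carrier torus" and \<rho>\<tau>: "\<rho> (\<tau> q) = q" if q: "q \<in> PW" for q
  proof -
    obtain t where t: "t \<in> carrier torus" "q = \<rho> (svd_map q, t)" using PWE[OF q] by (elim bexE)
    have Nq: "svd_map q \<in> N" using q by (simp add: PW_def)
    have "\<tau> q = (svd_map q, t)" using \<tau>\<rho>[OF Nq t(1)] t(2) by simp
    then show "\<tau> q \<in> N \<times> carrier torus" "\<rho> (\<tau> q) = q" using t Nq by simp_all
  qed
  have bij: "bij_betw \<tau> PW (N \<times> carrier torus)"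
  proof (rule bij_betw_byWitness[where f' = \<rho>])
    show "\<forall>q\<in>PW. \<rho> (\<tau> q) = q" by (intro ballI \<rho>\<tau>)
    show "\<tau> ` PW \<subseteq> N \<times> carrier torus" by (intro image_subsetI \<tau>_im)
    show "\<forall>q\<in>N \<times> carrier torus. \<tau> (\<rho> q) = q"
    proof
      fix q :: "'n cmat \<times> 'n cvec" assume "q \<in> N \<times> carrier torus"
      then show "\<tau> (\<rho> q) = q" by (elim SigmaE) (simp only: \<tau>\<rho>)
    qed
    show "\<rho> ` (N \<times> carrier torus) \<subseteq> PW"
    proof (rule image_subsetI)
      fix q :: "'n cmat \<times> 'n cvec" assume "q \<in> N \<times> carrier torus"
      then show "\<rho> q \<in> PW" by (elim SigmaE) (simp only: \<rho>PW)
    qed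
  qed
  have "smooth_on PW \<tau>" unfolding \<tau>_def
    by (intro smooth_on_Pair smooth_on_svd_map smooth_on_linear_compose[OF bounded_linear_diag_vec]
        smooth_on_bilinear[OF bounded_bilinear_matrix_mult] smooth_on_fst smooth_on_snd smooth_on_ident
        smooth_on_linear_compose[OF bounded_linear_ctrans] smooth_on_compose[OF smooth_on_svd_map N(4)])
       (auto simp: PW_def)
  then have sm\<tau>: "smooth_map (open_mfd UUR_mfd PW) (prod_mfd (open_mfd regular_mfd N) torus_mfd) \<tau>"
    by (rule smooth_map_submanifold[OF aP aNT]) (intro image_subsetI \<tau>_im)
  have "smooth_on (N \<times> carrier torus) (inv_into PW \<tau>)"
  proof (rule smooth_on_cong)
    let ?s = "\<lambda>q :: 'n cmat \<times> 'n cvec. s (fst q)"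
    have ss: "smooth_on (N \<times> carrier torus) ?s"
      by (rule smooth_on_compose[OF smooth_on_linear[OF bounded_linear_fst] N(4)]) auto
    show "smooth_on (N \<times> carrier torus) (\<lambda>q. (fst (?s q) ** diag_mat (cnj_vec (snd q)),
        diag_mat (snd q) ** fst (snd (?s q)), snd (snd (?s q))))"
      by (intro smooth_on_Pair smooth_on_bilinear[OF bounded_bilinear_matrix_mult] smooth_on_fst smooth_on_snd ss
        smooth_on_linear_compose[OF bounded_linear_diag_mat] smooth_on_linear_compose[OF bounded_linear_cnj_vec]
        smooth_on_ident)
    fix q :: "'n cmat \<times> 'n cvec" assume q: "q \<in> N \<times> carrier torus"
    obtain Y t where Yt: "q = (Y, t)" "Y \<in> N" "t \<in> carrier torus" using q by auto
    have "inv_into PW \<tau> (\<tau> (\<rho> q)) = \<rho> q"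
      by (rule inv_into_f_f[OF bij_betw_imp_inj_on[OF bij]]) (simp only: Yt(1) \<rho>PW[OF Yt(2,3)])
    then have "inv_into PW \<tau> q = \<rho> q" using \<tau>\<rho>[OF Yt(2,3)] Yt(1) by simp
    then show "(fst (?s q) ** diag_mat (cnj_vec (snd q)),
        diag_mat (snd q) ** fst (snd (?s q)), snd (snd (?s q))) = inv_into PW \<tau> q"
      using sN[OF Yt(2)] by (cases "s Y") (simp add: \<rho>_def Yt(1) UUR_act_apply)
  qed
  then have smi: "smooth_map (prod_mfd (open_mfd regular_mfd N) torus_mfd) (open_mfd UUR_mfd PW) (inv_into PW \<tau>)"
  proof (rule smooth_map_submanifold[OF aNT aP])
    show "inv_into PW \<tau> ` (N \<times> carrier torus) \<subseteq> PW"
      unfolding bij_betw_imp_surj_on[OF bij, symmetric] by (intro image_subsetI inv_into_into)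
  qed
  have diff: "diffeomorphism (open_mfd UUR_mfd PW) (prod_mfd (open_mfd regular_mfd N) torus_mfd) \<tau>"
    unfolding diffeomorphism_def
    using bij sm\<tau> smi by (simp add: submanifold_atlas_mtop[OF aP] submanifold_atlas_mtop[OF aNT])
  have equi: "snd (\<tau> (UUR_act t q)) = t \<otimes>\<^bsub>torus\<^esub> snd (\<tau> q)" if q: "q \<in> PW" and t: "t \<in> carrier torus" for q t
  proof -
    obtain u where u: "u \<in> carrier torus" "q = \<rho> (svd_map q, u)" using PWE[OF q] by (elim bexE)
    have Nq: "svd_map q \<in> N" using q by (simp add: PW_def)
    have "UUR_act t q = UUR_act t (UUR_act u (s (svd_map q)))" using u(2) by (simp add: \<rho>_def)
    also have "\<dots> = \<rho> (svd_map q, t * u)"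
      using group_action.composition_rule[OF group_action_UUR sN[OF Nq] t u(1)] by (simp add: \<rho>_def)
    finally have "\<tau> (UUR_act t q) = (svd_map q, t * u)" using \<tau>\<rho>[OF Nq torus_closed(1)[OF t u(1)]] by simp
    moreover have "\<tau> q = (svd_map q, u)" using \<tau>\<rho>[OF Nq u(1)] u(2) by simp
    ultimately show ?thesis by simp
  qed
  have PWeq: "{p \<in> topspace (mtop UUR_mfd). svd_map p \<in> N} = PW" unfolding topspace_UUR PW_def ..
  show "\<exists>W \<tau>. openin (mtop regular_mfd) W \<and> Z \<in> W \<and>
      (let PW = {p \<in> topspace (mtop UUR_mfd). svd_map p \<in> W}
       in diffeomorphism (open_mfd UUR_mfd PW) (prod_mfd (open_mfd regular_mfd W) torus_mfd) \<tau> \<and>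
          (\<forall>p\<in>PW. fst (\<tau> p) = svd_map p \<and>
             (\<forall>g\<in>carrier torus. snd (\<tau> (UUR_act g p)) = g \<otimes>\<^bsub>torus\<^esub> snd (\<tau> p))))"
  proof (intro exI[of _ N] exI[of _ \<tau>] conjI)
    show "openin (mtop regular_mfd) N" using oN by (simp only: submanifold_atlas_mtop[OF submanifold_regular])
    show "Z \<in> N" using N(3) p(2) by simp
    show "let PW = {p \<in> topspace (mtop UUR_mfd). svd_map p \<in> N}
       in diffeomorphism (open_mfd UUR_mfd PW) (prod_mfd (open_mfd regular_mfd N) torus_mfd) \<tau> \<and>
          (\<forall>p\<in>PW. fst (\<tau> p) = svd_map p \<and>
             (\<forall>g\<in>carrier torus. snd (\<tau> (UUR_act g p)) = g \<otimes>\<^bsub>torus\<^esub> snd (\<tau> p)))"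
      unfolding PWeq Let_def using diff equi by (intro conjI ballI) (simp_all add: \<tau>_def)
  qed
qed

section \<open>Orbits of pairs of unitary matrices\<close>
abbreviation UU :: "(('n::finite) cmat \<times> 'n cmat) set" where
  "UU \<equiv> unitary_group \<times> unitary_group"

lemma topspace_UU: "topspace (mtop (UU_mfd :: (('n::finite) cmat \<times> 'n cmat, _) mfd)) = UU"
  by (simp add: submanifold_atlas_mtop[OF submanifold_UU])

text \<open>For each fixed \<open>x\<close> in the cone the map \<open>(U, V) \<mapsto> U D(x) V\<close>
  separates exactly the torus orbits, since the action leaves \<open>x\<close> alone.\<close>
lemma UU_orbit_eq_fiber:
  fixes p :: "('n::{finite,linorder}) cmat \<times> 'n cmat"
  assumes p: "p \<in> UU" and x: "x \<in> decreasing_cone"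
  shows "orbit torus UU_act p = {q \<in> UU. svd_map (fst q, snd q, x) = svd_map (fst p, snd p, x)}"
proof -
  have px: "(fst p, snd p, x) \<in> svd_domain" using p x by auto
  have act: "UUR_act t (fst p, snd p, x) = (fst (UU_act t p), snd (UU_act t p), x)" for t
    using UUR_act_apply[OF px, of t] UU_act_apply[of "fst p" "snd p" t] p by simp
  show ?thesis
  proof (intro subset_antisym subsetI)
    fix q assume "q \<in> orbit torus UU_act p"
    then obtain t where t: "q = UU_act t p" "t \<in> carrier torus" unfolding orbit_def mem_Collect_eq by (elim exE conjE)
    have "svd_map (fst q, snd q, x) = svd_map (fst p, snd p, x)"
      using svd_map_UUR_act[OF t(2) px] by (simp add: act t(1))
    moreover have "q \<in> UU" unfolding t(1) by (rule UU_act_closed[OF t(2) p])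
    ultimately show "q \<in> {q \<in> UU. svd_map (fst q, snd q, x) = svd_map (fst p, snd p, x)}"
      by (intro CollectI conjI)
  next
    fix q assume "q \<in> {q \<in> UU. svd_map (fst q, snd q, x) = svd_map (fst p, snd p, x)}"
    then have q: "q \<in> UU" "svd_map (fst q, snd q, x) = svd_map (fst p, snd p, x)"
      unfolding mem_Collect_eq by (rule conjunct1, rule conjunct2)
    have qx: "(fst q, snd q, x) \<in> svd_domain" using q(1) x by auto
    obtain t where t: "t \<in> carrier torus" "(fst q, snd q, x) = UUR_act t (fst p, snd p, x)"
      using svd_map_eq_imp_orbit[OF px qx q(2)] by (elim bexE)
    have "q = UU_act t p" using t(2) unfolding act by (simp add: prod_eq_iff)
    then show "q \<in> orbit torus UU_act p" unfolding orbit_def using t(1) by (intro CollectI exI conjI)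
  qed
qed

lemma svd_map_eq_imp_same_values:
  assumes "p \<in> svd_domain" "q \<in> svd_domain" "svd_map q = svd_map p"
  shows "snd (snd q) = snd (snd p)"
proof -
  obtain t where "q = UUR_act t p" using svd_map_eq_imp_orbit[OF assms] by (elim bexE)
  then show ?thesis using assms(1) by (cases p) (simp add: UUR_act_apply)
qed

definition class_rep :: "('n::finite cmat \<times> 'n cmat) set \<Rightarrow> 'n cmat \<times> 'n cmat" where
  "class_rep q = (SOME p. p \<in> q)"

text \<open>The map of the orbit space that \<open>svd_map\<close> induces, written with a chosen
  representative; on orbits the choice is immaterial by \<open>svd_hat_orbit\<close>.\<close>
definition svd_hat :: "('n::{finite,linorder} cmat \<times> 'n cmat) set \<times> 'n rvec \<Rightarrow> 'n cmat" where
  "svd_hat qx = svd_map (fst (class_rep (fst qx)), snd (class_rep (fst qx)), snd qx)"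

lemma svd_hat_orbit:
  assumes "p \<in> UU" "x \<in> decreasing_cone"
  shows "svd_hat (orbit torus UU_act p, x) = svd_map (fst p, snd p, x)"
proof -
  have "p \<in> orbit torus UU_act p" unfolding UU_orbit_eq_fiber[OF assms] using assms(1) by (intro CollectI conjI refl)
  then have "class_rep (orbit torus UU_act p) \<in> orbit torus UU_act p" unfolding class_rep_def by (rule someI)
  then show ?thesis unfolding UU_orbit_eq_fiber[OF assms] mem_Collect_eq by (simp add: svd_hat_def)
qed

lemma orbit_image: "orbit G act ` E = orbits G E act"
  unfolding orbits_def by blast

lemma bij_betw_svd_hat:
  "bij_betw svd_hat (orbits torus (UU :: ('n::{finite,linorder} cmat \<times> 'n cmat) set) UU_act \<times> decreasing_cone) regular_matrices"
proof -
  have inj: "(orbit torus UU_act p, x) = (orbit torus UU_act q, y)"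
    if p: "p \<in> UU" "x \<in> decreasing_cone" and q: "q \<in> UU" "y \<in> decreasing_cone"
      and e: "svd_map (fst p, snd p, x) = svd_map (fst q, snd q, y)"
    for p q :: "'n cmat \<times> 'n cmat" and x y
  proof -
    have "(fst p, snd p, x) \<in> svd_domain" "(fst q, snd q, y) \<in> svd_domain" using p q by auto
    from svd_map_eq_imp_same_values[OF this e[symmetric]] have "y = x" by simp
    then show ?thesis using UU_orbit_eq_fiber[OF p] UU_orbit_eq_fiber[OF q(1) p(2)] e by simp
  qed
  show ?thesis
    unfolding bij_betw_def
  proof (intro conjI inj_onI subset_antisym image_subsetI subsetI)
    fix a b :: "('n cmat \<times> 'n cmat) set \<times> 'n rvec"
    assume a: "a \<in> orbits torus UU UU_act \<times> decreasing_cone"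
      and b: "b \<in> orbits torus UU UU_act \<times> decreasing_cone" and e: "svd_hat a = svd_hat b"
    obtain p x where p: "a = (orbit torus UU_act p, x)" "p \<in> UU" "x \<in> decreasing_cone"
      using a unfolding orbit_image[symmetric] by blast
    obtain q y where q: "b = (orbit torus UU_act q, y)" "q \<in> UU" "y \<in> decreasing_cone"
      using b unfolding orbit_image[symmetric] by blast
    show "a = b" unfolding p(1) q(1)
      by (rule inj) (use p q e in \<open>simp_all only: svd_hat_orbit\<close>)
  next
    fix a :: "('n cmat \<times> 'n cmat) set \<times> 'n rvec" assume a: "a \<in> orbits torus UU UU_act \<times> decreasing_cone"
    obtain p x where p: "a = (orbit torus UU_act p, x)" "p \<in> UU" "x \<in> decreasing_cone"
      using a unfolding orbit_image[symmetric] by blast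
    show "svd_hat a \<in> regular_matrices"
      unfolding p(1) svd_hat_orbit[OF p(2,3)] by (rule svd_map_in_regular) (use p in auto)
  next
    fix Z :: "'n cmat" assume "Z \<in> regular_matrices"
    then obtain r where r: "r \<in> svd_domain" "svd_map r = Z" by (rule regular_svdE)
    let ?p = "(fst r, fst (snd r))" and ?x = "snd (snd r)"
    have px: "?p \<in> UU" "?x \<in> decreasing_cone" using r(1) by auto
    have "svd_hat (orbit torus UU_act ?p, ?x) = Z" unfolding svd_hat_orbit[OF px] using r(2) by simp
    moreover have "(orbit torus UU_act ?p, ?x) \<in> orbits torus UU UU_act \<times> decreasing_cone"
      unfolding orbit_image[symmetric] using px by blast
    ultimately show "Z \<in> svd_hat ` (orbits torus UU UU_act \<times> decreasing_cone)" by (intro image_eqI) (erule sym)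
  qed
qed

section \<open>The induced diffeomorphism\<close>

text \<open>Locally the map is \<open>svd_map\<close> composed with a smooth section of the orbit map,
  and its inverse is the orbit map composed with a smooth section of \<open>svd_map\<close>.\<close>
lemma svd_hat_diffeomorphism:
  fixes Q :: "(('n::{finite,linorder} cmat \<times> 'n cmat) set, 'q::euclidean_space) mfd"
  assumes Q: "quotient_manifold torus UU_mfd UU_act Q"
  shows "diffeomorphism (prod_mfd Q cone_mfd) regular_mfd svd_hat"
proof -
  have mQ: "smooth_manifold Q"
    using Q unfolding quotient_manifold_def by (elim conjE)
  have tQ: "topspace (mtop Q) = orbits torus UU UU_act"
    using Q unfolding quotient_manifold_def topspace_UU by (elim conjE)
  have sub: "submersion UU_mfd Q (orbit torus UU_act)"
    using Q unfolding quotient_manifold_def by (elim conjE)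
  note aQ = smooth_manifold_imp_atlas[OF mQ]
  note aU = submanifold_atlas_imp_atlas[OF submanifold_UU] and aC = submanifold_atlas_imp_atlas[OF submanifold_cone]
    and aR = submanifold_atlas_imp_atlas[OF submanifold_regular] and aP = submanifold_atlas_imp_atlas[OF submanifold_UUR]
    and a1 = submanifold_atlas_imp_atlas[OF submanifold_unitary]
  have tC: "topspace (mtop (cone_mfd :: ('n rvec, 'n rvec) mfd)) = decreasing_cone"
    by (simp add: submanifold_atlas_mtop[OF submanifold_cone])
  note aQC = smooth_atlas_prod_mfd[OF aQ aC]
  have tQC: "topspace (mtop (prod_mfd Q (cone_mfd :: ('n rvec, 'n rvec) mfd))) = orbits torus UU UU_act \<times> decreasing_cone"
    by (simp only: topspace_prod_mfd tQ tC)
  have orb: "smooth_map UU_mfd Q (orbit torus UU_act)" using sub by (simp add: submersion_def)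
  have sm1: "smooth_map (prod_mfd Q (cone_mfd :: ('n rvec, 'n rvec) mfd)) regular_mfd svd_hat"
  proof (rule smooth_map_local[OF aQC aR])
    fix a assume "a \<in> topspace (mtop (prod_mfd Q (cone_mfd :: ('n rvec, 'n rvec) mfd)))"
    then obtain p x where p: "a = (orbit torus UU_act p, x)" "p \<in> UU" "x \<in> decreasing_cone"
      unfolding tQC orbit_image[symmetric] by blast
    have "p \<in> topspace (mtop UU_mfd)" using p(2) by (simp only: topspace_UU)
    from submersion_imp_section[OF aU aQ sub this]
    obtain W s where "smooth_section_at UU_mfd Q (orbit torus UU_act) p W s" by (elim exE)
    then have W: "openin (mtop Q) W" "orbit torus UU_act p \<in> W" and s: "smooth_map (open_mfd Q W) UU_mfd s"
      and os: "\<And>q. q \<in> W \<Longrightarrow> orbit torus UU_act (s q) = q"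
      by (simp_all add: smooth_section_at_def)
    have sUU: "s q \<in> UU" if "q \<in> W" for q
      using smooth_map_topspace[OF s, of q] that by (simp only: topspace_open_mfd[OF W(1)] topspace_UU)
    let ?W = "W \<times> (decreasing_cone :: 'n rvec set)"
    let ?M = "open_mfd (prod_mfd Q (cone_mfd :: ('n rvec, 'n rvec) mfd)) ?W"
    have oW: "openin (mtop (prod_mfd Q (cone_mfd :: ('n rvec, 'n rvec) mfd))) ?W"
      using W(1) openin_topspace[of "mtop (cone_mfd :: ('n rvec, 'n rvec) mfd)"]
      by (simp add: mtop_prod_mfd openin_prod_Times_iff tC)
    note aM = smooth_atlas_open_mfd[OF aQC oW]
    have tM: "topspace (mtop ?M) = ?W" by (rule topspace_open_mfd[OF oW])
    have "smooth_map ?M Q fst" by (rule smooth_map_open_mfd[OF aQC aQ smooth_map_projections(1)[OF aQ aC] oW])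
    then have "smooth_map ?M (open_mfd Q W) fst"
      by (rule smooth_map_into_open_mfd[OF aM aQ _ W(1)]) (unfold tM, auto)
    then have 1: "smooth_map ?M UU_mfd (\<lambda>b. s (fst b))"
      by (rule smooth_map_compose[OF aM smooth_atlas_open_mfd[OF aQ W(1)] aU _ s])
    have 2: "smooth_map ?M unitary_mfd (\<lambda>b. fst (s (fst b)))"
      by (rule smooth_map_compose[OF aM aU a1 1 smooth_map_projections(1)[OF a1 a1]])
    have 3: "smooth_map ?M unitary_mfd (\<lambda>b. snd (s (fst b)))"
      by (rule smooth_map_compose[OF aM aU a1 1 smooth_map_projections(2)[OF a1 a1]])
    have 4: "smooth_map ?M cone_mfd snd"
      by (rule smooth_map_open_mfd[OF aQC aC smooth_map_projections(2)[OF aQ aC] oW])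
    have "smooth_map ?M UUR_mfd (\<lambda>b. (fst (s (fst b)), snd (s (fst b)), snd b))"
      by (intro smooth_map_Pair[OF aM a1 smooth_atlas_prod_mfd[OF a1 aC]] smooth_map_Pair[OF aM a1 aC] 2 3 4)
    from smooth_map_compose[OF aM aP aR this smooth_map_svd]
    have "smooth_map ?M regular_mfd svd_hat"
    proof (rule smooth_map_cong[OF aM aR])
      fix b assume "b \<in> topspace (mtop ?M)"
      then have b: "fst b \<in> W" "snd b \<in> decreasing_cone" unfolding tM by auto
      have "svd_hat b = svd_hat (orbit torus UU_act (s (fst b)), snd b)" by (simp add: os[OF b(1)])
      also have "\<dots> = svd_map (fst (s (fst b)), snd (s (fst b)), snd b)" by (rule svd_hat_orbit[OF sUU[OF b(1)] b(2)])
      finally show "svd_map (fst (s (fst b)), snd (s (fst b)), snd b) = svd_hat b" by (rule sym)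
    qed
    moreover have "a \<in> ?W" using W(2) p(3) by (simp add: p(1))
    ultimately show "\<exists>W. openin (mtop (prod_mfd Q cone_mfd)) W \<and> a \<in> W \<and>
        smooth_map (open_mfd (prod_mfd Q cone_mfd) W) regular_mfd svd_hat"
      using oW by (intro exI[of _ ?W] conjI)
  qed
  have bij: "bij_betw svd_hat (orbits torus UU UU_act \<times> (decreasing_cone :: 'n rvec set)) regular_matrices"
    by (rule bij_betw_svd_hat)
  have sm2: "smooth_map regular_mfd (prod_mfd Q (cone_mfd :: ('n rvec, 'n rvec) mfd))
      (inv_into (orbits torus UU UU_act \<times> decreasing_cone) svd_hat)"
  proof (rule smooth_map_local[OF aR aQC])
    fix Z :: "'n cmat" assume "Z \<in> topspace (mtop regular_mfd)"
    then have "Z \<in> regular_matrices" by (simp only: topspace_regular)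
    then obtain p where p: "p \<in> svd_domain" "svd_map p = Z" by (rule regular_svdE)
    obtain N s where N: "open N" "N \<subseteq> regular_matrices" "svd_map p \<in> N" "smooth_on N s"
      "s ` N \<subseteq> svd_domain" "\<And>Z. Z \<in> N \<Longrightarrow> svd_map (s Z) = Z"
      by (rule svd_section_in_regular[OF p(1)]) (rule that)
    have sN: "s Y \<in> svd_domain" if "Y \<in> N" for Y using N(5) that by blast
    have sN1: "(fst (s Y), fst (snd (s Y))) \<in> UU" "snd (snd (s Y)) \<in> decreasing_cone" if "Y \<in> N" for Y
      using sN[OF that] by (cases "s Y", simp)+
    have oN: "openin (top_of_set regular_matrices) N" by (rule open_subset[OF N(2,1)])
    then have oN': "openin (mtop (regular_mfd :: ('n cmat, 'n cmat) mfd)) N"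
      by (simp only: submanifold_atlas_mtop[OF submanifold_regular])
    let ?M = "open_mfd (regular_mfd :: ('n cmat, 'n cmat) mfd) N"
    note mM = submanifold_atlas_open_mfd[OF submanifold_regular oN]
    note aM = submanifold_atlas_imp_atlas[OF mM]
    have "smooth_map ?M UU_mfd (\<lambda>Y. (fst (s Y), fst (snd (s Y))))"
      by (rule smooth_map_submanifold[OF mM submanifold_UU])
        (intro smooth_on_Pair smooth_on_fst smooth_on_snd N(4), intro image_subsetI sN1)
    from smooth_map_compose[OF aM aU aQ this orb]
    have 1: "smooth_map ?M Q (\<lambda>Y. orbit torus UU_act (fst (s Y), fst (snd (s Y))))" .
    have 2: "smooth_map ?M cone_mfd (\<lambda>Y. snd (snd (s Y)))"
      by (rule smooth_map_submanifold[OF mM submanifold_cone])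
        (intro smooth_on_snd N(4), intro image_subsetI sN1)
    from smooth_map_Pair[OF aM aQ aC 1 2]
    have "smooth_map ?M (prod_mfd Q cone_mfd) (inv_into (orbits torus UU UU_act \<times> decreasing_cone) svd_hat)"
    proof (rule smooth_map_cong[OF aM aQC])
      fix Y assume "Y \<in> topspace (mtop ?M)"
      then have Y: "Y \<in> N" unfolding topspace_open_mfd[OF oN'] .
      have "svd_hat (orbit torus UU_act (fst (s Y), fst (snd (s Y))), snd (snd (s Y))) = Y"
        unfolding svd_hat_orbit[OF sN1[OF Y]] using N(6)[OF Y] by simp
      moreover have "(orbit torus UU_act (fst (s Y), fst (snd (s Y))), snd (snd (s Y)))
          \<in> orbits torus UU UU_act \<times> decreasing_cone"
        unfolding orbit_image[symmetric] by (intro SigmaI imageI sN1 Y)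
      ultimately show "(orbit torus UU_act (fst (s Y), fst (snd (s Y))), snd (snd (s Y)))
          = inv_into (orbits torus UU UU_act \<times> decreasing_cone) svd_hat Y"
        by (intro inv_into_f_eq[OF bij_betw_imp_inj_on[OF bij], symmetric])
    qed
    moreover have "Z \<in> N" using N(3) p(2) by simp
    ultimately show "\<exists>W. openin (mtop regular_mfd) W \<and> Z \<in> W \<and> smooth_map (open_mfd regular_mfd W) (prod_mfd Q cone_mfd)
        (inv_into (orbits torus UU UU_act \<times> decreasing_cone) svd_hat)"
      using oN' by (intro exI[of _ N] conjI)
  qed
  show ?thesis unfolding diffeomorphism_def tQC topspace_regular using bij sm1 sm2 by (intro conjI)
qed

section \<open>The quotient manifold\<close>
text \<open>The rows of a unitary matrix are unit vectors, which bounds its entries; the group is closed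
  as a level set.\<close>
lemma compact_unitary_group: "compact (unitary_group :: ('n::finite) cmat set)"
proof -
  have entry: "norm (U $ i $ j) \<le> 1" if U: "U \<in> unitary_group" for U :: "'n cmat" and i j
  proof -
    have "(U ** ctrans U) $ i $ i = complex_of_real (\<Sum>j\<in>UNIV. (norm (U $ i $ j))\<^sup>2)"
      unfolding of_real_sum matrix_matrix_mult_def ctrans_def
      by (simp add: complex_norm_square del: of_real_power)
    then have "complex_of_real (\<Sum>j\<in>UNIV. (norm (U $ i $ j))\<^sup>2) = 1"
      by (simp add: unitary_groupD(2)[OF U] mat_def del: of_real_sum)
    then have "(\<Sum>j\<in>UNIV. (norm (U $ i $ j))\<^sup>2) = 1" unfolding of_real_eq_1_iff .
    moreover have "(norm (U $ i $ j))\<^sup>2 \<le> (\<Sum>j\<in>UNIV. (norm (U $ i $ j))\<^sup>2)" by (rule member_le_sum) simp_all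
    ultimately have "(norm (U $ i $ j))\<^sup>2 \<le> 1\<^sup>2" by simp
    then show ?thesis by (rule power2_le_imp_le) simp
  qed
  have vec_le: "norm v \<le> (\<Sum>i\<in>UNIV. norm (v $ i))" for v :: "('a::real_normed_vector, 'n) vec"
    unfolding norm_vec_def by (rule L2_set_le_sum) simp
  have "norm U \<le> (\<Sum>i\<in>(UNIV :: 'n set). \<Sum>j\<in>(UNIV :: 'n set). 1)" if U: "U \<in> unitary_group" for U :: "'n cmat"
    by (rule order_trans[OF vec_le sum_mono[OF order_trans[OF vec_le sum_mono[OF entry[OF U]]]]])
  then have "bounded (unitary_group :: 'n cmat set)" by (rule boundedI)
  moreover have "unitary_group = unitary_defect -` {hermitian_code (mat 1 :: 'n cmat)}"
    using unitary_iff_defect by blast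
  then have "closed (unitary_group :: 'n cmat set)"
    using closed_vimage[OF closed_singleton smooth_on_imp_continuous_on[OF smooth_on_unitary_defect[of UNIV]], of "hermitian_code (mat 1 :: 'n cmat)"]
    by simp
  ultimately show ?thesis by (simp add: compact_eq_bounded_closed)
qed

lemma decreasing_cone_nonempty: "\<exists>x. x \<in> (decreasing_cone :: ('n::{finite,linorder}) rvec set)"
proof -
  have "finite (real ` {1..CARD('n)})" "card (real ` {1..CARD('n)}) = CARD('n)"
    by (simp_all add: card_image)
  then obtain l :: "'n \<Rightarrow> real" where l: "range l = real ` {1..CARD('n)}" "\<And>i j. i < j \<Longrightarrow> l j < l i"
    by (rule finite_real_set_decreasing_enumeration) (rule that)
  have "l i > 0" for i
  proof -
    have "l i \<in> real ` {1..CARD('n)}" unfolding l(1)[symmetric] by simp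
    then show ?thesis by auto
  qed
  then have "(\<chi> i. l i) \<in> decreasing_cone" using l(2) by (simp add: decreasing_cone_def)
  then show ?thesis by (rule exI)
qed

text \<open>The set of matrices with singular values \<open>x\<close>; for \<open>x\<close> in the cone
  it is a copy of the orbit space.\<close>
definition isospectral :: "('n::{finite,linorder}) rvec \<Rightarrow> 'n cmat set" where
  "isospectral x = (\<lambda>p. svd_map (fst p, snd p, x)) ` UU"

lemma isospectral_iff:
  assumes "r \<in> svd_domain" "x \<in> decreasing_cone"
  shows "svd_map r \<in> isospectral x \<longleftrightarrow> snd (snd r) = x"
proof
  assume "svd_map r \<in> isospectral x"
  then obtain p where p: "p \<in> UU" "svd_map r = svd_map (fst p, snd p, x)" unfolding isospectral_def by blast
  have "(fst p, snd p, x) \<in> svd_domain" using p(1) assms(2) by auto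
  from svd_map_eq_imp_same_values[OF this assms(1) p(2)] show "snd (snd r) = x" by simp
next
  assume "snd (snd r) = x"
  then have "svd_map r = svd_map (fst (fst r, fst (snd r)), snd (fst r, fst (snd r)), x)"
    by (simp add: prod_eq_iff[of r] svd_map_eq)
  moreover have "(fst r, fst (snd r)) \<in> UU" using assms(1) by (cases r) simp
  ultimately show "svd_map r \<in> isospectral x" unfolding isospectral_def by (rule image_eqI)
qed

text \<open>Near a point of this set the singular values are the last component \<open>f\<close> of a
  smooth section, and the set is the level \<open>f = x\<close>. The derivative of
  \<open>f\<close> is onto because \<open>f (U D(y) V) = y\<close> for fixed
  \<open>U\<close> and \<open>V\<close>.\<close>
lemma submanifold_isospectral:
  fixes x :: "('n::{finite,linorder}) rvec"
  assumes x: "x \<in> decreasing_cone"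
  shows "submanifold_atlas (embedded_mfd (isospectral x) :: ('n cmat, 'n quot_index rvec) mfd) (isospectral x)"
proof (rule submanifold_atlas_embedded)
  fix Z assume "Z \<in> isospectral x"
  then obtain q where q: "q \<in> UU" "Z = svd_map (fst q, snd q, x)" unfolding isospectral_def by blast
  let ?p = "(fst q, snd q, x)"
  have p: "?p \<in> svd_domain" using q(1) x by auto
  obtain N s where N: "open N" "svd_map ?p \<in> N" "smooth_on N s" "s (svd_map ?p) = ?p" "s ` N \<subseteq> svd_domain"
    and sec: "\<And>Z. Z \<in> N \<Longrightarrow> svd_map (s Z) = Z"
    by (rule svd_smooth_section[OF p]) (rule that)
  have sN: "s Y \<in> svd_domain" if "Y \<in> N" for Y using N(5) that by blast
  define f where "f Y = snd (snd (s Y))" for Y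
  have ZN: "Z \<in> N" using N(2) q(2) by simp
  have fZ: "f Z = x" using N(4) q(2) by (simp add: f_def)
  have smf: "smooth_on N f" unfolding f_def by (intro smooth_on_snd N(3))
  have df: "(f has_derivative frechet_derivative f (at Z)) (at Z)" by (rule smooth_on_has_derivative[OF smf N(1) ZN])
  \<comment> \<open>A family of matrices with prescribed singular values; \<open>f (c y) =
    y\<close> for \<open>y\<close> near \<open>x\<close>.\<close>
  define c where "c y = svd_map (fst q, snd q, y)" for y
  have smc: "smooth_on T c" for T unfolding c_def svd_map_eq fst_conv snd_conv
    by (intro smooth_on_bilinear[OF bounded_bilinear_matrix_mult] smooth_on_const
        smooth_on_linear[OF bounded_linear_diag_complex_vec])
  have cx: "c x = Z" by (simp add: c_def q(2))
  have dc: "(c has_derivative frechet_derivative c (at x)) (at x)"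
    by (rule smooth_on_has_derivative[OF smc[of UNIV] open_UNIV UNIV_I])
  define B where "B = c -` N \<inter> decreasing_cone"
  have oB: "open B" unfolding B_def
    using N(1) smooth_on_imp_continuous_on[OF smc[of UNIV]] by (intro open_Int open_vimage open_decreasing_cone)
  have xB: "x \<in> B" using x ZN by (simp add: B_def cx)
  have fc: "f (c y) = y" if "y \<in> B" for y
  proof -
    have y: "c y \<in> N" "y \<in> decreasing_cone" using that by (simp_all add: B_def)
    have "(fst q, snd q, y) \<in> svd_domain" using q(1) y(2) by auto
    from svd_map_eq_imp_same_values[OF this sN[OF y(1)]] sec[OF y(1)] show ?thesis by (simp add: f_def c_def)
  qed
  have "((\<lambda>y. f (c y)) has_derivative (\<lambda>v. frechet_derivative f (at Z) (frechet_derivative c (at x) v))) (at x)"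
    by (rule has_derivative_compose[OF dc]) (simp only: cx df)
  then have "((\<lambda>y. y) has_derivative (\<lambda>v. frechet_derivative f (at Z) (frechet_derivative c (at x) v))) (at x)"
    by (rule has_derivative_transform_within_open[OF _ oB xB fc])
  then have e: "(\<lambda>v. frechet_derivative f (at Z) (frechet_derivative c (at x) v)) = (\<lambda>v. v)"
    by (rule has_derivative_unique[OF _ has_derivative_ident])
  have surj: "surj (frechet_derivative f (at Z))"
    by (rule surjI[of _ "frechet_derivative c (at x)"]) (rule fun_cong[OF e])
  show "\<exists>(A, \<phi>)\<in>charts (embedded_mfd (isospectral x) :: ('n cmat, 'n quot_index rvec) mfd). Z \<in> A"
  proof (rule level_set_chart[OF N(1) ZN smf df surj])
    have "CARD('n) \<le> 2 * CARD('n) ^ 2" by (simp add: power2_eq_square)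
    then show "DIM('n cmat) = DIM('n rvec) + DIM('n quot_index rvec)"
      by (simp add: card_quot_index power2_eq_square)
    have "Y \<in> isospectral x \<longleftrightarrow> f Y = x" if "Y \<in> N" for Y
      using isospectral_iff[OF sN[OF that] x] sec[OF that] by (simp add: f_def)
    then show "isospectral x \<inter> N = {Y \<in> N. f Y = f Z}" unfolding fZ by blast
  qed
qed

text \<open>The orbit space is identified with \<open>isospectral x\<close> for a fixed \<open>x\<close>
  and receives its manifold structure. The orbit map is a submersion since sections of
  \<open>svd_map\<close>, restricted to \<open>isospectral x\<close>, are sections of it. It
  is a quotient map because it is a continuous map from a compact space onto a Hausdorff
  space.\<close>
lemma quotient_manifold_exists:
  "\<exists>Q :: (('n::{finite,linorder} cmat \<times> 'n cmat) set, 'n quot_index rvec) mfd. quotient_manifold torus UU_mfd UU_act Q"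
proof -
  obtain x :: "'n rvec" where x: "x \<in> decreasing_cone" using decreasing_cone_nonempty by (elim exE)
  define S where "S = isospectral x"
  let ?S = "embedded_mfd S :: ('n cmat, 'n quot_index rvec) mfd"
  define X where "X = orbits torus (UU :: ('n cmat \<times> 'n cmat) set) UU_act"
  define j where "j q = svd_hat (q, x)" for q :: "('n cmat \<times> 'n cmat) set"
  let ?o = "orbit torus UU_act :: 'n cmat \<times> 'n cmat \<Rightarrow> _"
  have mS: "submanifold_atlas ?S S" unfolding S_def by (rule submanifold_isospectral[OF x])
  note aS = submanifold_atlas_imp_atlas[OF mS] and aU = submanifold_atlas_imp_atlas[OF submanifold_UU]
  have jo: "j (?o p) = svd_map (fst p, snd p, x)" if "p \<in> UU" for p
    unfolding j_def by (rule svd_hat_orbit[OF that x])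
  have oX: "?o ` UU = X" unfolding X_def by (rule orbit_image)
  have "j ` X = S" unfolding oX[symmetric] image_image S_def isospectral_def by (rule image_cong[OF refl jo])
  moreover have "inj_on j X"
  proof (rule inj_onI)
    fix a b assume ab: "a \<in> X" "b \<in> X" "j a = j b"
    then have "(a, x) = (b, x)"
      by (intro inj_onD[OF bij_betw_imp_inj_on[OF bij_betw_svd_hat]]) (simp_all add: X_def j_def x)
    then show "a = b" by simp
  qed
  ultimately have j: "bij_betw j X (topspace (mtop ?S))"
    by (simp add: bij_betw_def submanifold_atlas_mtop[OF mS])
  have smjo: "smooth_map UU_mfd ?S (j \<circ> ?o)"
  proof (rule smooth_map_submanifold[OF submanifold_UU mS])
    have "smooth_on UU (\<lambda>p. svd_map (fst p, snd p, x))"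
      by (rule smooth_on_compose[OF _ smooth_on_svd_map[of UNIV]])
        (intro smooth_on_Pair smooth_on_fst smooth_on_snd smooth_on_ident smooth_on_const, simp)
    then show "smooth_on UU (j \<circ> ?o)" by (rule smooth_on_cong) (simp add: jo)
    show "(j \<circ> ?o) ` UU \<subseteq> S" using \<open>j ` X = S\<close> oX by auto
  qed
  have "submersion UU_mfd ?S (j \<circ> ?o)"
  proof (rule submersionI[OF aU aS smjo])
    show "(j \<circ> ?o) ` topspace (mtop UU_mfd) = topspace (mtop ?S)"
      unfolding topspace_UU image_comp[symmetric] oX \<open>j ` X = S\<close> by (simp add: submanifold_atlas_mtop[OF mS])
    fix p :: "'n cmat \<times> 'n cmat" assume "p \<in> topspace (mtop UU_mfd)"
    then have pU: "p \<in> UU" by (simp only: topspace_UU)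
    let ?p = "(fst p, snd p, x)"
    have p: "?p \<in> svd_domain" using pU x by auto
    obtain N s where N: "open N" "svd_map ?p \<in> N" "smooth_on N s" "s (svd_map ?p) = ?p" "s ` N \<subseteq> svd_domain"
      and sec: "\<And>Z. Z \<in> N \<Longrightarrow> svd_map (s Z) = Z"
      by (rule svd_smooth_section[OF p]) (rule that)
    have sN: "s Y \<in> svd_domain" if "Y \<in> N" for Y using N(5) that by blast
    have sU: "(fst (s Y), fst (snd (s Y))) \<in> UU" if "Y \<in> N" for Y
      using sN[OF that] by (cases "s Y") simp
    define t where "t Y = (fst (s Y), fst (snd (s Y)))" for Y
    have oN: "openin (top_of_set S) (S \<inter> N)" using N(1) by (rule openin_open_Int)
    have "smooth_on N t" unfolding t_def by (intro smooth_on_Pair smooth_on_fst smooth_on_snd N(3))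
    then have "smooth_on (S \<inter> N) t" by (rule smooth_on_subset) simp
    then have "smooth_map (open_mfd ?S (S \<inter> N)) UU_mfd t"
    proof (rule smooth_map_submanifold[OF submanifold_atlas_open_mfd[OF mS oN] submanifold_UU])
      show "t ` (S \<inter> N) \<subseteq> UU"
      proof (rule image_subsetI)
        fix Y assume "Y \<in> S \<inter> N"
        then show "t Y \<in> UU" unfolding t_def by (intro sU) simp
      qed
    qed
    moreover have "(j \<circ> ?o) p = svd_map ?p" using jo[OF pU] by simp
    moreover have "svd_map ?p \<in> S"
      unfolding S_def isospectral_def using pU by (rule imageI)
    moreover have "t (svd_map ?p) = p" unfolding t_def N(4) by simp
    moreover have "(j \<circ> ?o) (t Y) = Y" if "Y \<in> S \<inter> N" for Y
    proof -
      have Y: "Y \<in> N" "svd_map (s Y) \<in> isospectral x" using that sec[of Y] by (simp_all add: S_def)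
      have "snd (snd (s Y)) = x" using isospectral_iff[OF sN[OF Y(1)] x] Y(2) by simp
      then have "(fst (t Y), snd (t Y), x) = s Y" by (simp add: t_def prod_eq_iff)
      moreover have "t Y \<in> UU" unfolding t_def by (rule sU[OF Y(1)])
      ultimately show ?thesis using jo[of "t Y"] sec[OF Y(1)] by simp
    qed
    ultimately have "smooth_section_at UU_mfd ?S (j \<circ> ?o) p (S \<inter> N) t"
      using oN N(2) unfolding smooth_section_at_def submanifold_atlas_mtop[OF mS] by simp
    then show "\<exists>W s. smooth_section_at UU_mfd ?S (j \<circ> ?o) p W s" by (intro exI)
  qed
  then have sub: "submersion UU_mfd (transport_mfd X j ?S) ?o"
    by (rule submersion_transport_mfd[OF aU j oX[folded topspace_UU]])
  have mQ: "smooth_manifold (transport_mfd X j ?S)"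
    by (rule smooth_manifold_transport_mfd[OF submanifold_atlas_imp_manifold[OF mS] j])
  have tQ: "topspace (mtop (transport_mfd X j ?S)) = X" by (rule topspace_transport_mfd[OF j])
  have "quotient_map (mtop UU_mfd) (mtop (transport_mfd X j ?S)) ?o"
  proof (rule continuous_closed_imp_quotient_map)
    show c: "continuous_map (mtop UU_mfd) (mtop (transport_mfd X j ?S)) ?o"
      using sub unfolding submersion_def smooth_map_def by (elim conjE)
    have "compact_space (mtop (UU_mfd :: ('n cmat \<times> 'n cmat, _) mfd))"
      unfolding submanifold_atlas_mtop[OF submanifold_UU]
      by (rule compact_space_subtopology) (simp add: compact_Times compact_unitary_group)
    moreover have "Hausdorff_space (mtop (transport_mfd X j ?S))"
      using mQ unfolding smooth_manifold_def by (elim conjE)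
    ultimately show "closed_map (mtop UU_mfd) (mtop (transport_mfd X j ?S)) ?o"
      using c by (intro continuous_imp_closed_map_gen Hausdorff_imp_kc_space)
    show "?o ` topspace (mtop UU_mfd) = topspace (mtop (transport_mfd X j ?S))"
      unfolding topspace_UU tQ by (rule oX)
  qed
  then have "quotient_manifold torus UU_mfd UU_act (transport_mfd X j ?S)"
    unfolding quotient_manifold_def topspace_UU using mQ tQ sub by (simp only: X_def simp_thms)
  then show ?thesis by (rule exI)
qed

section \<open>The principal bundle of singular value decompositions\<close>

theorem proposition3p1:
  shows
    "submersion UUR_mfd regular_mfd
       (svd_map :: ('n::{finite,linorder}) cmat \<times> 'n cmat \<times> 'n rvec \<Rightarrow> 'n cmat) \<and>
     proper_action (torus_mfd :: ('n cvec, _) mfd) UUR_mfd UUR_act \<and>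
     free_action (torus :: 'n cvec monoid) (topspace (mtop UUR_mfd)) UUR_act \<and>
     (\<forall>Z\<in>(regular_matrices :: 'n cmat set).
        {p \<in> topspace (mtop UUR_mfd). svd_map p = Z}
          \<in> orbits torus (topspace (mtop UUR_mfd)) UUR_act) \<and>
     principal_bundle torus torus_mfd UUR_mfd regular_mfd
       (svd_map :: 'n cmat \<times> 'n cmat \<times> 'n rvec \<Rightarrow> 'n cmat) UUR_act \<and>
     (\<exists>Q :: (('n cmat \<times> 'n cmat) set, 'n quot_index rvec) mfd.
        quotient_manifold torus UU_mfd UU_act Q) \<and>
     (\<forall>Q :: (('n cmat \<times> 'n cmat) set, 'n quot_index rvec) mfd.
        quotient_manifold torus UU_mfd UU_act Q \<longrightarrow>
        (\<exists>\<phi>'. diffeomorphism (prod_mfd Q cone_mfd) regular_mfd \<phi>' \<and>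
           (\<forall>U\<in>unitary_group. \<forall>V\<in>unitary_group. \<forall>x\<in>decreasing_cone.
              \<phi>' (orbit torus UU_act (U, V), x) = U ** diag_mat (complex_vec x) ** V)))"
proof (intro conjI allI impI)
  show "submersion UUR_mfd regular_mfd (svd_map :: 'n cmat \<times> 'n cmat \<times> 'n rvec \<Rightarrow> 'n cmat)"
    by (rule submersion_svd)
  show "proper_action (torus_mfd :: ('n cvec, _) mfd) UUR_mfd UUR_act" by (rule proper_action_UUR)
  show "free_action (torus :: 'n cvec monoid) (topspace (mtop UUR_mfd)) UUR_act"
    unfolding topspace_UUR by (rule free_action_UUR)
  show "\<forall>Z\<in>(regular_matrices :: 'n cmat set). {p \<in> topspace (mtop UUR_mfd). svd_map p = Z}
          \<in> orbits torus (topspace (mtop UUR_mfd)) UUR_act"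
    unfolding topspace_UUR by (intro ballI svd_fibers_are_orbits)
  show "principal_bundle torus torus_mfd UUR_mfd regular_mfd
       (svd_map :: 'n cmat \<times> 'n cmat \<times> 'n rvec \<Rightarrow> 'n cmat) UUR_act"
    by (rule principal_bundle_svd)
  show "\<exists>Q :: (('n cmat \<times> 'n cmat) set, 'n quot_index rvec) mfd. quotient_manifold torus UU_mfd UU_act Q"
    by (rule quotient_manifold_exists)
  fix Q :: "(('n cmat \<times> 'n cmat) set, 'n quot_index rvec) mfd"
  assume "quotient_manifold torus UU_mfd UU_act Q"
  then have "diffeomorphism (prod_mfd Q cone_mfd) regular_mfd svd_hat" by (rule svd_hat_diffeomorphism)
  moreover have "svd_hat (orbit torus UU_act (U, V), x) = U ** diag_mat (complex_vec x) ** V"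
    if "U \<in> unitary_group" "V \<in> unitary_group" "x \<in> decreasing_cone" for U V :: "'n cmat" and x
    using svd_hat_orbit[of "(U, V)" x] that by (simp add: svd_map_def)
  ultimately show "\<exists>\<phi>'. diffeomorphism (prod_mfd Q cone_mfd) regular_mfd \<phi>' \<and>
           (\<forall>U\<in>unitary_group. \<forall>V\<in>unitary_group. \<forall>x\<in>decreasing_cone.
              \<phi>' (orbit torus UU_act (U, V), x) = U ** diag_mat (complex_vec x) ** V)"
    by (intro exI[of _ svd_hat] conjI ballI)
qed

end
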